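(* Let $m\ge1$ be an integer and $0<\alpha<mn$. Let $0<p_i,p_i^k,q_i,q_i^k<\infty$ ($i=1,\dots,n$, $k=1,\dots,m$) be such that $$\frac1{p_i}=\sum_{k=1}^m\frac1{p_i^k},\qquad \frac1{q_i}=\sum_{k=1}^m\frac1{q_i^k}\qquad(i=1,\dots,n),$$ and write $\vec{p_k}=(p_1^k,\dots,p_n^k)$, $\vec{q_k}=(q_1^k,\dots,q_n^k)$, $\vec q=(q_1,\dots,q_n)$. Suppose that $$\vec{q_k}=\Big(\frac{mn\,p_1^k}{mn-\alpha p_1^k},\dots,\frac{mn\,p_n^k}{mn-\alpha p_n^k}\Big)\in(0,\infty)^n\qquad(k=1,\dots,m).$$ Then the multilinear fractional integral operator $\mathcal T_\alpha$ can be extended to a bounded operator from $H^{\vec{p_1}}\times\cdots\times H^{\vec{p_m}}$ into $L^{\vec q}$.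
   Context: **Operator.** For $0<\alpha<mn$ and functions on $\mathbb R^n$, $$\mathcal T_\alpha(f_1,\dots,f_m)(x)=\int_{(\mathbb R^n)^m}\frac{1}{|(y_1,\dots,y_m)|^{mn-\alpha}}\prod_{k=1}^m f_k(x-y_k)\,dy_1\cdots dy_m .$$ "Can be extended to a bounded operator from $H_{X_1}\times\cdots\times H_{X_m}$ into $Y$" means: there are $C>0$, $d\in\mathbb Z_+$ and an $m$-linear operator $T:H_{X_1}\times\cdots\times H_{X_m}\to Y$ with $\|T(f_1,\dots,f_m)\|_Y\le C\prod_k\|f_k\|_{H_{X_k}}$ that agrees with $\mathcal T_\alpha$ whenever all $f_k$ are finite linear combinations of $(X_k,\infty,d)$-atoms. An $(X,\infty,d)$-atom is a measurable function $a$ supported in a cube $Q$ with $\|a\|_{L^\infty}\le \|\chi_Q\|_X^{-1}$ and $\int a(x)x^{\beta}dx=0$ for all multi-indices $|\beta|\le d$. Here $X_k=L^{\vec{p_k}}$, $Y=L^{\vec q}$. **Spaces.** For $\vec p=(p_1,\dots,p_n)\in(0,\infty)^n$, the mixed-norm Lebesgue space $L^{\vec p}(\mathbb R^n)$ is the set of measurable $f$ on $\mathbb R^n$ with $$\|f\|_{L^{\vec p}}=\Big\{\int_{\mathbb R}\cdots\Big[\int_{\mathbb R}|f(x_1,\dots,x_n)|^{p_1}dx_1\Big]^{p_2/p_1}\cdots dx_n\Big\}^{1/p_n}<\infty .$$ For a sufficiently large fixed integer $N$, let $\mathcal F_N=\{\varphi\in\mathcal S(\mathbb R^n):\sum_{|\beta|\le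 N}\sup_x(1+|x|)^N|\partial^\beta\varphi(x)|\le1\}$ and, for $f\in\mathcal S'(\mathbb R^n)$, $\mathcal M_Nf(x)=\sup\{|\psi_t*f(x)|:t>0,\psi\in\mathcal F_N\}$, $\psi_t(x)=t^{-n}\psi(x/t)$. For $X=L^{\vec p}$, the mixed-norm Hardy space $H^{\vec p}=H_X$ is the set of $f\in\mathcal S'$ with $\|f\|_{H_X}:=\|\mathcal M_Nf\|_X<\infty$. *)

theory Defs
  imports "HOL-Analysis.Analysis"
begin

text \<open>
  Functions and distributions on \<open>\<real>\<^sup>n\<close> are complex valued.  \<open>\<real>\<^sup>n\<close> is \<^typ>\<open>real^'n\<close> with \<open>n = CARD('n)\<close>;
  the linear order on the index type fixes which coordinate is the first, the second, and so on,
  as needed for mixed norms.  The \<open>m\<close>-fold product of \<open>\<real>\<^sup>n\<close> is \<^typ>\<open>real^'n^'m\<close>, whose norm is the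
  Euclidean norm of \<open>\<real>\<^bsup>mn\<^esup>\<close>.  ``Measurable'' means Lebesgue measurable.
\<close>

type_synonym 'n rvec = "(real, 'n) vec"


section \<open>Mixed-norm Lebesgue spaces\<close>

definition ennreal_powr :: "ennreal \<Rightarrow> real \<Rightarrow> ennreal" where
  "ennreal_powr a r = (if a = \<infinity> then \<infinity> else ennreal (enn2real a powr r))"

definition coord_norm ::
    "real \<Rightarrow> 'n::finite \<Rightarrow> ('n rvec \<Rightarrow> ennreal) \<Rightarrow> 'n rvec \<Rightarrow> ennreal" where
  "coord_norm r i F x =
     ennreal_powr
       (\<integral>\<^sup>+t. ennreal_powr (F (\<chi> j. if j = i then t else x $ j)) r \<partial>(lebesgue :: real measure))
       (1 / r)"

text \<open>
  The list of coordinates is traversed in increasing order, so the first coordinate is the innermost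
  integration.  The final function is constant, hence the evaluation at \<open>0\<close>.
\<close>

definition mixed_norm ::
    "('n::{finite,linorder} \<Rightarrow> real) \<Rightarrow> ('n rvec \<Rightarrow> ennreal) \<Rightarrow> ennreal" where
  "mixed_norm p F = fold (\<lambda>i. coord_norm (p i) i) (sorted_list_of_set UNIV) F 0"

definition Lp_norm ::
    "('n::{finite,linorder} \<Rightarrow> real) \<Rightarrow> ('n rvec \<Rightarrow> complex) \<Rightarrow> ennreal" where
  "Lp_norm p f = mixed_norm p (\<lambda>x. ennreal (cmod (f x)))"

definition Lp_space ::
    "('n::{finite,linorder} \<Rightarrow> real) \<Rightarrow> ('n rvec \<Rightarrow> complex) set" where
  "Lp_space p = {f. f \<in> borel_measurable lebesgue \<and> Lp_norm p f < \<infinity>}"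


section \<open>Schwartz functions and tempered distributions\<close>

definition partial :: "'n::finite \<Rightarrow> ('n rvec \<Rightarrow> complex) \<Rightarrow> 'n rvec \<Rightarrow> complex" where
  "partial i f x = vector_derivative (\<lambda>t. f (x + t *\<^sub>R axis i 1)) (at 0)"

definition smooth :: "('n::finite rvec \<Rightarrow> complex) \<Rightarrow> bool" where
  "smooth f \<longleftrightarrow> (\<forall>is x. (fold partial is f) differentiable (at x))"

definition multi_partial ::
    "('n::{finite,linorder} \<Rightarrow> nat) \<Rightarrow> ('n rvec \<Rightarrow> complex) \<Rightarrow> 'n rvec \<Rightarrow> complex" where
  "multi_partial \<beta> f = fold (\<lambda>i. partial i ^^ \<beta> i) (sorted_list_of_set UNIV) f"

definition schwartz :: "(('n::{finite,linorder}) rvec \<Rightarrow> complex) set" where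
  "schwartz = {\<phi>. smooth \<phi> \<and>
     (\<forall>N \<beta>. bdd_above (range (\<lambda>x. (1 + norm x) ^ N * cmod (multi_partial \<beta> \<phi> x))))}"

definition schwartz_norm :: "nat \<Rightarrow> (('n::{finite,linorder}) rvec \<Rightarrow> complex) \<Rightarrow> real" where
  "schwartz_norm N \<phi> =
     (\<Sum>\<beta> | (\<Sum>i\<in>UNIV. \<beta> i) \<le> N. SUP x. (1 + norm x) ^ N * cmod (multi_partial \<beta> \<phi> x))"

type_synonym 'n distribution = "('n rvec \<Rightarrow> complex) \<Rightarrow> complex"

text \<open>
  Continuity of a linear functional is expressed by the seminorms \<^term>\<open>schwartz_norm N\<close>, which are
  increasing in \<open>N\<close> and generate the topology of the Schwartz space.  A functional is extended by \<open>0\<close>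
  to non-Schwartz functions, so that distinct members of the set below are distinct distributions.
\<close>

definition tempered :: "'n::{finite,linorder} distribution set" where
  "tempered = {u.
     (\<forall>\<phi>. \<phi> \<notin> schwartz \<longrightarrow> u \<phi> = 0) \<and>
     (\<forall>\<phi>\<in>schwartz. \<forall>\<psi>\<in>schwartz. \<forall>a b. u (\<lambda>x. a * \<phi> x + b * \<psi> x) = a * u \<phi> + b * u \<psi>) \<and>
     (\<exists>C N. \<forall>\<phi>\<in>schwartz. cmod (u \<phi>) \<le> C * schwartz_norm N \<phi>)}"

definition distr_of :: "(('n::{finite,linorder}) rvec \<Rightarrow> complex) \<Rightarrow> 'n distribution" where
  "distr_of f = (\<lambda>\<phi>. if \<phi> \<in> schwartz then (LINT x|lebesgue. f x * \<phi> x) else 0)"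


section \<open>Mixed-norm Hardy spaces\<close>

definition dilate :: "real \<Rightarrow> ('n::finite rvec \<Rightarrow> complex) \<Rightarrow> 'n rvec \<Rightarrow> complex" where
  "dilate t \<psi> = (\<lambda>x. complex_of_real (1 / t ^ CARD('n)) * \<psi> (x /\<^sub>R t))"

definition convolve :: "('n::finite rvec \<Rightarrow> complex) \<Rightarrow> 'n distribution \<Rightarrow> 'n rvec \<Rightarrow> complex" where
  "convolve \<psi> u x = u (\<lambda>y. \<psi> (x - y))"

definition grand_maximal :: "nat \<Rightarrow> 'n::{finite,linorder} distribution \<Rightarrow> 'n rvec \<Rightarrow> ennreal" where
  "grand_maximal N u x =
     (SUP (t, \<psi>) \<in> {0<..} \<times> {\<psi> \<in> schwartz. schwartz_norm N \<psi> \<le> 1}.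
        ennreal (cmod (convolve (dilate t \<psi>) u x)))"

definition hardy_norm ::
    "nat \<Rightarrow> ('n::{finite,linorder} \<Rightarrow> real) \<Rightarrow> 'n distribution \<Rightarrow> ennreal" where
  "hardy_norm N p u = mixed_norm p (grand_maximal N u)"

definition hardy_space ::
    "nat \<Rightarrow> ('n::{finite,linorder} \<Rightarrow> real) \<Rightarrow> 'n distribution set" where
  "hardy_space N p = {u \<in> tempered. hardy_norm N p u < \<infinity>}"


section \<open>Atoms\<close>

definition cube :: "('n::finite rvec) set \<Rightarrow> bool" where
  "cube Q \<longleftrightarrow> (\<exists>c l. 0 < l \<and> Q = cbox c (c + (\<chi> i. l)))"

definition atom ::
    "('n::{finite,linorder} \<Rightarrow> real) \<Rightarrow> nat \<Rightarrow> ('n rvec \<Rightarrow> complex) \<Rightarrow> bool" where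
  "atom p d a \<longleftrightarrow> a \<in> borel_measurable lebesgue \<and>
     (\<exists>Q. cube Q \<and> (\<forall>x. x \<notin> Q \<longrightarrow> a x = 0) \<and>
        (AE x in lebesgue. ennreal (cmod (a x)) \<le> inverse (Lp_norm p (indicator Q)))) \<and>
     (\<forall>\<beta> :: 'n \<Rightarrow> nat. (\<Sum>i\<in>UNIV. \<beta> i) \<le> d \<longrightarrow>
        (LINT x|lebesgue. a x * complex_of_real (\<Prod>i\<in>UNIV. (x $ i) ^ \<beta> i)) = 0)"

definition atomic_sums ::
    "('n::{finite,linorder} \<Rightarrow> real) \<Rightarrow> nat \<Rightarrow> ('n rvec \<Rightarrow> complex) set" where
  "atomic_sums p d =
     {f. \<exists>(J::nat) c a. (\<forall>j<J. atom p d (a j)) \<and> f = (\<lambda>x. \<Sum>j<J. c j * a j x)}"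


section \<open>The multilinear fractional integral operator and its extensions\<close>

definition frac_int ::
    "real \<Rightarrow> ('m::finite \<Rightarrow> 'n::finite rvec \<Rightarrow> complex) \<Rightarrow> 'n rvec \<Rightarrow> complex" where
  "frac_int \<alpha> f x =
     (LINT y|(lebesgue :: ('n rvec, 'm) vec measure).
        complex_of_real (1 / norm y powr (real CARD('m) * real CARD('n) - \<alpha>)) *
        (\<Prod>k\<in>UNIV. f k (x - y $ k)))"

text \<open>
  Elements of the target space are functions modulo null sets, so multilinearity and agreement are
  required almost everywhere.  The last clause includes that finite sums of atoms belong to the
  Hardy spaces (as distributions), without which the agreement would not make sense.
\<close>

definition extends_to_bounded_operator ::
    "(('m::finite \<Rightarrow> 'n rvec \<Rightarrow> complex) \<Rightarrow> 'n rvec \<Rightarrow> complex) \<Rightarrow>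
     ('m \<Rightarrow> nat) \<Rightarrow> ('m \<Rightarrow> 'n::{finite,linorder} \<Rightarrow> real) \<Rightarrow> ('n \<Rightarrow> real) \<Rightarrow> bool" where
  "extends_to_bounded_operator S N P q \<longleftrightarrow>
     (\<exists>(C::real) (d::nat) (T :: ('m \<Rightarrow> 'n distribution) \<Rightarrow> 'n rvec \<Rightarrow> complex). 0 < C \<and>
        (\<forall>f. (\<forall>k. f k \<in> hardy_space (N k) (P k)) \<longrightarrow>
           T f \<in> Lp_space q \<and>
           Lp_norm q (T f) \<le> ennreal C * (\<Prod>k\<in>UNIV. hardy_norm (N k) (P k) (f k))) \<and>
        (\<forall>f k u v a b. (\<forall>j. f j \<in> hardy_space (N j) (P j)) \<longrightarrow>
           u \<in> hardy_space (N k) (P k) \<longrightarrow> v \<in> hardy_space (N k) (P k) \<longrightarrow>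
           (AE x in lebesgue. T (f(k := (\<lambda>\<phi>. a * u \<phi> + b * v \<phi>))) x
              = a * T (f(k := u)) x + b * T (f(k := v)) x)) \<and>
        (\<forall>f. (\<forall>k. f k \<in> atomic_sums (P k) d) \<longrightarrow>
           (\<forall>k. distr_of (f k) \<in> hardy_space (N k) (P k)) \<and>
           (AE x in lebesgue. T (\<lambda>k. distr_of (f k)) x = S f x)))"

end

theory Submission
  imports Defs
begin

text \<open>
  With \<open>b = mn - \<alpha>\<close> one has \<open>|y|\<^sup>-\<^sup>b = \<Gamma>(b/2)\<^sup>-\<^sup>1 \<integral>\<^sub>0\<^sup>\<infinity> s\<^bsup>b/2-1\<^esup> exp(-s|y|\<^sup>2) ds\<close>, and the Gaussian on
  \<open>\<real>\<^bsup>mn\<^esup>\<close> is a product of Gaussians on \<open>\<real>\<^sup>n\<close>.  Hence the operator extends to all tempered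
  distributions for which
  \<open>T(f\<^sub>1,...,f\<^sub>m)(x) = \<Gamma>(b/2)\<^sup>-\<^sup>1 \<integral>\<^sub>0\<^sup>\<infinity> s\<^bsup>b/2-1\<^esup> \<Prod>\<^sub>k f\<^sub>k(exp(-s|x-\<cdot>|\<^sup>2)) ds\<close> converges absolutely,
  and no atomic decomposition is needed.  For \<open>2\<^sup>j \<le> s\<^bsup>-1/2\<^esup> < 2\<^bsup>j+1\<^esup>\<close> the \<open>k\<close>-th factor is at most a
  constant times \<open>2\<^bsup>jn\<^esup>\<close> times the infimum \<open>u\<^sub>j\<close> of the grand maximal function of \<open>f\<^sub>k\<close> over the dyadic
  cube of side \<open>2\<^sup>j\<close> around \<open>x\<close>.  So \<open>|T|\<close> is dominated by a product over \<open>k\<close> of sums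
  \<open>\<Sum>\<^sub>j 2\<^bsup>j\<alpha>/m\<^esup> u\<^sub>j\<close>, each of which is estimated by a Hedberg type argument, one coordinate at a time:
  after the norms in the first \<open>i\<close> variables are taken, what remains is an \<open>\<ell>\<^sup>r\<close> sum over \<open>j\<close> of
  \<open>2\<^bsup>j(n-i)\<alpha>/(mn)\<^esup>\<close> times the partial norms of \<open>u\<^sub>j\<close>, which are still constant on dyadic intervals.
  Hoelder's inequality finishes the proof.
\<close>

section \<open>Extended powers and the one-dimensional dyadic embedding\<close>

text \<open>The obstacle is that the exponents vary with the coordinate. Hedberg's pointwise bound
  in all \<open>n\<close> variables at once interpolates with weights \<open>1 - a * p\<close> and
  \<open>a * p\<close>, where \<open>a = \<alpha> / (m * n)\<close>, and these would have to agree
  in all variables. What does agree is the gap \<open>1 / p i - 1 / q i = a\<close>. So the weight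
  \<open>2 powr (j * \<alpha> / m)\<close> is cut into \<open>n\<close> equal factors
  \<open>2 powr (j * a)\<close>, and each variable uses up one of them. The estimate in one variable
  ends in a supremum over \<open>j\<close>, with which the next norm does not commute. It is
  replaced by an \<ell>^r sum; this is affordable because the estimate on a line bounds such a sum,
  for every \<open>r > 0\<close>, by a supremum again. The infimum over dyadic cells makes this
  work: it is constant on cells, hence measurable, controlled at a point by its average over an
  interval, and still constant on intervals after partial norms. Atoms enter only through the
  agreement: bounded support justifies Fubini, and vanishing moments put their sums into the Hardy
  spaces.\<close>

notation ennreal_powr (infixr \<open>powe\<close> 80)

lemma powe_0 [simp]: "0 powe r = 0"
  by (simp add: ennreal_powr_def)

lemma powe_top [simp]: "\<infinity> powe r = \<infinity>" "top powe r = top"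
  by (simp_all add: ennreal_powr_def)

lemma powe_ennreal: "0 \<le> x \<Longrightarrow> ennreal x powe r = ennreal (x powr r)"
  by (simp add: ennreal_powr_def)

lemma powe_one [simp]: "1 powe r = 1"
  using powe_ennreal[of 1 r] by simp

lemma powe_eq_0_iff [simp]: "a powe r = 0 \<longleftrightarrow> a = 0"
  by (cases a rule: ennreal_cases) (auto simp: powe_ennreal)

lemma powe_eq_top_iff [simp]: "a powe r = \<infinity> \<longleftrightarrow> a = \<infinity>" "a powe r = top \<longleftrightarrow> a = top"
  by (cases a rule: ennreal_cases; simp add: powe_ennreal)+

lemma powe_less_top_iff [simp]: "a powe r < \<infinity> \<longleftrightarrow> a < \<infinity>" "a powe r < top \<longleftrightarrow> a < top"
  by (simp_all add: less_top[symmetric])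

lemma powe_mono: "a \<le> b \<Longrightarrow> 0 \<le> r \<Longrightarrow> a powe r \<le> b powe r"
  by (cases a rule: ennreal_cases; cases b rule: ennreal_cases)
     (auto simp: powe_ennreal top_unique intro!: ennreal_leI powr_mono2)

lemma powe_powe: "(a powe r) powe s = a powe (r * s)"
  by (cases a rule: ennreal_cases) (auto simp: powe_ennreal powr_powr)

lemma powe_1 [simp]: "a powe 1 = a"
  by (cases a rule: ennreal_cases) (auto simp: powe_ennreal)

lemma powe_inverse [simp]:
  "0 < r \<Longrightarrow> (a powe r) powe (1 / r) = a" "0 < r \<Longrightarrow> (a powe (1 / r)) powe r = a"
  by (simp_all add: powe_powe)

text \<open>Holds for every real exponent, negative ones included: \<open>powe\<close> fixes 0 and
  \<infinity> whatever the exponent is, and \<open>0 * \<infinity> = 0\<close>.\<close>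

lemma powe_mult: "(a * b) powe r = a powe r * b powe r"
proof (cases "a = 0 \<or> b = 0")
  case False
  then show ?thesis
    by (cases a rule: ennreal_cases; cases b rule: ennreal_cases)
       (auto simp: powe_ennreal powr_mult ennreal_mult_eq_top_iff ennreal_mult[symmetric]
          ennreal_mult_top ennreal_top_mult)
qed auto

lemma powe_add: "a powe (r + s) = a powe r * a powe s"
  by (cases a rule: ennreal_cases) (auto simp: powe_ennreal powr_add ennreal_mult)

lemma powe_prod: "finite A \<Longrightarrow> (\<Prod>k\<in>A. f k) powe r = (\<Prod>k\<in>A. f k powe r)"
  by (induction A rule: finite_induct) (auto simp: powe_mult)

lemma powe_measurable [measurable (raw)]:
  assumes [measurable]: "f \<in> borel_measurable M"
  shows "(\<lambda>x. f x powe r) \<in> borel_measurable M"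
proof -
  have "Measurable.pred M (\<lambda>x. f x = \<infinity>)" by measurable
  then show ?thesis unfolding ennreal_powr_def by measurable
qed

section \<open>Sums over the integers and two-sided geometric series\<close>

abbreviation count_sum :: "('j \<Rightarrow> ennreal) \<Rightarrow> ennreal" (binder \<open>\<Sum>\<^sup>+\<close> 10) where
  "count_sum f \<equiv> nn_integral (count_space UNIV) f"

text \<open>Index 0 lies in both half-lines and is counted twice, hence only an inequality; it
  serves to prove finiteness.\<close>

lemma nn_integral_int_le:
  fixes f :: "int \<Rightarrow> ennreal"
  shows "(\<Sum>\<^sup>+k. f k) \<le> (\<Sum>n. f (int n)) + (\<Sum>n. f (- int n))"
proof -
  let ?A = "range int" and ?B = "range (\<lambda>n. - int n)"
  have "f k \<le> f k * indicator ?A k + f k * indicator ?B k" for k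
  proof (cases "k \<ge> 0")
    case True
    then have "k \<in> ?A" by (metis nonneg_int_cases rangeI)
    then show ?thesis by simp
  next
    case False
    then have "k \<in> ?B" by (metis int_cases2 neg_0_le_iff_le of_nat_0_le_iff rangeI)
    then show ?thesis by simp
  qed
  then have "(\<Sum>\<^sup>+k. f k) \<le>
      (\<Sum>\<^sup>+k. f k * indicator ?A k + f k * indicator ?B k)"
    by (intro nn_integral_mono) auto
  also have "\<dots> = (\<integral>\<^sup>+k\<in>?A. f k \<partial>count_space UNIV) + (\<integral>\<^sup>+k\<in>?B. f k \<partial>count_space UNIV)"
    by (rule nn_integral_add) auto
  also have "(\<integral>\<^sup>+k\<in>?A. f k \<partial>count_space UNIV) = (\<Sum>n. f (int n))"
    by (subst nn_integral_count_compose_inj[symmetric]) (auto simp: nn_integral_count_space_nat)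
  also have "(\<integral>\<^sup>+k\<in>?B. f k \<partial>count_space UNIV) = (\<Sum>n. f (- int n))"
    by (subst nn_integral_count_compose_inj[symmetric])
       (auto simp: nn_integral_count_space_nat inj_on_def)
  finally show ?thesis .
qed

lemma nn_integral_int_geometric_finite:
  assumes "0 < \<delta>"
  shows "(\<Sum>\<^sup>+k. ennreal (2 powr (- \<delta> * \<bar>real_of_int k\<bar>))) < \<infinity>"
proof -
  have lt: "(2::real) powr (- \<delta>) < 1"
    using assms by (simp add: powr_less_one)
  have "2 powr (- \<delta> * real n) = (2 powr (- \<delta>)) ^ n" for n
    by (simp add: powr_powr powr_realpow[symmetric])
  then have "(\<Sum>n. ennreal (2 powr (- \<delta> * real n))) < \<infinity>"
    using summable_geometric[of "2 powr (- \<delta>)"] lt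
    by (simp add: less_top ennreal_suminf_neq_top)
  then have "(\<Sum>n. ennreal (2 powr (- \<delta> * \<bar>real_of_int (int n)\<bar>))) +
     (\<Sum>n. ennreal (2 powr (- \<delta> * \<bar>real_of_int (- int n)\<bar>))) < \<infinity>"
    by simp
  then show ?thesis
    by (rule order.strict_trans1[OF nn_integral_int_le])
qed

text \<open>Shape of the term \<open>2 powr (j * a) * min s (2 powr (- j / p) * B)\<close> once
  \<open>j\<close> has been shifted so that the two bounds balance near \<open>k = 0\<close>. The
  exponent has \<open>1 - k\<close> and not \<open>- k\<close> because the balancing scale is
  rounded down to an integer power of 2.\<close>

abbreviation dyadic_weight :: "real \<Rightarrow> real \<Rightarrow> int \<Rightarrow> real" where
  "dyadic_weight a p k \<equiv> 2 powr (real_of_int k * a) * min 1 (2 powr ((1 - real_of_int k) / p))"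

definition dyadic_const :: "real \<Rightarrow> real \<Rightarrow> real \<Rightarrow> ennreal" where
  "dyadic_const a p r =
     (\<Sum>\<^sup>+k. ennreal (dyadic_weight a p k) powe r)"

lemma dyadic_const_pos: "dyadic_const a p r > 0" if "0 < p"
proof -
  have "0 < ennreal (dyadic_weight a p 0) powe r"
    using that by (simp add: powe_ennreal)
  also have "\<dots> \<le> dyadic_const a p r"
    unfolding dyadic_const_def by (rule nn_integral_ge_point) simp
  finally show ?thesis .
qed

text \<open>Geometric decay on both sides: the exponent is \<open>k * a\<close> for \<open>k\<close>
  towards minus infinity and \<open>k * (a - 1 / p)\<close>, up to a constant, towards plus
  infinity. The second one decreases because \<open>a * p < 1\<close>.\<close>

lemma dyadic_const_finite:
  assumes "0 < a" "0 < p" "a * p < 1" "0 < r"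
  shows "dyadic_const a p r < \<infinity>"
proof -
  \<comment> \<open>The smaller of the two decay rates, times \<open>r\<close> for the
    \<open>r\<close>-th power.\<close>
  define \<delta> where "\<delta> = r * min a (1 / p - a)"
  have ap: "a < 1 / p" using assms by (simp add: field_simps)
  have "0 < \<delta>" using assms ap by (simp add: \<delta>_def)
  \<comment> \<open>Pays for the shift by 1 in \<open>dyadic_weight\<close>.\<close>
  let ?c = "ennreal (2 powr (r / p))"
  have le: "ennreal (dyadic_weight a p k) powe r
      \<le> ?c * ennreal (2 powr (- \<delta> * \<bar>real_of_int k\<bar>))" for k
  proof -
    have "dyadic_weight a p k
        \<le> 2 powr (1 / p - (\<delta> / r) * \<bar>real_of_int k\<bar>)"
    proof (cases "k \<le> 0")
      case True
      have "dyadic_weight a p k \<le> 2 powr (real_of_int k * a)"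
        by (simp add: mult_left_le)
      also have "\<dots> \<le> 2 powr (1 / p - (\<delta> / r) * \<bar>real_of_int k\<bar>)"
      proof (rule powr_mono)
        have "(\<delta> / r) * \<bar>real_of_int k\<bar> \<le> a * \<bar>real_of_int k\<bar>"
          using assms by (intro mult_right_mono) (auto simp: \<delta>_def)
        then have "real_of_int k * a \<le> - ((\<delta> / r) * \<bar>real_of_int k\<bar>)"
          using True by (simp add: mult.commute)
        moreover have "0 < 1 / p" using assms by simp
        ultimately show "real_of_int k * a \<le> 1 / p - (\<delta> / r) * \<bar>real_of_int k\<bar>"
          by linarith
      qed simp
      finally show ?thesis .
    next
      case False
      have "dyadic_weight a p k \<le>
          2 powr (real_of_int k * a) * 2 powr ((1 - real_of_int k) / p)"
        by (intro mult_left_mono) auto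
      also have "\<dots> = 2 powr (real_of_int k * a + (1 - real_of_int k) / p)"
        by (simp add: powr_add)
      also have "\<dots> \<le> 2 powr (1 / p - (\<delta> / r) * \<bar>real_of_int k\<bar>)"
      proof (rule powr_mono)
        have "(\<delta> / r) * \<bar>real_of_int k\<bar> \<le> (1 / p - a) * \<bar>real_of_int k\<bar>"
          using assms by (intro mult_right_mono) (auto simp: \<delta>_def)
        then show "real_of_int k * a + (1 - real_of_int k) / p \<le> 1 / p - (\<delta> / r) * \<bar>real_of_int k\<bar>"
          using False by (simp add: algebra_simps diff_divide_distrib)
      qed simp
      finally show ?thesis .
    qed
    then have "ennreal (dyadic_weight a p k) powe r
       \<le> ennreal (2 powr (1 / p - (\<delta> / r) * \<bar>real_of_int k\<bar>)) powe r"
      using assms by (intro powe_mono ennreal_leI) auto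
    also have "\<dots> = ennreal (2 powr ((1 / p - (\<delta> / r) * \<bar>real_of_int k\<bar>) * r))"
      by (simp add: powe_ennreal powr_powr)
    also have "(1 / p - (\<delta> / r) * \<bar>real_of_int k\<bar>) * r = r / p + (- \<delta> * \<bar>real_of_int k\<bar>)"
      using assms by (simp add: field_simps)
    finally show ?thesis by (simp add: powr_add[symmetric] ennreal_mult[symmetric])
  qed
  have "dyadic_const a p r \<le> (\<Sum>\<^sup>+k. ?c * ennreal (2 powr (- \<delta> * \<bar>real_of_int k\<bar>)))"
    unfolding dyadic_const_def by (intro nn_integral_mono le)
  also have "\<dots> = ?c * (\<Sum>\<^sup>+k. ennreal (2 powr (- \<delta> * \<bar>real_of_int k\<bar>)))"
    by (rule nn_integral_cmult) simp
  also have "\<dots> < \<infinity>"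
    using nn_integral_int_geometric_finite[OF \<open>0 < \<delta>\<close>] by (simp add: ennreal_mult_less_top)
  finally show ?thesis .
qed

section \<open>Balancing two bounds over the dyadic scales\<close>

abbreviation pow2 :: "real \<Rightarrow> int \<Rightarrow> ennreal" where
  "pow2 a j \<equiv> ennreal (2 powr (real_of_int j * a))"

text \<open>Discrete form of Hedberg's argument. Small scales use the bound by \<open>s\<close>,
  large scales the bound by \<open>B\<close>. The terms grow geometrically and then decay
  geometrically, so the sum is comparable to the value at the scale where the two bounds agree, and
  that value is the interpolated product.\<close>

lemma dyadic_sum_min_le:
  fixes s B :: ennreal and v :: "int \<Rightarrow> ennreal"
  assumes a: "0 < a" and p: "0 < p" and r: "0 < r" and "B \<noteq> \<infinity>"
    and vs: "\<And>j. v j \<le> s" and vB: "\<And>j. v j \<le> pow2 (- 1 / p) j * B"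
  shows "(\<Sum>\<^sup>+j. (pow2 a j * v j) powe r)
    \<le> dyadic_const a p r * (s powe (1 - a * p) * B powe (a * p)) powe r"
proof -
  consider "\<forall>j. v j = 0" | "s = \<infinity>" "B \<noteq> 0" | s' B' where "s = ennreal s'" "B = ennreal B'" "0 < s'" "0 < B'"
  proof (cases "s = 0 \<or> B = 0")
    case True
    have "v j = 0" for j using vs[of j] vB[of j] True by auto
    then show ?thesis using that by blast
  next
    case False
    then show ?thesis using that \<open>B \<noteq> \<infinity>\<close>
      by (cases s rule: ennreal_cases; cases B rule: ennreal_cases) (auto simp: less_le)
  qed
  then show ?thesis
  proof cases
    case 1
    then show ?thesis by simp
  next
    case 2
    \<comment> \<open>An infinite \<open>s\<close> makes the right side infinite, since its other
      factors are nonzero.\<close>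
    then have "dyadic_const a p r * (s powe (1 - a * p) * B powe (a * p)) powe r = \<infinity>"
      using dyadic_const_pos[OF p, of a r] by (simp add: ennreal_top_mult ennreal_mult_eq_top_iff)
    then show ?thesis by simp
  next
    case 3
    \<comment> \<open>Solution of \<open>s' = l powr (- 1 / p) * B'\<close>: at this scale the two
      bounds coincide.\<close>
    define l where "l = (B' / s') powr p"
    define J where "J = \<lfloor>log 2 l\<rfloor>"
    have l: "0 < l" using 3 by (simp add: l_def)
    have J1: "2 powr J \<le> l" and J2: "l \<le> 2 powr (J + 1)"
      using l by (simp_all add: J_def le_log_iff[symmetric] log_le_iff[symmetric])
    have Bl: "B' = s' * l powr (1 / p)"
      using 3 p by (simp add: l_def powr_powr)
    have sl: "s' * l powr a = s' powr (1 - a * p) * B' powr (a * p)"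
      using 3 by (simp add: l_def powr_powr powr_divide powr_diff mult.commute field_simps)
    have le: "pow2 a (J + k) * v (J + k) \<le>
        ennreal (s' * l powr a) * ennreal (dyadic_weight a p k)" for k
    proof -
      have "B' * 2 powr (- real_of_int (J + k) / p) \<le> s' * 2 powr ((1 - real_of_int k) / p)"
      proof -
        have "l powr (1 / p) \<le> (2 powr (J + 1)) powr (1 / p)"
          using J2 l p by (intro powr_mono2) auto
        then have "B' \<le> s' * 2 powr ((real_of_int J + 1) / p)"
          using 3 by (simp add: Bl powr_powr)
        then have "B' * 2 powr (- real_of_int (J + k) / p) \<le> s' * 2 powr ((real_of_int J + 1) / p) * 2 powr (- real_of_int (J + k) / p)"
          by (intro mult_right_mono) auto
        also have "\<dots> = s' * 2 powr ((1 - real_of_int k) / p)"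
          by (simp add: mult.assoc powr_add[symmetric] add_divide_distrib[symmetric])
        finally show ?thesis .
      qed
      then have "v (J + k) \<le> ennreal (s' * min 1 (2 powr ((1 - real_of_int k) / p)))"
        using vs[of "J + k"] vB[of "J + k"] 3
        by (auto simp: min_def ennreal_mult[symmetric] mult.commute simp del: of_int_add
            intro: order_trans ennreal_leI)
      moreover have "pow2 a (J + k) \<le> ennreal (l powr a * 2 powr (real_of_int k * a))"
      proof (rule ennreal_leI)
        have "2 powr (real_of_int (J + k) * a) = (2 powr J) powr a * 2 powr (real_of_int k * a)"
          by (simp add: powr_powr powr_add distrib_right)
        also have "\<dots> \<le> l powr a * 2 powr (real_of_int k * a)"
          using J1 a by (intro mult_right_mono powr_mono2) auto
        finally show "2 powr (real_of_int (J + k) * a) \<le> l powr a * 2 powr (real_of_int k * a)" .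
      qed
      ultimately have "pow2 a (J + k) * v (J + k) \<le>
         ennreal (l powr a * 2 powr (real_of_int k * a)) * ennreal (s' * min 1 (2 powr ((1 - real_of_int k) / p)))"
        by (intro mult_mono) auto
      also have "\<dots> = ennreal (s' * l powr a) * ennreal (dyadic_weight a p k)"
        using 3 by (simp add: ennreal_mult[symmetric] mult_ac)
      finally show ?thesis .
    qed
    have bij: "bij_betw (\<lambda>k. J + k) UNIV UNIV"
      by (rule bij_betw_byWitness[where f' = "\<lambda>k. k - J"]) auto
    have "(\<Sum>\<^sup>+j. (pow2 a j * v j) powe r)
        = (\<Sum>\<^sup>+k. (pow2 a (J + k) * v (J + k)) powe r)"
      by (rule nn_integral_bij_count_space[OF bij, symmetric])
    also have "\<dots> \<le> (\<Sum>\<^sup>+k. (ennreal (s' * l powr a)) powe r *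
        (ennreal (dyadic_weight a p k)) powe r)"
      using r by (intro nn_integral_mono, subst powe_mult[symmetric]) (intro powe_mono le, simp)
    also have "\<dots> = dyadic_const a p r * (ennreal (s' * l powr a)) powe r"
      unfolding dyadic_const_def by (subst nn_integral_cmult) (auto simp: mult.commute)
    also have "ennreal (s' * l powr a) = s powe (1 - a * p) * B powe (a * p)"
      using 3 sl by (simp add: powe_ennreal ennreal_mult)
    finally show ?thesis .
  qed
qed

text \<open>\<open>V\<close> factors through the integer-valued floor, and every function of an
  integer is measurable.\<close>

lemma dyadic_step_measurable:
  fixes V :: "real \<Rightarrow> 'a::topological_space"
  assumes "\<And>t s. \<lfloor>t / d\<rfloor> = \<lfloor>s / d\<rfloor> \<Longrightarrow> V t = V s" "0 < d"
  shows "V \<in> borel_measurable borel"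
proof -
  have "V t = (\<lambda>z::int. V (real_of_int z * d)) \<lfloor>t / d\<rfloor>" for t
    using assms(2) by (intro assms(1)) simp
  moreover have "(\<lambda>t. (\<lambda>z::int. V (real_of_int z * d)) \<lfloor>t / d\<rfloor>) \<in> borel_measurable borel"
    by measurable
  ultimately show ?thesis by presburger
qed

text \<open>A Sobolev-type embedding with \<open>1 / q = 1 / p - a\<close>. A function constant on
  intervals of length \<open>2 powr j\<close> is at most \<open>2 powr (- j / p)\<close> times its
  \<open>p\<close>-norm. So \<open>dyadic_sum_min_le\<close> applies at each point, with
  \<open>s\<close> the supremum at that point and \<open>B\<close> the norm of the supremum. Since
  \<open>(1 - a * p) * q = p\<close>, the \<open>q\<close>-th power of the outcome integrates to a
  power of \<open>B\<close>.\<close>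

lemma dyadic_embedding_line:
  assumes a: "0 < a" and p: "0 < p" and ap: "a * p < 1" and r: "0 < r" and q: "q = p / (1 - a * p)"
    and V: "\<And>j t s. \<lfloor>t / 2 powr real_of_int j\<rfloor> = \<lfloor>s / 2 powr real_of_int j\<rfloor> \<Longrightarrow> V j t = V j s"
  shows "(\<integral>\<^sup>+t. ((\<Sum>\<^sup>+j. (pow2 a j * V j t) powe r) powe (1 / r)) powe q \<partial>lborel) powe (1 / q)
    \<le> dyadic_const a p r powe (1 / r) * (\<integral>\<^sup>+t. (SUP j. V j t) powe p \<partial>lborel) powe (1 / p)"
proof -
  define S where "S = (\<lambda>t. SUP j. V j t)"
  define B where "B = (\<integral>\<^sup>+t. S t powe p \<partial>lborel) powe (1 / p)"
  define C where "C = dyadic_const a p r powe (1 / r)"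
  have q0: "0 < q" using p ap q by simp
  have [measurable]: "V j \<in> borel_measurable borel" for j
    by (rule dyadic_step_measurable[of "2 powr real_of_int j" "V j", OF V]) simp_all
  have [measurable]: "S \<in> borel_measurable borel" unfolding S_def by measurable
  show ?thesis
  proof (cases "B = \<infinity>")
    case True
    have "C * B = \<infinity>"
      using True dyadic_const_pos[OF p, of a r] by (simp add: C_def ennreal_mult_eq_top_iff)
    then show ?thesis by (simp add: B_def S_def C_def)
  next
    case False
    have Bp: "B powe p = (\<integral>\<^sup>+t. S t powe p \<partial>lborel)" using p by (simp add: B_def)
    have VS: "V j t \<le> S t" for j t unfolding S_def by (rule SUP_upper) simp
    \<comment> \<open>\<open>V j\<close> is constant on the interval \<open>I\<close> of length
      \<open>d\<close> around \<open>t\<close> and lies below \<open>S\<close> there; the integral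
      of \<open>S\<close> is restricted to \<open>I\<close>.\<close>
    have VB: "V j t \<le> pow2 (- 1 / p) j * B" for j t
    proof -
      define d where "d = (2::real) powr real_of_int j"
      have d: "0 < d" by (simp add: d_def)
      define I where "I = {of_int \<lfloor>t / d\<rfloor> * d..<(of_int \<lfloor>t / d\<rfloor> + 1) * d}"
      have eq: "V j s = V j t" if "s \<in> I" for s
      proof -
        have "\<lfloor>s / d\<rfloor> = \<lfloor>t / d\<rfloor>" using that d unfolding I_def
          by (subst floor_eq_iff) (auto simp: pos_le_divide_eq pos_divide_less_eq)
        then show ?thesis unfolding d_def by (rule V)
      qed
      have em: "emeasure lborel I = ennreal d"
        using d by (simp add: I_def algebra_simps)
      have "V j t powe p * ennreal d = (\<integral>\<^sup>+s. V j t powe p * indicator I s \<partial>lborel)"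
        by (subst nn_integral_cmult_indicator) (simp_all only: em, simp add: I_def)
      also have "\<dots> \<le> (\<integral>\<^sup>+s. S s powe p \<partial>lborel)"
      proof (rule nn_integral_mono)
        fix s show "V j t powe p * indicator I s \<le> S s powe p"
          using VS[of j s] eq[of s] p by (auto simp: indicator_def intro!: powe_mono)
      qed
      finally have 1: "V j t powe p * ennreal d \<le> B powe p" by (simp add: Bp)
      have "V j t powe p = V j t powe p * ennreal d * ennreal (1 / d)"
        using d by (simp add: mult.assoc ennreal_mult[symmetric])
      also have "\<dots> \<le> B powe p * ennreal (1 / d)" by (intro mult_right_mono 1) simp
      finally have "(V j t powe p) powe (1 / p) \<le> (B powe p * ennreal (1 / d)) powe (1 / p)"
        using p by (intro powe_mono) auto
      then have "V j t \<le> B * ennreal ((1 / d) powr (1 / p))"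
        using p d by (simp add: powe_mult powe_ennreal)
      also have "(1 / d) powr (1 / p) = 2 powr (real_of_int j * (- 1 / p))"
        by (simp add: d_def powr_minus_divide[symmetric] powr_powr)
      finally show ?thesis by (simp add: mult.commute)
    qed
    have pt: "((\<Sum>\<^sup>+j. (pow2 a j * V j t) powe r) powe (1 / r)) powe q \<le>
        (C * B powe (a * p)) powe q * S t powe p" for t
    proof -
      have "(\<Sum>\<^sup>+j. (pow2 a j * V j t) powe r) powe (1 / r) \<le>
        (dyadic_const a p r * (S t powe (1 - a * p) * B powe (a * p)) powe r) powe (1 / r)"
        using False VS VB by (intro powe_mono dyadic_sum_min_le a p r) (use r in auto)
      also have "\<dots> = C * (S t powe (1 - a * p) * B powe (a * p))"
        using r by (simp add: powe_mult C_def powe_powe)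
      finally have "((\<Sum>\<^sup>+j. (pow2 a j * V j t) powe r) powe (1 / r)) powe q \<le>
         (C * (S t powe (1 - a * p) * B powe (a * p))) powe q"
        using q0 by (intro powe_mono) auto
      also have "\<dots> = (C * B powe (a * p)) powe q * S t powe ((1 - a * p) * q)"
        by (simp add: powe_mult powe_powe mult_ac)
      also have "(1 - a * p) * q = p" using ap by (simp add: q)
      finally show ?thesis .
    qed
    have "(\<integral>\<^sup>+t. ((\<Sum>\<^sup>+j. (pow2 a j * V j t) powe r) powe (1 / r)) powe q \<partial>lborel)
       \<le> (\<integral>\<^sup>+t. (C * B powe (a * p)) powe q * S t powe p \<partial>lborel)"
      by (intro nn_integral_mono pt)
    also have "\<dots> = (C * B powe (a * p)) powe q * B powe p"
      by (subst nn_integral_cmult) (auto simp: Bp)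
    also have "\<dots> = (C * B) powe q"
    proof -
      have "a * p * q + p = q" using ap by (simp add: q field_simps)
      then have "B powe (a * p * q) * B powe p = B powe q" by (simp add: powe_add[symmetric])
      then show ?thesis by (simp add: powe_mult powe_powe mult.assoc)
    qed
    finally have "(\<integral>\<^sup>+t. ((\<Sum>\<^sup>+j. (pow2 a j * V j t) powe r) powe (1 / r)) powe q \<partial>lborel) powe (1 / q)
       \<le> ((C * B) powe q) powe (1 / q)"
      using q0 by (intro powe_mono) auto
    also have "\<dots> = C * B" using q0 by simp
    finally show ?thesis by (simp add: C_def B_def S_def)
  qed
qed

section \<open>Norms in one variable and their iterates\<close>

abbreviation upd :: "'n::finite rvec \<Rightarrow> 'n \<Rightarrow> real \<Rightarrow> 'n rvec" where
  "upd x i t \<equiv> (\<chi> j. if j = i then t else x $ j)"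

abbreviation iter_norm ::
    "('n::finite \<Rightarrow> real) \<Rightarrow> 'n list \<Rightarrow> ('n rvec \<Rightarrow> ennreal) \<Rightarrow> 'n rvec \<Rightarrow> ennreal" where
  "iter_norm p xs F \<equiv> fold (\<lambda>i. coord_norm (p i) i) xs F"

text \<open>Completion does not change nonnegative integrals, so from here on the Borel theory
  suffices.\<close>

lemma coord_norm_lborel:
  "coord_norm r i F x = (\<integral>\<^sup>+t. F (upd x i t) powe r \<partial>lborel) powe (1 / r)"
  by (simp add: coord_norm_def nn_integral_completion)

lemma coord_norm_mono:
  assumes "\<And>x. F x \<le> G x" "0 < r"
  shows "coord_norm r i F x \<le> coord_norm r i G x"
  unfolding coord_norm_lborel using assms by (intro powe_mono nn_integral_mono) auto

lemma iter_norm_mono: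
  assumes "\<And>x. F x \<le> G x" "\<And>i. 0 < p i"
  shows "iter_norm p xs F x \<le> iter_norm p xs G x"
  using assms(1)
proof (induction xs arbitrary: F G x)
  case (Cons i xs)
  show ?case using assms(2) by (auto intro!: Cons.IH coord_norm_mono Cons.prems)
qed simp

lemma mixed_norm_mono:
  "(\<And>x. F x \<le> G x) \<Longrightarrow> (\<And>i. 0 < p i) \<Longrightarrow> mixed_norm p F \<le> mixed_norm p G"
  unfolding mixed_norm_def by (rule iter_norm_mono)

lemma continuous_upd: "continuous_on UNIV (\<lambda>z. upd (fst z) i (snd z))"
proof -
  have "continuous_on UNIV (\<lambda>z :: 'a rvec \<times> real. if j = i then snd z else fst z $ j)" for j
    by (cases "j = i") (auto intro!: continuous_intros)
  then show ?thesis by (intro continuous_intros)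
qed

lemma upd_measurable [measurable]: "(\<lambda>z. upd (fst z) i (snd z)) \<in> borel \<Otimes>\<^sub>M borel \<rightarrow>\<^sub>M borel"
  using borel_measurable_continuous_onI[OF continuous_upd[of i]] by (simp add: borel_prod)

lemma upd_measurable_snd [measurable]: "upd x i \<in> borel \<rightarrow>\<^sub>M borel"
proof -
  have "(\<lambda>t. (\<lambda>z. upd (fst z) i (snd z)) (x, t)) \<in> borel \<rightarrow>\<^sub>M borel" by measurable
  then show ?thesis by (simp only: fst_conv snd_conv)
qed

lemma coord_norm_measurable:
  assumes [measurable]: "F \<in> borel_measurable borel"
  shows "coord_norm r i F \<in> borel_measurable borel"
proof -
  have "(\<lambda>z. F (upd (fst z) i (snd z)) powe r) \<in> borel_measurable (borel \<Otimes>\<^sub>M lborel)"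
    by measurable
  then have "(\<lambda>(x, t). F (upd x i t) powe r) \<in> borel_measurable (borel \<Otimes>\<^sub>M lborel)"
    by (simp add: case_prod_unfold)
  then have "(\<lambda>x. \<integral>\<^sup>+t. F (upd x i t) powe r \<partial>lborel) \<in> borel_measurable borel"
    by (rule lborel.borel_measurable_nn_integral)
  then show ?thesis unfolding coord_norm_lborel[abs_def] by measurable
qed

lemma iter_norm_measurable:
  "F \<in> borel_measurable borel \<Longrightarrow> iter_norm p xs F \<in> borel_measurable borel"
  by (induction xs arbitrary: F) (auto intro: coord_norm_measurable)

lemma coord_norm_cmult:
  assumes [measurable]: "F \<in> borel_measurable borel" and "0 < r"
  shows "coord_norm r i (\<lambda>x. c * F x) x = c * coord_norm r i F x"
  using assms(2) unfolding coord_norm_lborel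
  by (simp add: powe_mult nn_integral_cmult)

lemma iter_norm_cmult:
  assumes "F \<in> borel_measurable borel" and "\<And>i. 0 < p i"
  shows "iter_norm p xs (\<lambda>x. c * F x) x = c * iter_norm p xs F x"
  using assms(1)
proof (induction xs arbitrary: F x)
  case (Cons i xs)
  have "coord_norm (p i) i (\<lambda>x. c * F x) = (\<lambda>x. c * coord_norm (p i) i F x)"
    using coord_norm_cmult[OF Cons.prems assms(2)] by blast
  then show ?case using Cons.IH[OF coord_norm_measurable[OF Cons.prems]] by simp
qed simp

lemma mixed_norm_cmult:
  "F \<in> borel_measurable borel \<Longrightarrow> (\<And>i. 0 < p i) \<Longrightarrow> mixed_norm p (\<lambda>x. c * F x) = c * mixed_norm p F"
  unfolding mixed_norm_def by (rule iter_norm_cmult)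

section \<open>The dyadic Sobolev embedding\<close>

definition dyadic :: "int \<Rightarrow> ('n::finite rvec \<Rightarrow> 'a) \<Rightarrow> bool" where
  "dyadic j u \<longleftrightarrow> (\<forall>x y. (\<forall>i. \<lfloor>x $ i / 2 powr real_of_int j\<rfloor> = \<lfloor>y $ i / 2 powr real_of_int j\<rfloor>) \<longrightarrow> u x = u y)"

text \<open>The function factors through the vector of floors, a point of the countable set of
  integer vectors; the floors themselves are measurable.\<close>

lemma dyadic_measurable:
  fixes u :: "'n::finite rvec \<Rightarrow> 'a::topological_space"
  assumes "dyadic j u"
  shows "u \<in> borel_measurable borel"
proof -
  define d where "d = (2::real) powr real_of_int j"
  have d: "0 < d" by (simp add: d_def)
  define g where "g = (\<lambda>z::'n \<Rightarrow> int. u (\<chi> i. real_of_int (z i) * d))"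
  define w where "w = (\<lambda>(x::'n rvec) i. \<lfloor>x $ i / d\<rfloor>)"
  have ug: "u x = g (w x)" for x
    unfolding g_def using assms d unfolding dyadic_def w_def d_def[symmetric] by simp
  have [measurable]: "w \<in> borel \<rightarrow>\<^sub>M count_space UNIV"
  proof (subst measurable_count_space_eq2_countable, intro conjI ballI)
    fix z :: "'n \<Rightarrow> int"
    have eq: "w -` {z} \<inter> space borel = {x. \<forall>i. \<lfloor>x $ i / d\<rfloor> = z i}"
      by (auto simp: w_def fun_eq_iff)
    have "(\<lambda>x. \<lfloor>x $ i / d\<rfloor>) \<in> borel \<rightarrow>\<^sub>M count_space UNIV" for i
      by measurable
    then show "w -` {z} \<inter> space borel \<in> sets borel"
      unfolding eq by measurable
  qed auto
  have "(\<lambda>x. g (w x)) \<in> borel_measurable borel" by measurable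
  then show ?thesis using ug by presburger
qed

text \<open>Used in two directions: with \<open>x = y\<close> it makes slices constant on intervals,
  with \<open>t = s\<close> it keeps partial norms constant on cells.\<close>

lemma dyadic_upd_cong:
  assumes "dyadic j u" "\<And>k. \<lfloor>x $ k / 2 powr real_of_int j\<rfloor> = \<lfloor>y $ k / 2 powr real_of_int j\<rfloor>"
    "\<lfloor>t / 2 powr real_of_int j\<rfloor> = \<lfloor>s / 2 powr real_of_int j\<rfloor>"
  shows "u (upd x i t) = u (upd y i s)"
proof -
  have "\<lfloor>upd x i t $ k / 2 powr real_of_int j\<rfloor> = \<lfloor>upd y i s $ k / 2 powr real_of_int j\<rfloor>" for k
    using assms(2,3) by simp
  then show ?thesis using assms(1) unfolding dyadic_def by blast
qed

lemma dyadic_coord_norm: "dyadic j u \<Longrightarrow> dyadic j (coord_norm r i u)"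
  unfolding dyadic_def[of j "coord_norm r i u"] coord_norm_lborel
proof (intro allI impI)
  fix x y :: "'a rvec"
  assume u: "dyadic j u" and xy: "\<forall>i. \<lfloor>x $ i / 2 powr real_of_int j\<rfloor> = \<lfloor>y $ i / 2 powr real_of_int j\<rfloor>"
  have "u (upd x i t) = u (upd y i t)" for t
    using xy by (intro dyadic_upd_cong[OF u]) auto
  then show "(\<integral>\<^sup>+t. u (upd x i t) powe r \<partial>lborel) powe (1 / r) = (\<integral>\<^sup>+t. u (upd y i t) powe r \<partial>lborel) powe (1 / r)"
    by (simp only:)
qed

lemma dyadic_iter_norm: "dyadic j u \<Longrightarrow> dyadic j (iter_norm p xs u)"
  by (induction xs arbitrary: u) (auto intro: dyadic_coord_norm)

text \<open>The exponent \<open>a + b\<close> is divided: \<open>a\<close> is spent on variable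
  \<open>i\<close> through \<open>dyadic_embedding_line\<close>, \<open>b\<close> stays with the
  function for the variables still to come.\<close>

lemma coord_norm_dyadic_sum_le:
  assumes a: "0 < a" and p: "0 < p" and ap: "a * p < 1" and r: "0 < r" and q: "q = p / (1 - a * p)"
    and W: "\<And>j. dyadic j (W j)"
  shows "coord_norm q i (\<lambda>x. (\<Sum>\<^sup>+j. (pow2 (a + b) j * W j x) powe r) powe (1 / r)) x
    \<le> dyadic_const a p r powe (1 / r) * coord_norm p i (\<lambda>x. SUP j. pow2 b j * W j x) x"
proof -
  define V where "V = (\<lambda>j t. pow2 b j * W j (upd x i t))"
  have 1: "pow2 (a + b) j * W j (upd x i t) = pow2 a j * V j t" for j t
    by (simp add: V_def distrib_left powr_add ennreal_mult mult.assoc)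
  have "V j t = V j s"
    if "\<lfloor>t / 2 powr real_of_int j\<rfloor> = \<lfloor>s / 2 powr real_of_int j\<rfloor>" for j t s
    unfolding V_def using dyadic_upd_cong[OF W, of x j x t s i] that by simp
  from dyadic_embedding_line[OF a p ap r q, of V, OF this] show ?thesis
    unfolding coord_norm_lborel 1 by (simp only: V_def)
qed

lemma SUP_powe_le:
  fixes v :: "'i \<Rightarrow> ennreal"
  assumes "0 < p"
  shows "(SUP j. v j) powe p \<le> (\<Sum>\<^sup>+j. v j powe p)"
proof -
  let ?s = "\<Sum>\<^sup>+j. v j powe p"
  have "v j \<le> ?s powe (1 / p)" for j
  proof -
    have "v j powe p \<le> ?s" by (rule nn_integral_ge_point) simp
    then have "(v j powe p) powe (1 / p) \<le> ?s powe (1 / p)"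
      using assms by (intro powe_mono) auto
    then show ?thesis using assms by simp
  qed
  then have "(SUP j. v j) \<le> ?s powe (1 / p)" by (rule SUP_least)
  then have "(SUP j. v j) powe p \<le> (?s powe (1 / p)) powe p"
    using assms by (intro powe_mono) auto
  then show ?thesis using assms by simp
qed

text \<open>
  Taking the exponent of the current variable for the \<open>\<ell>\<^sup>p\<close> sum that dominates the supremum makes the
  sum commute with the norm.
\<close>

lemma coord_norm_SUP_le:
  fixes V :: "int \<Rightarrow> 'n::finite rvec \<Rightarrow> ennreal"
  assumes [measurable]: "\<And>j. V j \<in> borel_measurable borel" and p: "0 < p"
  shows "coord_norm p i (\<lambda>x. SUP j. V j x) x
    \<le> (\<Sum>\<^sup>+j. coord_norm p i (V j) x powe p) powe (1 / p)"
proof -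
  have "(\<integral>\<^sup>+t. (SUP j. V j (upd x i t)) powe p \<partial>lborel)
      \<le> (\<integral>\<^sup>+t. (\<Sum>\<^sup>+j. V j (upd x i t) powe p) \<partial>lborel)"
    by (intro nn_integral_mono SUP_powe_le p)
  also have "\<dots> = (\<integral>\<^sup>+j. \<integral>\<^sup>+t. V j (upd x i t) powe p \<partial>lborel \<partial>count_space UNIV)"
    by (rule nn_integral_count_space_nn_integral) auto
  also have "\<dots> = (\<Sum>\<^sup>+j. coord_norm p i (V j) x powe p)"
    using p by (simp add: coord_norm_lborel)
  finally show ?thesis
    unfolding coord_norm_lborel[of p i "\<lambda>x. SUP j. V j x"] using p by (intro powe_mono) auto
qed

lemma borel_measurable_nn_integral_int:
  fixes f :: "int \<Rightarrow> 'a \<Rightarrow> ennreal"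
  assumes [measurable]: "\<And>j. f j \<in> borel_measurable M"
  shows "(\<lambda>x. \<Sum>\<^sup>+j. f j x) \<in> borel_measurable M"
proof -
  have "(\<Sum>\<^sup>+j. f j x) = (\<Sum>n. f (int_decode n) x)" for x
    by (subst nn_integral_bij_count_space[OF bij_int_decode, symmetric])
       (simp add: nn_integral_count_space_nat)
  then show ?thesis by simp
qed

text \<open>One step of the iteration, common to all variables. It stops at the supremum over
  \<open>j\<close>, because inner variables go on to a sum while the last one does not.\<close>

lemma coord_norm_dyadic_step:
  fixes p :: "'n::finite \<Rightarrow> real"
  assumes a: "0 < a" and p: "0 < p i" and ap: "a * p i < 1" and r: "0 < r" and q: "q i = p i / (1 - a * p i)"
    and U: "\<And>j. dyadic j (U j)"
    and G: "\<And>x. G x \<le> C * (\<Sum>\<^sup>+j. (pow2 (a + b) j * iter_norm p xs (U j) x) powe r) powe (1 / r)"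
  shows "coord_norm (q i) i G x \<le>
    C * dyadic_const a (p i) r powe (1 / r) * coord_norm (p i) i (\<lambda>x. SUP j. pow2 b j * iter_norm p xs (U j) x) x"
proof -
  have q0: "0 < q i" using p ap q by simp
  have W: "dyadic j (iter_norm p xs (U j))" for j by (rule dyadic_iter_norm[OF U])
  have [measurable]: "iter_norm p xs (U j) \<in> borel_measurable borel" for j
    by (rule dyadic_measurable[OF W])
  have [measurable]: "(\<lambda>x. \<Sum>\<^sup>+j. (pow2 (a + b) j * iter_norm p xs (U j) x) powe r) \<in> borel_measurable borel"
    by (rule borel_measurable_nn_integral_int) auto
  have "coord_norm (q i) i G x \<le>
      coord_norm (q i) i (\<lambda>x. C * (\<Sum>\<^sup>+j. (pow2 (a + b) j * iter_norm p xs (U j) x) powe r) powe (1 / r)) x"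
    by (rule coord_norm_mono[OF G q0])
  also have "\<dots> = C * coord_norm (q i) i (\<lambda>x. (\<Sum>\<^sup>+j. (pow2 (a + b) j * iter_norm p xs (U j) x) powe r) powe (1 / r)) x"
    by (rule coord_norm_cmult[OF _ q0]) measurable
  also have "\<dots> \<le> C * (dyadic_const a (p i) r powe (1 / r) *
      coord_norm (p i) i (\<lambda>x. SUP j. pow2 b j * iter_norm p xs (U j) x) x)"
    by (intro mult_left_mono coord_norm_dyadic_sum_le a p ap r q W) auto
  finally show ?thesis by (simp add: mult.assoc)
qed

text \<open>\<open>C\<close> and \<open>r\<close> are chosen before \<open>U\<close>. The exponent
  \<open>r\<close> changes along the way: after variable \<open>i\<close> it is \<open>p i\<close>,
  as \<open>coord_norm_SUP_le\<close> dictates. \<open>M\<close> will be the dimension, and each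
  variable lowers the dyadic exponent by \<open>a\<close>. Appending at the end matches
  \<open>fold\<close>, whose last element is the outermost norm.\<close>

lemma iter_norm_dyadic_sum_le:
  fixes p :: "'n::finite \<Rightarrow> real"
  assumes a: "0 < a" and p: "\<And>i. 0 < p i" and ap: "\<And>i. a * p i < 1" and q: "\<And>i. q i = p i / (1 - a * p i)"
  shows "\<exists>C r. C < \<infinity> \<and> 0 < r \<and> (\<forall>U. (\<forall>j. dyadic j (U j)) \<longrightarrow> (\<forall>x.
     iter_norm q xs (\<lambda>x. \<Sum>\<^sup>+j. pow2 (a * M) j * U j x) x
      \<le> C * (\<Sum>\<^sup>+j. (pow2 (a * (M - real (length xs))) j * iter_norm p xs (U j) x) powe r) powe (1 / r)))"
proof (induction xs rule: rev_induct)
  case Nil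
  show ?case by (rule exI[of _ 1], rule exI[of _ 1]) simp
next
  case (snoc i xs)
  define b where "b = a * (M - real (length (xs @ [i])))"
  have ab: "a * (M - real (length xs)) = a + b" by (simp add: b_def algebra_simps)
  obtain C r where C: "C < \<infinity>" and r: "0 < r" and
    IH: "\<And>U x. (\<And>j. dyadic j (U j)) \<Longrightarrow> iter_norm q xs (\<lambda>x. \<Sum>\<^sup>+j. pow2 (a * M) j * U j x) x
      \<le> C * (\<Sum>\<^sup>+j. (pow2 (a + b) j * iter_norm p xs (U j) x) powe r) powe (1 / r)"
    using snoc ab by auto
  define C' where "C' = C * dyadic_const a (p i) r powe (1 / r)"
  have "C' < \<infinity>"
    using C dyadic_const_finite[OF a p ap r, of i] by (simp add: C'_def ennreal_mult_less_top)
  moreover have "iter_norm q (xs @ [i]) (\<lambda>x. \<Sum>\<^sup>+j. pow2 (a * M) j * U j x) x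
      \<le> C' * (\<Sum>\<^sup>+j. (pow2 b j * iter_norm p (xs @ [i]) (U j) x) powe p i) powe (1 / p i)"
    if U: "\<And>j. dyadic j (U j)" for U x
  proof -
    have [measurable]: "iter_norm p xs (U j) \<in> borel_measurable borel" for j
      by (rule dyadic_measurable[OF dyadic_iter_norm[OF U]])
    have "iter_norm q (xs @ [i]) (\<lambda>x. \<Sum>\<^sup>+j. pow2 (a * M) j * U j x) x
        \<le> C' * coord_norm (p i) i (\<lambda>x. SUP j. pow2 b j * iter_norm p xs (U j) x) x"
      using coord_norm_dyadic_step[where q = q, OF a p ap r q U IH[OF U]] by (simp add: C'_def)
    also have "\<dots> \<le> C' * (\<Sum>\<^sup>+j. coord_norm (p i) i (\<lambda>x. pow2 b j * iter_norm p xs (U j) x) x powe p i) powe (1 / p i)"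
      by (intro mult_left_mono coord_norm_SUP_le p) auto
    finally show ?thesis using p by (simp add: coord_norm_cmult)
  qed
  ultimately show ?case using p unfolding b_def by blast
qed

text \<open>The last variable is set apart. The dyadic exponent left after it is 0, so a further sum
  over \<open>j\<close> would have no weight to make it converge. But the supremum is already
  enough, since all \<open>U j\<close> lie below the single function \<open>F\<close>.\<close>

theorem mixed_norm_dyadic_sum_le:
  fixes p :: "'n::{finite,linorder} \<Rightarrow> real"
  assumes a: "0 < a" and p: "\<And>i. 0 < p i" and ap: "\<And>i. a * p i < 1" and q: "\<And>i. q i = p i / (1 - a * p i)"
  shows "\<exists>C<\<infinity>. \<forall>U F. (\<forall>j. dyadic j (U j)) \<longrightarrow> (\<forall>j x. U j x \<le> F x) \<longrightarrow>
      mixed_norm q (\<lambda>x. \<Sum>\<^sup>+j. pow2 (a * real CARD('n)) j * U j x) \<le> C * mixed_norm p F"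
proof -
  define ys where "ys = sorted_list_of_set (UNIV :: 'n set)"
  have len: "length ys = CARD('n)" by (simp add: ys_def)
  then have "ys \<noteq> []" by auto
  then obtain xs i where ys: "ys = xs @ [i]" using rev_exhaust by blast
  then have "real CARD('n) = real (length xs) + 1" using len by simp
  then have "a * (real CARD('n) - real (length xs)) = a + 0" by simp
  then obtain C r where C: "C < \<infinity>" and r: "0 < r" and
    IH: "\<And>U x. (\<And>j. dyadic j (U j)) \<Longrightarrow> iter_norm q xs (\<lambda>x. \<Sum>\<^sup>+j. pow2 (a * real CARD('n)) j * U j x) x
      \<le> C * (\<Sum>\<^sup>+j. (pow2 (a + 0) j * iter_norm p xs (U j) x) powe r) powe (1 / r)"
    using iter_norm_dyadic_sum_le[where p = p and q = q and xs = xs and M = "real CARD('n)", OF a p ap q]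
    by (elim exE conjE) (rule that, auto)
  define C' where "C' = C * dyadic_const a (p i) r powe (1 / r)"
  have "C' < \<infinity>"
    using C dyadic_const_finite[OF a p ap r, of i] by (simp add: C'_def ennreal_mult_less_top)
  moreover have "mixed_norm q (\<lambda>x. \<Sum>\<^sup>+j. pow2 (a * real CARD('n)) j * U j x) \<le> C' * mixed_norm p F"
    if U: "\<And>j. dyadic j (U j)" and UF: "\<And>j x. U j x \<le> F x" for U F
  proof -
    have "mixed_norm q (\<lambda>x. \<Sum>\<^sup>+j. pow2 (a * real CARD('n)) j * U j x)
        \<le> C' * coord_norm (p i) i (\<lambda>x. SUP j. pow2 0 j * iter_norm p xs (U j) x) 0"
      unfolding mixed_norm_def ys_def[symmetric] ys
      using coord_norm_dyadic_step[where q = q, OF a p ap r q U IH[OF U]] by (simp add: C'_def)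
    also have "\<dots> \<le> C' * coord_norm (p i) i (iter_norm p xs F) 0"
      using p UF by (intro mult_left_mono coord_norm_mono SUP_least) (auto intro: iter_norm_mono)
    also have "\<dots> = C' * mixed_norm p F"
      using ys by (simp add: mixed_norm_def ys_def)
    finally show ?thesis .
  qed
  ultimately show ?thesis by blast
qed

section \<open>Product functions, Tonelli and Hoelder in mixed norms\<close>

text \<open>Each norm acts on one factor and treats the others as constants; factors of variables
  not yet reached stay as functions. Meant for indicators of cubes and for products of decaying
  functions.\<close>

lemma iter_norm_prod:
  fixes h :: "'n::finite \<Rightarrow> real \<Rightarrow> ennreal"
  assumes h [measurable]: "\<And>i. h i \<in> borel_measurable borel" and p: "\<And>i. 0 < p i" and "distinct xs"
  shows "iter_norm p xs (\<lambda>x. \<Prod>i\<in>UNIV. h i (x $ i)) x =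
    (\<Prod>i\<in>set xs. (\<integral>\<^sup>+t. h i t powe p i \<partial>lborel) powe (1 / p i)) * (\<Prod>i\<in>- set xs. h i (x $ i))"
  using assms(3)
proof (induction xs arbitrary: x rule: rev_induct)
  case (snoc i xs)
  let ?N = "\<lambda>i. (\<integral>\<^sup>+t. h i t powe p i \<partial>lborel) powe (1 / p i)"
  have i: "- set xs = insert i (- set (xs @ [i]))" and d: "distinct xs" using snoc.prems by auto
  have IH: "iter_norm p xs (\<lambda>x. \<Prod>i\<in>UNIV. h i (x $ i)) (upd x i t)
      = (\<Prod>i\<in>set xs. ?N i) * (\<Prod>k\<in>- set (xs @ [i]). h k (x $ k)) * h i t" for t
  proof -
    have "(\<Prod>k\<in>- set xs. h k (upd x i t $ k)) = h i t * (\<Prod>k\<in>- set (xs @ [i]). h k (x $ k))"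
      unfolding i by (subst prod.insert) (auto intro!: prod.cong)
    then show ?thesis using snoc.IH[OF d] by (simp add: mult_ac)
  qed
  have "iter_norm p (xs @ [i]) (\<lambda>x. \<Prod>i\<in>UNIV. h i (x $ i)) x
      = (\<Prod>i\<in>set xs. ?N i) * (\<Prod>k\<in>- set (xs @ [i]). h k (x $ k)) * ?N i"
    using p[of i] by (simp add: coord_norm_lborel IH powe_mult nn_integral_cmult del: set_append)
  also have "\<dots> = (\<Prod>i\<in>set (xs @ [i]). ?N i) * (\<Prod>k\<in>- set (xs @ [i]). h k (x $ k))"
    using snoc.prems by (simp add: mult_ac)
  finally show ?case .
qed simp

lemma mixed_norm_prod:
  fixes h :: "'n::{finite,linorder} \<Rightarrow> real \<Rightarrow> ennreal"
  assumes "\<And>i. h i \<in> borel_measurable borel" and "\<And>i. 0 < p i"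
  shows "mixed_norm p (\<lambda>x. \<Prod>i\<in>UNIV. h i (x $ i)) =
    (\<Prod>i\<in>UNIV. (\<integral>\<^sup>+t. h i t powe p i \<partial>lborel) powe (1 / p i))"
  unfolding mixed_norm_def by (subst iter_norm_prod) (auto simp: assms)

section \<open>Lebesgue measure on vectors as a product measure\<close>

lemma vec_lambda_measurable [measurable]:
  "(\<lambda>w. \<chi> i. w i) \<in> (\<Pi>\<^sub>M i\<in>(UNIV::'n::finite set). (lborel :: 'a::euclidean_space measure)) \<rightarrow>\<^sub>M borel"
proof (rule borel_measurable_euclidean_space[THEN iffD2], intro ballI)
  fix b :: "'a ^ 'n" assume "b \<in> Basis"
  then obtain i u where b: "b = axis i u" by (auto simp: Basis_vec_def)
  show "(\<lambda>w. (\<chi> i. w i) \<bullet> b) \<in> borel_measurable (\<Pi>\<^sub>M i\<in>(UNIV::'n set). (lborel :: 'a measure))"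
    by (simp add: b inner_axis)
qed

text \<open>Lebesgue measure is determined by the volumes of boxes, and these multiply. The entries
  range over any Euclidean space because two levels occur: real entries for \<real>^n, and entries
  in \<real>^n for its \<open>m\<close>-fold power.\<close>

lemma lborel_vec_eq:
  "(lborel :: ('a::euclidean_space ^ 'n::finite) measure)
     = distr (\<Pi>\<^sub>M i\<in>UNIV. lborel) borel (\<lambda>w. \<chi> i. w i)"
proof (rule lborel_eqI)
  interpret product_sigma_finite "\<lambda>_::'n. lborel :: 'a measure" ..
  fix l u :: "'a ^ 'n" assume lu: "\<And>b. b \<in> Basis \<Longrightarrow> l \<bullet> b \<le> u \<bullet> b"
  have lu': "l $ i \<bullet> b \<le> u $ i \<bullet> b" if "b \<in> Basis" for i b
    using lu[of "axis i b"] that by (auto simp: Basis_vec_def inner_axis)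
  have box: "(\<lambda>w. \<chi> i. w i) -` box l u \<inter> space (\<Pi>\<^sub>M i\<in>(UNIV::'n set). (lborel :: 'a measure))
      = (\<Pi>\<^sub>E i\<in>UNIV. box (l $ i) (u $ i))"
    by (auto simp: space_PiM mem_box Basis_vec_def inner_axis PiE_def Pi_def)
  have "emeasure (distr (\<Pi>\<^sub>M i\<in>UNIV. lborel) borel (\<lambda>w. \<chi> i. w i)) (box l u)
      = (\<Prod>i\<in>UNIV. emeasure lborel (box (l $ i) (u $ i)))"
    by (subst emeasure_distr) (auto simp: box emeasure_PiM)
  also have "\<dots> = (\<Prod>i\<in>UNIV. ennreal (\<Prod>b\<in>Basis. (u $ i - l $ i) \<bullet> b))"
    using lu' by (intro prod.cong refl emeasure_lborel_box) auto
  also have "\<dots> = ennreal (\<Prod>i\<in>UNIV. \<Prod>b\<in>Basis. (u $ i - l $ i) \<bullet> b)"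
    using lu' by (intro prod_ennreal prod_nonneg) (auto simp: inner_diff_left)
  also have "(\<Prod>i\<in>UNIV. \<Prod>b\<in>Basis. (u $ i - l $ i) \<bullet> b) = (\<Prod>b\<in>Basis. (u - l) \<bullet> b)"
  proof -
    have Basis: "(Basis :: ('a ^ 'n) set) = (\<lambda>(i, b). axis i b) ` (UNIV \<times> Basis)"
      by (auto simp: Basis_vec_def)
    have inj: "inj_on (\<lambda>(i, b). axis i b) (UNIV \<times> (Basis :: 'a set))"
      by (auto simp: inj_on_def axis_eq_axis)
    show ?thesis
      unfolding Basis by (subst prod.reindex[OF inj]) (simp add: prod.cartesian_product inner_axis case_prod_unfold)
  qed
  finally show "emeasure (distr (\<Pi>\<^sub>M i\<in>UNIV. lborel) borel (\<lambda>w. \<chi> i. w i)) (box l u)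
      = ennreal (prod ((\<bullet>) (u - l)) Basis)" .
qed simp

lemma nn_integral_lborel_vec:
  fixes f :: "'a::euclidean_space ^ 'n::finite \<Rightarrow> ennreal"
  assumes "f \<in> borel_measurable borel"
  shows "(\<integral>\<^sup>+x. f x \<partial>lborel) = (\<integral>\<^sup>+w. f (\<chi> i. w i) \<partial>(\<Pi>\<^sub>M i\<in>UNIV. lborel))"
  using assms by (subst lborel_vec_eq, subst nn_integral_distr) auto

lemma nn_integral_zero_or_top:
  assumes [measurable]: "G \<in> borel_measurable M" and "\<And>x. G x \<in> {0, \<infinity>}"
  shows "(\<integral>\<^sup>+x. G x \<partial>M) \<in> {0, \<infinity>}"
proof -
  \<comment> \<open>Multiplication by \<infinity> leaves \<open>G\<close> unchanged, hence also its
    integral.\<close>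
  have "G x = \<infinity> * G x" for x using assms(2)[of x] by (auto simp: ennreal_top_mult)
  then have "(\<integral>\<^sup>+x. G x \<partial>M) = (\<integral>\<^sup>+x. \<infinity> * G x \<partial>M)" by presburger
  also have "\<dots> = \<infinity> * (\<integral>\<^sup>+x. G x \<partial>M)" by (rule nn_integral_cmult) simp
  finally show ?thesis
    by (cases "(\<integral>\<^sup>+x. G x \<partial>M) = 0") (auto simp: ennreal_top_mult)
qed

lemma powe_zero_or_top: "a \<in> {0, \<infinity>} \<Longrightarrow> a powe r = a"
  by auto

text \<open>
  Powers do not change a function with values in \<open>{0, \<infinity>}\<close>, so all its mixed norms agree with its integral.
\<close>

lemma iter_norm_zero_or_top:
  fixes G :: "'n::finite rvec \<Rightarrow> ennreal"
  assumes G [measurable]: "G \<in> borel_measurable borel" and zt: "\<And>x. G x \<in> {0, \<infinity>}" and "distinct xs"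
  shows "iter_norm p xs G x =
    (\<integral>\<^sup>+w. G (\<chi> j. if j \<in> set xs then w j else x $ j) \<partial>(\<Pi>\<^sub>M i\<in>set xs. lborel))"
  using assms(3)
proof (induction xs arbitrary: x rule: rev_induct)
  case Nil
  show ?case by (simp add: PiM_empty nn_integral_count_space_finite)
next
  case (snoc i xs)
  interpret product_sigma_finite "\<lambda>_::'n. lborel :: real measure" ..
  have d: "distinct xs" and i: "i \<notin> set xs" using snoc.prems by auto
  have [measurable]: "(\<lambda>w. \<chi> j. if j \<in> S then w j else x $ j) \<in> (\<Pi>\<^sub>M i\<in>S. (lborel::real measure)) \<rightarrow>\<^sub>M borel" for S and x :: "'n rvec"
  proof (rule borel_measurable_euclidean_space[THEN iffD2], intro ballI)
    fix b :: "'n rvec" assume "b \<in> Basis"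
    then obtain k where b: "b = axis k 1" by (auto simp: Basis_vec_def)
    show "(\<lambda>w. (\<chi> j. if j \<in> S then w j else x $ j) \<bullet> b) \<in> borel_measurable (\<Pi>\<^sub>M i\<in>S. (lborel::real measure))"
      by (cases "k \<in> S") (simp_all add: b inner_axis)
  qed
  have IH: "iter_norm p xs G y \<in> {0, \<infinity>}" for y
    unfolding snoc.IH[OF d] by (rule nn_integral_zero_or_top) (use zt in auto)
  have "iter_norm p (xs @ [i]) G x = (\<integral>\<^sup>+t. iter_norm p xs G (upd x i t) \<partial>lborel) powe (1 / p i)"
    by (simp add: coord_norm_lborel powe_zero_or_top[OF IH])
  \<comment> \<open>The integral is 0 or \<infinity> already, so the outer exponent drops
    out.\<close>
  also have "\<dots> = (\<integral>\<^sup>+t. iter_norm p xs G (upd x i t) \<partial>lborel)"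
  proof (rule powe_zero_or_top, rule nn_integral_zero_or_top[OF _ IH])
    have [measurable]: "iter_norm p xs G \<in> borel_measurable borel" by (rule iter_norm_measurable[OF G])
    show "(\<lambda>t. iter_norm p xs G (upd x i t)) \<in> borel_measurable lborel" by measurable
  qed
  also have "\<dots> = (\<integral>\<^sup>+t. \<integral>\<^sup>+w. G (\<chi> j. if j \<in> set (xs @ [i]) then (w(i := t)) j else x $ j)
      \<partial>(\<Pi>\<^sub>M i\<in>set xs. lborel) \<partial>lborel)"
    unfolding snoc.IH[OF d] using i
    by (intro nn_integral_cong arg_cong[where f = G]) (auto simp: vec_eq_iff)
  also have "\<dots> = (\<integral>\<^sup>+w. G (\<chi> j. if j \<in> set (xs @ [i]) then w j else x $ j) \<partial>(\<Pi>\<^sub>M i\<in>insert i (set xs). lborel))"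
  proof (rule product_nn_integral_insert_rev[symmetric, OF _ i])
    have "set (xs @ [i]) = insert i (set xs)" by simp
    then show "(\<lambda>w. G (\<chi> j. if j \<in> set (xs @ [i]) then w j else x $ j))
        \<in> borel_measurable (\<Pi>\<^sub>M i\<in>insert i (set xs). lborel)" by (simp only:) measurable
  qed simp
  finally show ?case by simp
qed

text \<open>Replace \<open>F\<close> by \<infinity> where it is infinite and by 0 elsewhere. The
  mixed norm of that function is its integral, which is then finite, so the set is null. This will
  give convergence almost everywhere of the integral that defines the extension.\<close>

lemma mixed_norm_finite_imp_AE_finite:
  fixes F :: "'n::{finite,linorder} rvec \<Rightarrow> ennreal"
  assumes F [measurable]: "F \<in> borel_measurable borel" and p: "\<And>i. 0 < p i" and fin: "mixed_norm p F < \<infinity>"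
  shows "AE x in lebesgue. F x < \<infinity>"
proof -
  define G where "G = (\<lambda>x. if F x = \<infinity> then \<infinity> else (0::ennreal))"
  have [measurable]: "G \<in> borel_measurable borel" unfolding G_def by measurable
  have zt: "G x \<in> {0, \<infinity>}" for x by (simp add: G_def)
  have "mixed_norm p G = (\<integral>\<^sup>+w. G (\<chi> j. w j) \<partial>(\<Pi>\<^sub>M i\<in>UNIV. lborel))"
    unfolding mixed_norm_def by (subst iter_norm_zero_or_top) (use zt in auto)
  also have "\<dots> = (\<integral>\<^sup>+x. G x \<partial>lborel)" by (rule nn_integral_lborel_vec[symmetric]) simp
  finally have eq: "mixed_norm p G = (\<integral>\<^sup>+x. G x \<partial>lborel)" .
  have "mixed_norm p G \<le> mixed_norm p F" by (rule mixed_norm_mono) (auto simp: G_def p)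
  then have "(\<integral>\<^sup>+x. G x \<partial>lborel) \<noteq> \<infinity>" using fin eq by (auto simp: top_unique)
  then have "AE x in lborel. G x \<noteq> \<infinity>" by (intro nn_integral_noteq_infinite) auto
  then have "AE x in lborel. F x < \<infinity>" by eventually_elim (auto simp: G_def less_top split: if_splits)
  then show ?thesis by (rule AE_completion)
qed

section \<open>Hoelder's inequality for several factors\<close>

lemma weighted_amgm_ennreal:
  fixes x :: "'k \<Rightarrow> ennreal"
  assumes K: "finite K" and l: "\<And>k. k \<in> K \<Longrightarrow> 0 < l k" and sum: "(\<Sum>k\<in>K. l k) = (1::real)"
  shows "(\<Prod>k\<in>K. x k powe l k) \<le> (\<Sum>k\<in>K. ennreal (l k) * x k)"
proof -
  consider k where "k \<in> K" "x k = 0" | k where "k \<in> K" "x k = \<infinity>" | "\<forall>k\<in>K. x k \<noteq> 0 \<and> x k \<noteq> \<infinity>" by blast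
  then show ?thesis
  proof cases
    case (1 k)
    then have "(\<Prod>k\<in>K. x k powe l k) = 0" using K by (intro prod_zero) auto
    then show ?thesis by (simp only: zero_le)
  next
    case (2 k)
    have "ennreal (l k) * x k \<le> (\<Sum>k\<in>K. ennreal (l k) * x k)"
      using K 2 by (intro member_le_sum) auto
    moreover have "ennreal (l k) * x k = \<infinity>" using 2 l[of k] by (simp add: ennreal_mult_eq_top_iff)
    ultimately show ?thesis by (simp add: top_unique)
  next
    case 3
    define y where "y k = enn2real (x k)" for k
    have y: "0 < y k" "x k = ennreal (y k)" if "k \<in> K" for k
      using 3 that by (auto simp: y_def less_top enn2real_positive_iff zero_less_iff_neq_zero)
    \<comment> \<open>Jensen's inequality for \<open>exp\<close> at the points
      \<open>ln (y k)\<close>.\<close>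
    have "convex_on UNIV (exp :: real \<Rightarrow> real)" by (rule exp_convex)
    then have "exp (\<Sum>k\<in>K. l k *\<^sub>R ln (y k)) \<le> (\<Sum>k\<in>K. l k * exp (ln (y k)))"
      using K l sum by (intro convex_on_sum) (auto intro: less_imp_le)
    also have "\<dots> = (\<Sum>k\<in>K. l k * y k)" using y by (intro sum.cong) auto
    also have "exp (\<Sum>k\<in>K. l k *\<^sub>R ln (y k)) = (\<Prod>k\<in>K. y k powr l k)"
      using K y(1) by (simp add: exp_sum powr_def less_imp_neq[symmetric])
    finally have "ennreal (\<Prod>k\<in>K. y k powr l k) \<le> ennreal (\<Sum>k\<in>K. l k * y k)" by (rule ennreal_leI)
    moreover have "(\<Prod>k\<in>K. x k powe l k) = ennreal (\<Prod>k\<in>K. y k powr l k)"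
      using y by (subst prod_ennreal[symmetric]) (auto simp: powe_ennreal[OF less_imp_le[OF y(1)]] intro!: prod.cong)
    moreover have "(\<Sum>k\<in>K. ennreal (l k) * x k) = ennreal (\<Sum>k\<in>K. l k * y k)"
      using y l by (subst sum_ennreal[symmetric]) (auto simp: ennreal_mult less_imp_le intro!: sum.cong)
    ultimately show ?thesis by simp
  qed
qed

text \<open>Divide each \<open>f k\<close> by its integral \<open>A k\<close> and apply the weighted
  mean inequality pointwise; the right side then integrates to the product of the powers of the
  \<open>A k\<close>, because the weights sum to 1.\<close>

lemma nn_integral_Holder:
  fixes f :: "'k \<Rightarrow> 'a \<Rightarrow> ennreal"
  assumes K: "finite K" and l: "\<And>k. k \<in> K \<Longrightarrow> 0 < l k" and sum: "(\<Sum>k\<in>K. l k) = (1::real)"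
    and f [measurable]: "\<And>k. k \<in> K \<Longrightarrow> f k \<in> borel_measurable M"
  shows "(\<integral>\<^sup>+x. (\<Prod>k\<in>K. f k x powe l k) \<partial>M) \<le> (\<Prod>k\<in>K. (\<integral>\<^sup>+x. f k x \<partial>M) powe l k)"
proof -
  define A where "A k = (\<integral>\<^sup>+x. f k x \<partial>M)" for k
  \<comment> \<open>A factor with zero integral comes first: the integrand then vanishes almost
    everywhere, even if another integral is infinite.\<close>
  consider k where "k \<in> K" "A k = 0" | k where "k \<in> K" "A k = \<infinity>" "\<forall>k\<in>K. A k \<noteq> 0"
    | "\<forall>k\<in>K. A k \<noteq> 0 \<and> A k \<noteq> \<infinity>" by blast
  then show ?thesis
  proof cases
    case (1 k)
    then have "AE x in M. f k x = 0" by (simp add: A_def nn_integral_0_iff_AE)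
    then have "AE x in M. (\<Prod>k\<in>K. f k x powe l k) = 0"
      by eventually_elim (use 1 K in \<open>auto intro!: prod_zero\<close>)
    then have "(\<integral>\<^sup>+x. (\<Prod>k\<in>K. f k x powe l k) \<partial>M) = (\<integral>\<^sup>+x. 0 \<partial>M)" by (rule nn_integral_cong_AE)
    then show ?thesis by simp
  next
    case (2 k)
    then have "(\<Prod>k\<in>K. A k powe l k) = \<infinity>"
      using K by (simp add: ennreal_prod_eq_top) (auto intro!: bexI[of _ k])
    then show ?thesis by (simp add: A_def)
  next
    case 3
    have pt: "(\<Prod>k\<in>K. f k x powe l k) \<le> (\<Prod>k\<in>K. A k powe l k) * (\<Sum>k\<in>K. ennreal (l k) * (f k x / A k))" for x
    proof -
      have "f k x = A k * (f k x / A k)" if "k \<in> K" for k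
        using 3 that by (simp add: ennreal_times_divide mult.commute[of "A k"] ennreal_mult_divide_eq)
      then have "(\<Prod>k\<in>K. f k x powe l k) = (\<Prod>k\<in>K. (A k * (f k x / A k)) powe l k)"
        by (intro prod.cong refl) simp
      also have "\<dots> = (\<Prod>k\<in>K. A k powe l k) * (\<Prod>k\<in>K. (f k x / A k) powe l k)"
        by (simp add: powe_mult prod.distrib)
      also have "\<dots> \<le> (\<Prod>k\<in>K. A k powe l k) * (\<Sum>k\<in>K. ennreal (l k) * (f k x / A k))"
        by (intro mult_left_mono weighted_amgm_ennreal K l sum) auto
      finally show ?thesis .
    qed
    have "(\<integral>\<^sup>+x. (\<Prod>k\<in>K. f k x powe l k) \<partial>M)
        \<le> (\<integral>\<^sup>+x. (\<Prod>k\<in>K. A k powe l k) * (\<Sum>k\<in>K. ennreal (l k) * (f k x / A k)) \<partial>M)"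
      by (intro nn_integral_mono pt)
    also have "\<dots> = (\<Prod>k\<in>K. A k powe l k) * (\<Sum>k\<in>K. ennreal (l k) * (A k / A k))"
      by (simp add: nn_integral_cmult nn_integral_sum nn_integral_divide A_def)
    also have "(\<Sum>k\<in>K. ennreal (l k) * (A k / A k)) = (\<Sum>k\<in>K. ennreal (l k))"
      using 3 by (intro sum.cong) (auto simp: ennreal_divide_self less_top)
    also have "\<dots> = 1" using l sum by (subst sum_ennreal) (auto simp: less_imp_le)
    finally show ?thesis by (simp add: A_def)
  qed
qed

lemma coord_norm_Holder:
  fixes F :: "'k::finite \<Rightarrow> 'n::finite rvec \<Rightarrow> ennreal"
  assumes [measurable]: "\<And>k. F k \<in> borel_measurable borel"
    and q: "0 < q" and Q: "\<And>k. 0 < Q k" and sum: "1 / q = (\<Sum>k\<in>UNIV. 1 / Q k)"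
  shows "coord_norm q i (\<lambda>x. \<Prod>k\<in>UNIV. F k x) x \<le> (\<Prod>k\<in>UNIV. coord_norm (Q k) i (F k) x)"
proof -
  have "(\<Sum>k\<in>UNIV. q / Q k) = q * (\<Sum>k\<in>UNIV. 1 / Q k)" by (simp add: sum_distrib_left)
  then have s1: "(\<Sum>k\<in>UNIV. q / Q k) = 1" using q unfolding sum[symmetric] by simp
  have "(\<integral>\<^sup>+t. (\<Prod>k\<in>UNIV. F k (upd x i t)) powe q \<partial>lborel)
      = (\<integral>\<^sup>+t. (\<Prod>k\<in>UNIV. (F k (upd x i t) powe Q k) powe (q / Q k)) \<partial>lborel)"
    using Q by (intro nn_integral_cong) (simp add: powe_prod powe_powe less_imp_neq[symmetric])
  also have "\<dots> \<le> (\<Prod>k\<in>UNIV. (\<integral>\<^sup>+t. F k (upd x i t) powe Q k \<partial>lborel) powe (q / Q k))"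
    using q Q s1 by (intro nn_integral_Holder) auto
  finally have "coord_norm q i (\<lambda>x. \<Prod>k\<in>UNIV. F k x) x
      \<le> (\<Prod>k\<in>UNIV. (\<integral>\<^sup>+t. F k (upd x i t) powe Q k \<partial>lborel) powe (q / Q k)) powe (1 / q)"
    unfolding coord_norm_lborel using q by (intro powe_mono) auto
  also have "\<dots> = (\<Prod>k\<in>UNIV. coord_norm (Q k) i (F k) x)"
    using q by (simp add: powe_prod powe_powe coord_norm_lborel)
  finally show ?thesis .
qed

theorem mixed_norm_Holder:
  fixes F :: "'k::finite \<Rightarrow> 'n::{finite,linorder} rvec \<Rightarrow> ennreal"
  assumes F: "\<And>k. F k \<in> borel_measurable borel"
    and q: "\<And>i. 0 < q i" and Q: "\<And>k i. 0 < Q k i" and sum: "\<And>i. 1 / q i = (\<Sum>k\<in>UNIV. 1 / Q k i)"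
  shows "mixed_norm q (\<lambda>x. \<Prod>k\<in>UNIV. F k x) \<le> (\<Prod>k\<in>UNIV. mixed_norm (Q k) (F k))"
proof -
  have "iter_norm q xs (\<lambda>x. \<Prod>k\<in>UNIV. F k x) x \<le> (\<Prod>k\<in>UNIV. iter_norm (Q k) xs (F k) x)" for xs x
  proof (induction xs arbitrary: x rule: rev_induct)
    case (snoc i xs)
    have "iter_norm q (xs @ [i]) (\<lambda>x. \<Prod>k\<in>UNIV. F k x) x
        \<le> coord_norm (q i) i (\<lambda>x. \<Prod>k\<in>UNIV. iter_norm (Q k) xs (F k) x) x"
      using q by (auto intro!: coord_norm_mono snoc.IH)
    also have "\<dots> \<le> (\<Prod>k\<in>UNIV. coord_norm (Q k i) i (iter_norm (Q k) xs (F k)) x)"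
      using q Q sum by (intro coord_norm_Holder iter_norm_measurable F) auto
    finally show ?case by simp
  qed simp
  then show ?thesis unfolding mixed_norm_def by blast
qed

section \<open>Schwartz functions\<close>

lemma line_has_vector_derivative:
  assumes "(f has_derivative D) (at (x + t *\<^sub>R axis i 1))"
  shows "((\<lambda>t. f (x + t *\<^sub>R axis i 1)) has_vector_derivative D (axis i 1)) (at t)"
proof -
  have "((\<lambda>t. x + t *\<^sub>R axis i 1) has_derivative (\<lambda>t. t *\<^sub>R axis i 1)) (at t)"
    by (auto intro!: derivative_eq_intros)
  then have "((\<lambda>t. f (x + t *\<^sub>R axis i 1)) has_derivative (\<lambda>s. D (s *\<^sub>R axis i 1))) (at t)"
    using assms by (intro has_derivative_compose[of "\<lambda>t. x + t *\<^sub>R axis i 1" _ t UNIV f D]) auto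
  moreover have "D (s *\<^sub>R axis i 1) = s *\<^sub>R D (axis i 1)" for s
    using assms has_derivative_bounded_linear bounded_linear.linear linear_scale by blast
  ultimately show ?thesis by (simp add: has_vector_derivative_def)
qed

text \<open>\<open>partial\<close> is a derivative along a line. Through the total derivative, which
  smoothness supplies, the chain rule and linearity become available.\<close>

lemma partial_eq_derivative:
  assumes "(f has_derivative D) (at x)"
  shows "partial i f x = D (axis i 1)"
  unfolding partial_def
  by (rule vector_derivative_at) (use line_has_vector_derivative[of f D x 0 i] assms in simp)

lemma smooth_partial: "smooth f \<Longrightarrow> smooth (partial i f)"
  unfolding smooth_def by (metis fold_simps(2))

lemma smooth_imp_differentiable: "smooth f \<Longrightarrow> f differentiable (at x)"
  unfolding smooth_def by (metis fold_simps(1))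

lemma smooth_line_derivative:
  assumes "smooth g"
  shows "((\<lambda>t. g (x + t *\<^sub>R axis i 1)) has_vector_derivative partial i g (x + t *\<^sub>R axis i 1)) (at t)"
proof -
  obtain D where D: "(g has_derivative D) (at (x + t *\<^sub>R axis i 1))"
    using smooth_imp_differentiable[OF assms] differentiable_def by blast
  then show ?thesis unfolding partial_eq_derivative[OF D] by (rule line_has_vector_derivative)
qed

lemma affine_has_derivative:
  fixes f :: "'a::real_normed_vector \<Rightarrow> complex"
  assumes "(f has_derivative D) (at (a *\<^sub>R x + b))"
  shows "((\<lambda>y. c * f (a *\<^sub>R y + b)) has_derivative (\<lambda>h. c * D (a *\<^sub>R h))) (at x)"
proof -
  have "((\<lambda>y. a *\<^sub>R y + b) has_derivative (\<lambda>h. a *\<^sub>R h)) (at x)"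
    by (auto intro!: derivative_eq_intros)
  then have "((\<lambda>y. f (a *\<^sub>R y + b)) has_derivative (\<lambda>h. D (a *\<^sub>R h))) (at x)"
    using assms by (intro has_derivative_compose[of "\<lambda>y. a *\<^sub>R y + b" _ x UNIV f D]) auto
  then show ?thesis by (rule has_derivative_mult_right)
qed

lemma partial_affine:
  assumes "\<And>x. f differentiable (at x)"
  shows "partial i (\<lambda>y. c * f (a *\<^sub>R y + b)) = (\<lambda>y. (c * of_real a) * partial i f (a *\<^sub>R y + b))"
proof
  fix y
  obtain D where D: "(f has_derivative D) (at (a *\<^sub>R y + b))"
    using assms differentiable_def by blast
  have "D (a *\<^sub>R axis i 1) = a *\<^sub>R D (axis i 1)"
    using D has_derivative_bounded_linear bounded_linear.linear linear_scale by blast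
  then show "partial i (\<lambda>y. c * f (a *\<^sub>R y + b)) y = (c * of_real a) * partial i f (a *\<^sub>R y + b)"
    by (simp add: partial_eq_derivative[OF affine_has_derivative[OF D]] partial_eq_derivative[OF D]
        scaleR_conv_of_real[of a "D (axis i 1)"])
qed

text \<open>Affine substitutions with a real factor cover what convolution does to a test function:
  \<open>\<psi> ((x - y) / t)\<close>, as a function of \<open>y\<close>, has the factor
  \<open>- 1 / t\<close>.\<close>

lemma fold_partial_affine:
  assumes "smooth f"
  shows "fold partial is (\<lambda>y. c * f (a *\<^sub>R y + b))
    = (\<lambda>y. (c * of_real a ^ length is) * fold partial is f (a *\<^sub>R y + b))"
  using assms
proof (induction "is" arbitrary: c f)
  case (Cons i "is")
  have "fold partial (i # is) (\<lambda>y. c * f (a *\<^sub>R y + b))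
      = fold partial is (\<lambda>y. (c * of_real a) * partial i f (a *\<^sub>R y + b))"
    by (simp add: partial_affine smooth_imp_differentiable[OF Cons.prems])
  also have "\<dots> = (\<lambda>y. (c * of_real a * of_real a ^ length is) * fold partial is (partial i f) (a *\<^sub>R y + b))"
    by (rule Cons.IH[OF smooth_partial[OF Cons.prems]])
  finally show ?case by (simp add: mult.assoc)
qed simp

lemma smooth_affine:
  assumes "smooth f"
  shows "smooth (\<lambda>y. c * f (a *\<^sub>R y + b))"
  unfolding smooth_def fold_partial_affine[OF assms]
proof (intro allI)
  fix "is" x
  obtain D where "(fold partial is f has_derivative D) (at (a *\<^sub>R x + b))"
    using assms unfolding smooth_def differentiable_def by blast
  from affine_has_derivative[OF this]
  show "(\<lambda>y. c * complex_of_real a ^ length is * fold partial is f (a *\<^sub>R y + b)) differentiable at x"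
    unfolding differentiable_def by blast
qed

lemma fold_partial_lincomb:
  assumes "smooth f" "smooth g"
  shows "fold partial is (\<lambda>y. a * f y + b * g y) = (\<lambda>y. a * fold partial is f y + b * fold partial is g y)"
  using assms
proof (induction "is" arbitrary: f g)
  case (Cons i "is")
  have "partial i (\<lambda>y. a * f y + b * g y) = (\<lambda>y. a * partial i f y + b * partial i g y)"
  proof
    fix y
    obtain D E where D: "(f has_derivative D) (at y)" and E: "(g has_derivative E) (at y)"
      using Cons.prems smooth_imp_differentiable differentiable_def by meson
    have "((\<lambda>y. a * f y + b * g y) has_derivative (\<lambda>h. a * D h + b * E h)) (at y)"
      by (intro has_derivative_add has_derivative_mult_right D E)
    then show "partial i (\<lambda>y. a * f y + b * g y) y = a * partial i f y + b * partial i g y"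
      by (simp add: partial_eq_derivative[OF D] partial_eq_derivative[OF E] partial_eq_derivative)
  qed
  then show ?case
    by (simp add: Cons.IH[OF smooth_partial[OF Cons.prems(1)] smooth_partial[OF Cons.prems(2)]])
qed simp

lemma smooth_lincomb:
  assumes "smooth f" "smooth g"
  shows "smooth (\<lambda>y. a * f y + b * g y)"
  unfolding smooth_def fold_partial_lincomb[OF assms]
  using assms by (auto simp: smooth_def)

text \<open>\<open>smooth\<close> quantifies over lists of directions, \<open>multi_partial\<close>
  over multi-indices. Listing each coordinate as often as it is differentiated, in the order of
  \<open>multi_partial\<close>, makes the second an instance of the first, without any appeal to the
  symmetry of mixed derivatives.\<close>

definition index_list :: "('n::{finite,linorder} \<Rightarrow> nat) \<Rightarrow> 'n list \<Rightarrow> 'n list" where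
  "index_list \<beta> xs = concat (map (\<lambda>i. replicate (\<beta> i) i) xs)"

lemma fold_index_list: "fold partial (index_list \<beta> xs) f = fold (\<lambda>i. partial i ^^ \<beta> i) xs f"
  by (induction xs arbitrary: f) (auto simp: index_list_def)

lemma multi_partial_eq_fold: "multi_partial \<beta> f = fold partial (index_list \<beta> (sorted_list_of_set UNIV)) f"
  by (simp add: multi_partial_def fold_index_list)

lemma length_index_list: "length (index_list \<beta> (sorted_list_of_set UNIV)) = (\<Sum>i\<in>UNIV. \<beta> i)"
proof -
  have "length (index_list \<beta> (sorted_list_of_set UNIV)) = sum_list (map \<beta> (sorted_list_of_set UNIV))"
    by (simp add: index_list_def length_concat o_def)
  then show ?thesis by (simp add: sum_list_distinct_conv_sum_set)
qed

lemma multi_partial_affine: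
  assumes "smooth f"
  shows "multi_partial \<beta> (\<lambda>y. c * f (a *\<^sub>R y + b)) y
    = (c * of_real a ^ (\<Sum>i\<in>UNIV. \<beta> i)) * multi_partial \<beta> f (a *\<^sub>R y + b)"
  by (simp add: multi_partial_eq_fold fold_partial_affine[OF assms] length_index_list)

lemma multi_partial_lincomb:
  assumes "smooth f" "smooth g"
  shows "multi_partial \<beta> (\<lambda>y. a * f y + b * g y) y = a * multi_partial \<beta> f y + b * multi_partial \<beta> g y"
  by (simp add: multi_partial_eq_fold fold_partial_lincomb[OF assms])

section \<open>Schwartz functions and their seminorms\<close>

lemma schwartzI:
  assumes "smooth f" "\<And>N \<beta>. \<exists>B. \<forall>x. (1 + norm x) ^ N * cmod (multi_partial \<beta> f x) \<le> B"
  shows "f \<in> schwartz"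
  unfolding schwartz_def bdd_above_def using assms by fastforce

lemma schwartz_bound:
  assumes "f \<in> schwartz"
  obtains B where "\<And>x. (1 + norm x) ^ N * cmod (multi_partial \<beta> f x) \<le> B"
  using assms unfolding schwartz_def bdd_above_def by fastforce

lemma schwartz_smooth: "f \<in> schwartz \<Longrightarrow> smooth f"
  by (simp add: schwartz_def)

lemma schwartz_affine:
  assumes f: "f \<in> schwartz" and a: "a \<noteq> 0"
  shows "(\<lambda>y. c * f (a *\<^sub>R y + b)) \<in> schwartz"
proof (rule schwartzI)
  show "smooth (\<lambda>y. c * f (a *\<^sub>R y + b))" by (rule smooth_affine[OF schwartz_smooth[OF f]])
  fix N \<beta>
  obtain B where B: "\<And>x. (1 + norm x) ^ N * cmod (multi_partial \<beta> f x) \<le> B"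
    using schwartz_bound[OF f] by blast
  \<comment> \<open>From \<open>\<bar>a\<bar> * norm y \<le> norm (a *\<^sub>R y + b) + norm
    b\<close>.\<close>
  define K where "K = 1 + (1 + norm b) / \<bar>a\<bar>"
  have K: "1 + norm y \<le> K * (1 + norm (a *\<^sub>R y + b))" for y
  proof -
    have "\<bar>a\<bar> * norm y = norm ((a *\<^sub>R y + b) - b)" by simp
    also have "\<dots> \<le> norm (a *\<^sub>R y + b) + norm b" by (rule norm_triangle_ineq4)
    finally have "norm y \<le> (norm (a *\<^sub>R y + b) + norm b) / \<bar>a\<bar>" using a by (simp add: field_simps)
    also have "\<dots> \<le> ((1 + norm b) * (1 + norm (a *\<^sub>R y + b))) / \<bar>a\<bar>"
      by (intro divide_right_mono) (simp_all add: algebra_simps)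
    also have "\<dots> = (1 + norm b) / \<bar>a\<bar> * (1 + norm (a *\<^sub>R y + b))" by simp
    finally show ?thesis unfolding K_def by (simp add: distrib_right) (smt (verit) norm_ge_zero)
  qed
  have "(1 + norm y) ^ N * cmod (multi_partial \<beta> (\<lambda>y. c * f (a *\<^sub>R y + b)) y)
      \<le> K ^ N * (cmod c * \<bar>a\<bar> ^ (\<Sum>i\<in>UNIV. \<beta> i)) * B" for y
  proof -
    have "(1 + norm y) ^ N \<le> (K * (1 + norm (a *\<^sub>R y + b))) ^ N"
      by (intro power_mono K) simp
    then have "(1 + norm y) ^ N * cmod (multi_partial \<beta> (\<lambda>y. c * f (a *\<^sub>R y + b)) y)
       \<le> (K * (1 + norm (a *\<^sub>R y + b))) ^ N * cmod (multi_partial \<beta> (\<lambda>y. c * f (a *\<^sub>R y + b)) y)"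
      by (intro mult_right_mono) auto
    also have "\<dots> = K ^ N * (cmod c * \<bar>a\<bar> ^ (\<Sum>i\<in>UNIV. \<beta> i))
        * ((1 + norm (a *\<^sub>R y + b)) ^ N * cmod (multi_partial \<beta> f (a *\<^sub>R y + b)))"
      by (simp add: multi_partial_affine[OF schwartz_smooth[OF f]] norm_mult norm_power power_mult_distrib mult_ac)
    also have "\<dots> \<le> K ^ N * (cmod c * \<bar>a\<bar> ^ (\<Sum>i\<in>UNIV. \<beta> i)) * B"
      by (intro mult_left_mono B) (auto simp: K_def)
    finally show ?thesis .
  qed
  then show "\<exists>B. \<forall>y. (1 + norm y) ^ N * cmod (multi_partial \<beta> (\<lambda>y. c * f (a *\<^sub>R y + b)) y) \<le> B" by blast
qed

lemma schwartz_lincomb: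
  assumes f: "f \<in> schwartz" and g: "g \<in> schwartz"
  shows "(\<lambda>y. a * f y + b * g y) \<in> schwartz"
proof (rule schwartzI)
  show "smooth (\<lambda>y. a * f y + b * g y)" by (rule smooth_lincomb[OF schwartz_smooth[OF f] schwartz_smooth[OF g]])
  fix N \<beta>
  obtain B where B: "\<And>x. (1 + norm x) ^ N * cmod (multi_partial \<beta> f x) \<le> B"
    using schwartz_bound[OF f] by blast
  obtain B' where B': "\<And>x. (1 + norm x) ^ N * cmod (multi_partial \<beta> g x) \<le> B'"
    using schwartz_bound[OF g] by blast
  have "(1 + norm y) ^ N * cmod (multi_partial \<beta> (\<lambda>y. a * f y + b * g y) y) \<le> cmod a * B + cmod b * B'" for y
  proof -
    have "(1 + norm y) ^ N * cmod (multi_partial \<beta> (\<lambda>y. a * f y + b * g y) y)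
       \<le> (1 + norm y) ^ N * (cmod a * cmod (multi_partial \<beta> f y) + cmod b * cmod (multi_partial \<beta> g y))"
      by (intro mult_left_mono)
         (auto simp: multi_partial_lincomb[OF schwartz_smooth[OF f] schwartz_smooth[OF g]] norm_mult[symmetric]
           intro: norm_triangle_ineq)
    also have "\<dots> = cmod a * ((1 + norm y) ^ N * cmod (multi_partial \<beta> f y))
        + cmod b * ((1 + norm y) ^ N * cmod (multi_partial \<beta> g y))"
      by (simp add: algebra_simps)
    also have "\<dots> \<le> cmod a * B + cmod b * B'"
      by (intro add_mono mult_left_mono B B') auto
    finally show ?thesis .
  qed
  then show "\<exists>B. \<forall>y. (1 + norm y) ^ N * cmod (multi_partial \<beta> (\<lambda>y. a * f y + b * g y) y) \<le> B" by blast
qed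

text \<open>Over an infinite index set the sum in \<open>schwartz_norm\<close> would be 0 by
  convention and would control nothing.\<close>

lemma finite_multiindices: "finite {\<beta> :: 'n::finite \<Rightarrow> nat. (\<Sum>i\<in>UNIV. \<beta> i) \<le> N}"
proof (rule finite_subset)
  show "{\<beta> :: 'n \<Rightarrow> nat. (\<Sum>i\<in>UNIV. \<beta> i) \<le> N} \<subseteq> (\<Pi>\<^sub>E i\<in>UNIV. {..N})"
  proof (clarsimp simp: PiE_def Pi_def extensional_def)
    fix \<beta> :: "'n \<Rightarrow> nat" and i assume "(\<Sum>i\<in>UNIV. \<beta> i) \<le> N"
    then show "\<beta> i \<le> N" using member_le_sum[of i UNIV \<beta>] by simp
  qed
  show "finite ((\<Pi>\<^sub>E i\<in>UNIV. {..N}) :: ('n \<Rightarrow> nat) set)" by (rule finite_PiE) auto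
qed

definition num_multiindices :: "'n::finite itself \<Rightarrow> nat \<Rightarrow> nat" where
  "num_multiindices _ N = card {\<beta> :: 'n \<Rightarrow> nat. (\<Sum>i\<in>UNIV. \<beta> i) \<le> N}"

lemma schwartz_norm_ge:
  assumes f: "f \<in> schwartz" and \<beta>: "(\<Sum>i\<in>UNIV. \<beta> i) \<le> N"
  shows "(1 + norm x) ^ N * cmod (multi_partial \<beta> f x) \<le> schwartz_norm N f"
proof -
  let ?S = "\<lambda>\<beta>. SUP x. (1 + norm x) ^ N * cmod (multi_partial \<beta> f x)"
  have le: "(1 + norm x) ^ N * cmod (multi_partial \<beta> f x) \<le> ?S \<beta>" for \<beta> x
    using f by (intro cSUP_upper) (auto simp: schwartz_def)
  then have nn: "0 \<le> ?S \<beta>" for \<beta>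
    by (rule order_trans[rotated, of _ _ 0]) simp
  have "?S \<beta> \<le> schwartz_norm N f"
    unfolding schwartz_norm_def using \<beta> nn
    by (intro member_le_sum[where f = ?S] finite_multiindices) auto
  then show ?thesis using le order_trans by blast
qed

lemma multi_partial_0: "multi_partial (\<lambda>_. 0) f = f"
proof -
  have "fold (\<lambda>i. partial i ^^ (0::nat)) xs f = f" for xs by (induction xs) auto
  then show ?thesis by (simp add: multi_partial_def)
qed

lemma schwartz_norm_nonneg: "f \<in> schwartz \<Longrightarrow> 0 \<le> schwartz_norm N f"
  by (rule order_trans[OF _ schwartz_norm_ge[of f "\<lambda>_. 0" N 0]]) auto

lemma schwartz_norm_le:
  fixes f :: "'n::{finite,linorder} rvec \<Rightarrow> complex"
  assumes "\<And>\<beta> x. (\<Sum>i\<in>UNIV. \<beta> i) \<le> N \<Longrightarrow> (1 + norm x) ^ N * cmod (multi_partial \<beta> f x) \<le> B"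
  shows "schwartz_norm N f \<le> real (num_multiindices TYPE('n) N) * B"
proof -
  have "schwartz_norm N f \<le> (\<Sum>\<beta> | (\<Sum>i\<in>(UNIV::'n set). \<beta> i) \<le> N. B)"
    unfolding schwartz_norm_def using assms by (intro sum_mono cSUP_least) auto
  then show ?thesis by (simp add: num_multiindices_def)
qed

section \<open>Gaussians\<close>

text \<open>Polynomial multiples of the Gaussian centred at \<open>x\<close>, as functions of
  \<open>y\<close>. The polynomial depends jointly on \<open>s\<close> and \<open>x - y\<close>, so
  that differentiation in \<open>y\<close> stays in the class with one polynomial for all
  \<open>s\<close> and \<open>x\<close>. This yields bounds that are uniform over compact sets of
  parameters.\<close>

definition gauss_poly ::
    "(real \<times> 'n::finite rvec \<Rightarrow> real) \<Rightarrow> real \<Rightarrow> 'n rvec \<Rightarrow> 'n rvec \<Rightarrow> complex" where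
  "gauss_poly q s x y = complex_of_real (q (s, x - y) * exp (- s * (norm (x - y))\<^sup>2))"

abbreviation gauss :: "real \<Rightarrow> 'n::finite rvec \<Rightarrow> 'n rvec \<Rightarrow> complex" where
  "gauss \<equiv> gauss_poly (\<lambda>_. 1)"

lemma gauss_eq: "gauss s x y = complex_of_real (exp (- s * (norm (x - y))\<^sup>2))"
  by (simp add: gauss_poly_def)

lemma real_polynomial_directional_derivative:
  assumes "real_polynomial_function q"
  shows "\<exists>q'. real_polynomial_function q' \<and> (\<forall>w. ((\<lambda>t. q (w + t *\<^sub>R v)) has_real_derivative q' w) (at 0))"
  using assms
proof induction
  case (linear f)
  interpret f: bounded_linear f by fact
  have "((\<lambda>t. f (w + t *\<^sub>R v)) has_real_derivative f v) (at 0)" for w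
    unfolding f.add f.scaleR by (auto intro!: derivative_eq_intros)
  then show ?case by (intro exI[of _ "\<lambda>_. f v"]) (auto intro: real_polynomial_function.intros(2))
next
  case (const c)
  show ?case by (intro exI[of _ "\<lambda>_. 0"]) (auto intro: real_polynomial_function.intros(2))
next
  case (add f g)
  then obtain f' g' where "real_polynomial_function f'" "real_polynomial_function g'"
    and *: "\<And>w. ((\<lambda>t. f (w + t *\<^sub>R v)) has_real_derivative f' w) (at 0)"
      "\<And>w. ((\<lambda>t. g (w + t *\<^sub>R v)) has_real_derivative g' w) (at 0)" by blast
  then show ?case
    by (intro exI[of _ "\<lambda>w. f' w + g' w"]) (auto intro: real_polynomial_function.intros(3) DERIV_add)
next
  case (mult f g)
  then obtain f' g' where "real_polynomial_function f'" "real_polynomial_function g'"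
    and *: "\<And>w. ((\<lambda>t. f (w + t *\<^sub>R v)) has_real_derivative f' w) (at 0)"
      "\<And>w. ((\<lambda>t. g (w + t *\<^sub>R v)) has_real_derivative g' w) (at 0)" by blast
  moreover have "((\<lambda>t. f (w + t *\<^sub>R v) * g (w + t *\<^sub>R v)) has_real_derivative f' w * g w + g' w * f w) (at 0)" for w
    using DERIV_mult[OF *(1)[of w] *(2)[of w]] by simp
  ultimately show ?case using mult
    by (intro exI[of _ "\<lambda>w. f' w * g w + g' w * f w"])
       (auto intro!: real_polynomial_function.intros(3) real_polynomial_function.intros(4))
qed

lemma gauss_poly_differentiable:
  assumes "real_polynomial_function q"
  shows "gauss_poly q s x differentiable (at y)"
proof -
  have "(\<lambda>y. (s, x - y)) differentiable (at y)"
    unfolding differentiable_def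
    by (rule exI[of _ "\<lambda>h. (0, - h)"]) (auto intro!: derivative_eq_intros)
  then have "(q \<circ> (\<lambda>y. (s, x - y))) differentiable (at y)"
    by (intro differentiable_chain_at differentiable_at_real_polynomial_function assms)
  then obtain D where D: "((\<lambda>y. q (s, x - y)) has_derivative D) (at y)"
    unfolding differentiable_def o_def by blast
  have E: "\<exists>E. ((\<lambda>y. exp (- s * ((x - y) \<bullet> (x - y)))) has_derivative E) (at y)"
    by (rule exI) (rule derivative_eq_intros refl | simp)+
  then obtain E where E: "((\<lambda>y. exp (- s * (norm (x - y))\<^sup>2)) has_derivative E) (at y)"
    by (auto simp: power2_norm_eq_inner)
  have "((\<lambda>y. complex_of_real (q (s, x - y) * exp (- s * (norm (x - y))\<^sup>2))) has_derivative
     (\<lambda>h. complex_of_real (q (s, x - y) * E h + D h * exp (- s * (norm (x - y))\<^sup>2)))) (at y)"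
    by (intro has_derivative_of_real has_derivative_mult D E)
  then show ?thesis unfolding gauss_poly_def[abs_def] differentiable_def by blast
qed

lemma partial_gauss_poly:
  fixes q :: "real \<times> 'n::finite rvec \<Rightarrow> real"
  assumes q: "real_polynomial_function q"
  shows "\<exists>q'. real_polynomial_function q' \<and> (\<forall>s x. partial i (gauss_poly q s x) = gauss_poly q' s x)"
proof -
  \<comment> \<open>\<open>s\<close> stays fixed, and \<open>y\<close> enters through
    \<open>x - y\<close>, whence the sign.\<close>
  define v where "v = (0::real, - axis i (1::real) :: 'n rvec)"
  obtain d where d: "real_polynomial_function d"
    "\<And>w. ((\<lambda>t. q (w + t *\<^sub>R v)) has_real_derivative d w) (at 0)"
    using real_polynomial_directional_derivative[OF q] by blast
  \<comment> \<open>The second term comes from the exponential; \<open>fst w\<close> is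
    \<open>s\<close>.\<close>
  define q' where "q' = (\<lambda>w. d w + (2 * fst w * (snd w $ i)) * q w)"
  have "real_polynomial_function q'"
    unfolding q'_def
    by (intro real_polynomial_function.intros(3) real_polynomial_function.intros(4) d q
        real_polynomial_function.intros(2) real_polynomial_function.intros(1)
        bounded_linear_fst bounded_linear_compose[OF bounded_linear_vec_nth bounded_linear_snd])
  moreover have "partial i (gauss_poly q s x) y = gauss_poly q' s x y" for s x y
  proof -
    define z where "z = x - y"
    have 1: "((\<lambda>t. q (s, z - t *\<^sub>R axis i 1)) has_real_derivative d (s, z)) (at 0)"
      using d(2)[of "(s, z)"] by (simp add: v_def)
    have n: "(norm (z - t *\<^sub>R axis i 1))\<^sup>2 = z \<bullet> z - 2 * t * (z $ i) + t\<^sup>2" for t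
      unfolding power2_norm_eq_inner
      by (simp add: inner_diff_left inner_diff_right inner_axis inner_commute[of "axis i 1"]
          power2_eq_square algebra_simps)
    have 2: "((\<lambda>t. exp (- s * (norm (z - t *\<^sub>R axis i 1))\<^sup>2)) has_real_derivative
        exp (- s * (norm z)\<^sup>2) * (2 * s * (z $ i))) (at 0)"
      unfolding n by (auto intro!: derivative_eq_intros simp: power2_norm_eq_inner)
    have "((\<lambda>t. q (s, z - t *\<^sub>R axis i 1) * exp (- s * (norm (z - t *\<^sub>R axis i 1))\<^sup>2)) has_real_derivative
        q' (s, z) * exp (- s * (norm z)\<^sup>2)) (at 0)"
      using DERIV_mult[OF 1 2] by (simp add: q'_def algebra_simps)
    then have "((\<lambda>t. complex_of_real (q (s, z - t *\<^sub>R axis i 1) * exp (- s * (norm (z - t *\<^sub>R axis i 1))\<^sup>2)))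
        has_vector_derivative complex_of_real (q' (s, z) * exp (- s * (norm z)\<^sup>2))) (at 0)"
      by (intro has_vector_derivative_of_real)
         (simp add: has_real_derivative_iff_has_vector_derivative)
    then have "((\<lambda>t. gauss_poly q s x (y + t *\<^sub>R axis i 1)) has_vector_derivative gauss_poly q' s x y) (at 0)"
      by (simp add: gauss_poly_def z_def diff_diff_eq)
    then show ?thesis unfolding partial_def by (rule vector_derivative_at)
  qed
  ultimately show ?thesis by blast
qed

lemma fold_partial_gauss_poly:
  fixes q :: "real \<times> 'n::finite rvec \<Rightarrow> real"
  assumes "real_polynomial_function q"
  shows "\<exists>q'. real_polynomial_function q' \<and> (\<forall>s x. fold partial is (gauss_poly q s x) = gauss_poly q' s x)"
  using assms
proof (induction "is" arbitrary: q)
  case (Cons i "is")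
  obtain q1 where q1: "real_polynomial_function q1" "\<And>s x. partial i (gauss_poly q s x) = gauss_poly q1 s x"
    using partial_gauss_poly[OF Cons.prems] by blast
  then show ?case using Cons.IH[OF q1(1)] by simp
qed auto

lemma smooth_gauss_poly:
  assumes "real_polynomial_function q"
  shows "smooth (gauss_poly q s x)"
  unfolding smooth_def by (metis fold_partial_gauss_poly[OF assms] gauss_poly_differentiable)

lemma real_polynomial_growth:
  assumes "real_polynomial_function q"
  shows "\<exists>M k. 0 \<le> M \<and> (\<forall>w. \<bar>q w\<bar> \<le> M * (1 + norm w) ^ k)"
  using assms
proof induction
  case (linear f)
  obtain K where K: "0 < K" "\<And>w. norm (f w) \<le> norm w * K" using bounded_linear.pos_bounded[OF linear] by blast
  have "\<bar>f w\<bar> \<le> K * (1 + norm w) ^ 1" for w using K(2)[of w] K(1) by (simp add: algebra_simps)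
  then show ?case using K(1) less_imp_le by blast
next
  case (const c)
  have "\<bar>c\<bar> \<le> \<bar>c\<bar> * (1 + norm w) ^ 0" for w :: 'a by simp
  then show ?case using abs_ge_zero by blast
next
  case (add f g)
  then obtain M k M' k' where *: "0 \<le> M" "0 \<le> M'" "\<And>w. \<bar>f w\<bar> \<le> M * (1 + norm w) ^ k"
    "\<And>w. \<bar>g w\<bar> \<le> M' * (1 + norm w) ^ k'" by blast
  have "\<bar>f w + g w\<bar> \<le> (M + M') * (1 + norm w) ^ (k + k')" for w
  proof -
    have "\<bar>f w + g w\<bar> \<le> M * (1 + norm w) ^ k + M' * (1 + norm w) ^ k'"
      using *(3,4)[of w] by linarith
    also have "\<dots> \<le> M * (1 + norm w) ^ (k + k') + M' * (1 + norm w) ^ (k + k')"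
      using * by (intro add_mono mult_left_mono power_increasing) auto
    finally show ?thesis by (simp add: distrib_right)
  qed
  then show ?case using * by (meson add_nonneg_nonneg)
next
  case (mult f g)
  then obtain M k M' k' where *: "0 \<le> M" "0 \<le> M'" "\<And>w. \<bar>f w\<bar> \<le> M * (1 + norm w) ^ k"
    "\<And>w. \<bar>g w\<bar> \<le> M' * (1 + norm w) ^ k'" by blast
  have "\<bar>f w * g w\<bar> \<le> (M * M') * (1 + norm w) ^ (k + k')" for w
  proof -
    have "\<bar>f w * g w\<bar> \<le> (M * (1 + norm w) ^ k) * (M' * (1 + norm w) ^ k')"
      unfolding abs_mult using * by (intro mult_mono) auto
    then show ?thesis by (simp add: power_add mult_ac)
  qed
  then show ?case using * by (meson mult_nonneg_nonneg)
qed

text \<open>With \<open>u = a * (1 + r)^2 / 2\<close>, raising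
  \<open>u / K \<le> exp (u / K)\<close> to the power \<open>K\<close> gives
  \<open>(u / K) ^ K * exp (- u) \<le> 1\<close>, and \<open>(1 + r)^2 \<le> 2 * (1 + r^2)\<close>
  gives \<open>exp (- a * r^2) \<le> exp a * exp (- u)\<close>. Taking \<open>K = Suc L\<close>
  keeps the divisor positive.\<close>

lemma power_times_gaussian_le:
  fixes r :: real
  assumes a: "0 < a" and r: "0 \<le> r" and K: "K = Suc L"
  shows "(1 + r) ^ L * exp (- a * r\<^sup>2) \<le> exp a * (2 * real K / a) ^ K"
proof -
  define m where "m = real K"
  have m: "0 < m" by (simp add: m_def K)
  define u where "u = (1 + r)\<^sup>2 * (a / 2)"
  have u0: "0 < u" using a r by (simp add: u_def)
  have "(u / m) ^ K \<le> exp (u / m) ^ K"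
    using u0 m by (intro power_mono order_trans[OF _ exp_ge_add_one_self]) auto
  also have "\<dots> = exp u" using m by (subst exp_of_nat_mult[symmetric]) (simp add: m_def)
  finally have "(u / m) ^ K * exp (- u) \<le> exp u * exp (- u)" by (rule mult_right_mono) simp
  then have 1: "(u / m) ^ K * exp (- u) \<le> 1" by (simp add: exp_add[symmetric])
  have 2: "(1 + r) ^ L \<le> ((1 + r)\<^sup>2) ^ K"
    using r K by (subst power_mult[symmetric]) (intro power_increasing; simp)
  have "(2 * m / a) * (u / m) = (1 + r)\<^sup>2" using a m by (simp add: u_def)
  then have 3: "(2 * m / a) ^ K * (u / m) ^ K = ((1 + r)\<^sup>2) ^ K"
    by (subst power_mult_distrib[symmetric]) simp
  have 4: "exp (- a * r\<^sup>2) \<le> exp a * exp (- u)"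
  proof -
    have "0 \<le> (1 - r)\<^sup>2" by simp
    then have "(1 + r)\<^sup>2 / 2 \<le> 1 + r\<^sup>2" by (simp add: power2_eq_square algebra_simps)
    then have "a * ((1 + r)\<^sup>2 / 2) \<le> a * (1 + r\<^sup>2)" using a by (intro mult_left_mono) auto
    then have "- a * r\<^sup>2 \<le> a + - u" by (simp add: u_def algebra_simps)
    then show ?thesis by (simp add: exp_add[symmetric])
  qed
  have "(1 + r) ^ L * exp (- a * r\<^sup>2) \<le> ((1 + r)\<^sup>2) ^ K * (exp a * exp (- u))"
    using 2 4 r by (intro mult_mono) auto
  also have "\<dots> = exp a * (2 * m / a) ^ K * ((u / m) ^ K * exp (- u))"
    by (simp only: 3[symmetric] mult_ac)
  also have "\<dots> \<le> exp a * (2 * m / a) ^ K * 1"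
    using a m by (intro mult_left_mono 1) auto
  finally show ?thesis by (simp add: m_def)
qed

text \<open>Uniform in \<open>s\<close> over a compact interval and in \<open>x\<close> over a ball.
  The growth of the polynomial and the weight of order \<open>N\<close> are both absorbed by the
  Gaussian with the smallest parameter \<open>a\<close>.\<close>

lemma gauss_poly_decay:
  fixes q :: "real \<times> 'n::finite rvec \<Rightarrow> real"
  assumes q: "real_polynomial_function q" and a: "0 < a"
  shows "\<exists>B. 0 \<le> B \<and> (\<forall>s x y. a \<le> s \<longrightarrow> s \<le> b \<longrightarrow> norm x \<le> R \<longrightarrow> (1 + norm y) ^ N * cmod (gauss_poly q s x y) \<le> B)"
proof -
  obtain M k where M: "0 \<le> M" "\<And>w. \<bar>q w\<bar> \<le> M * (1 + norm w) ^ k"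
    using real_polynomial_growth[OF q] by blast
  define G where "G = exp a * (2 * real (Suc (N + k)) / a) ^ Suc (N + k)"
  define B where "B = (1 + \<bar>R\<bar>) ^ N * (M * (1 + \<bar>b\<bar>) ^ k) * G"
  have "(1 + norm y) ^ N * cmod (gauss_poly q s x y) \<le> B"
    if s: "a \<le> s" "s \<le> b" and x: "norm x \<le> R" for s x y
  proof -
    define r where "r = norm (x - y)"
    have r: "0 \<le> r" by (simp add: r_def)
    have "norm y \<le> norm x + r"
      using norm_triangle_ineq4[of x "x - y"] by (simp add: r_def)
    then have "1 + norm y \<le> (1 + \<bar>R\<bar>) * (1 + r)"
      using x r by (simp add: algebra_simps) (smt (verit) mult_nonneg_nonneg)
    then have 1: "(1 + norm y) ^ N \<le> (1 + \<bar>R\<bar>) ^ N * (1 + r) ^ N"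
      by (subst power_mult_distrib[symmetric]) (intro power_mono; simp)
    have "norm (s, x - y) \<le> \<bar>b\<bar> + r"
      using norm_Pair_le[of s "x - y"] s a by (simp add: r_def)
    then have "1 + norm (s, x - y) \<le> (1 + \<bar>b\<bar>) * (1 + r)"
      using r by (simp add: algebra_simps) (smt (verit) mult_nonneg_nonneg)
    then have "(1 + norm (s, x - y)) ^ k \<le> (1 + \<bar>b\<bar>) ^ k * (1 + r) ^ k"
      by (subst power_mult_distrib[symmetric]) (intro power_mono; simp)
    then have 2: "\<bar>q (s, x - y)\<bar> \<le> M * ((1 + \<bar>b\<bar>) ^ k * (1 + r) ^ k)"
      using M(2)[of "(s, x - y)"] M(1) by (meson mult_left_mono order_trans)
    have 3: "exp (- s * r\<^sup>2) \<le> exp (- a * r\<^sup>2)" using s by (simp add: mult_right_mono)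
    have 4: "(1 + r) ^ (N + k) * exp (- a * r\<^sup>2) \<le> G"
      unfolding G_def by (rule power_times_gaussian_le[OF a r refl])
    have "(1 + norm y) ^ N * cmod (gauss_poly q s x y) = (1 + norm y) ^ N * (\<bar>q (s, x - y)\<bar> * exp (- s * r\<^sup>2))"
      by (simp add: gauss_poly_def r_def norm_mult del: of_real_mult)
         (simp add: abs_mult)
    also have "\<dots> \<le> ((1 + \<bar>R\<bar>) ^ N * (1 + r) ^ N) * ((M * ((1 + \<bar>b\<bar>) ^ k * (1 + r) ^ k)) * exp (- a * r\<^sup>2))"
      using r M(1) by (intro mult_mono 1 2 3) auto
    also have "\<dots> = (1 + \<bar>R\<bar>) ^ N * (M * (1 + \<bar>b\<bar>) ^ k) * ((1 + r) ^ (N + k) * exp (- a * r\<^sup>2))"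
      by (simp add: power_add mult_ac)
    also have "\<dots> \<le> B"
      unfolding B_def using M(1) by (intro mult_left_mono 4) auto
    finally show ?thesis .
  qed
  moreover have "0 \<le> B" using M(1) a by (simp add: B_def G_def)
  ultimately show ?thesis by blast
qed

lemma multi_partial_gauss:
  "\<exists>q. real_polynomial_function q \<and>
     (\<forall>s (x :: 'n::{finite,linorder} rvec). multi_partial \<beta> (gauss s x) = gauss_poly q s x)"
  unfolding multi_partial_eq_fold using fold_partial_gauss_poly[OF real_polynomial_function.intros(2)] by blast

lemma gauss_schwartz:
  fixes x :: "'n::{finite,linorder} rvec"
  assumes "0 < s"
  shows "gauss s x \<in> schwartz"
proof (rule schwartzI)
  show "smooth (gauss s x)" by (rule smooth_gauss_poly[OF real_polynomial_function.intros(2)])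
  fix N \<beta>
  obtain q' where q': "real_polynomial_function q'"
    "\<And>s x :: 'n rvec. multi_partial \<beta> (gauss s x) = gauss_poly q' s x"
      using multi_partial_gauss[of \<beta>] by blast
  show "\<exists>B. \<forall>y. (1 + norm y) ^ N * cmod (multi_partial \<beta> (gauss s x) y) \<le> B"
    using gauss_poly_decay[OF q'(1) assms, of s "norm x" N] unfolding q'(2) by blast
qed

text \<open>Translates by bounded \<open>h\<close> form a bounded family in the seminorm, so one
  factor \<open>1 / C\<close> makes all of them admissible for the grand maximal function. This is
  what allows a value at \<open>x\<close> to be compared with the maximal function at a nearby
  point.\<close>

lemma gauss_translates_bounded:
  "\<exists>C>0. \<forall>h :: 'n::{finite,linorder} rvec. norm h \<le> R \<longrightarrow> schwartz_norm N (\<lambda>y. complex_of_real (1 / C) * gauss 1 h y) \<le> 1"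
proof -
  define I where "I = {\<beta> :: 'n \<Rightarrow> nat. (\<Sum>i\<in>UNIV. \<beta> i) \<le> N}"
  have "\<exists>B. \<forall>h y :: 'n rvec. norm h \<le> R \<longrightarrow> (1 + norm y) ^ N * cmod (multi_partial \<beta> (gauss 1 h) y) \<le> B" for \<beta>
  proof -
    obtain q' where q': "real_polynomial_function q'"
      "\<And>s x :: 'n rvec. multi_partial \<beta> (gauss s x) = gauss_poly q' s x"
      using multi_partial_gauss[of \<beta>] by blast
    show ?thesis
      using gauss_poly_decay[OF q'(1) zero_less_one, of 1 R N] unfolding q'(2) by auto
  qed
  then obtain B where B: "\<And>\<beta> h y :: 'n rvec. norm h \<le> R \<Longrightarrow> (1 + norm y) ^ N * cmod (multi_partial \<beta> (gauss 1 h) y) \<le> B \<beta>"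
    by metis
  define B' where "B' = 1 + (\<Sum>\<beta>\<in>I. \<bar>B \<beta>\<bar>)"
  have B'0: "0 < B'" unfolding B'_def by (smt (verit) sum_nonneg abs_ge_zero)
  have BB: "B \<beta> \<le> B'" if "\<beta> \<in> I" for \<beta>
    using member_le_sum[of \<beta> I "\<lambda>\<beta>. \<bar>B \<beta>\<bar>"] that finite_multiindices[of N] unfolding B'_def I_def
    by fastforce
  define c where "c = real (num_multiindices TYPE('n) N)"
  have "(\<lambda>_. 0) \<in> I" by (simp add: I_def)
  then have c: "0 < c" using finite_multiindices[of N, where 'n = 'n] unfolding c_def num_multiindices_def I_def
    by (auto simp: card_gt_0_iff intro!: exI[of _ "\<lambda>_. 0"])
  have "schwartz_norm N (\<lambda>y. complex_of_real (1 / (c * B')) * gauss 1 h y) \<le> 1" if h: "norm h \<le> R" for h :: "'n rvec"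
  proof -
    have "schwartz_norm N (\<lambda>y. complex_of_real (1 / (c * B')) * gauss 1 h y) \<le> c * (1 / c)"
      unfolding c_def
    proof (rule schwartz_norm_le, fold c_def)
      fix \<beta> :: "'n \<Rightarrow> nat" and x :: "'n rvec" assume "(\<Sum>i\<in>UNIV. \<beta> i) \<le> N"
      then have "(1 + norm x) ^ N * cmod (multi_partial \<beta> (gauss 1 h) x) \<le> B'"
        using B[OF h, of x \<beta>] BB[of \<beta>] by (auto simp: I_def)
      then have "(1 + norm x) ^ N * cmod (multi_partial \<beta> (gauss 1 h) x) / (c * B') \<le> B' / (c * B')"
        using c B'0 by (intro divide_right_mono) auto
      moreover have mp: "multi_partial \<beta> (\<lambda>y. k * gauss 1 h y) x = k * multi_partial \<beta> (gauss 1 h) x" for k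
        using multi_partial_affine[OF schwartz_smooth[OF gauss_schwartz[of 1 h]], of \<beta> k 1 0 x] by simp
      ultimately show "(1 + norm x) ^ N * cmod (multi_partial \<beta> (\<lambda>y. complex_of_real (1 / (c * B')) * gauss 1 h y) x) \<le> 1 / c"
        using c B'0 unfolding mp by (simp add: norm_mult norm_divide)
    qed
    then show ?thesis using c by simp
  qed
  moreover have "0 < c * B'" using c B'0 by simp
  ultimately show ?thesis by blast
qed

section \<open>Tempered distributions tested on Gaussians\<close>

lemma tempered_lincomb:
  "u \<in> tempered \<Longrightarrow> \<phi> \<in> schwartz \<Longrightarrow> \<psi> \<in> schwartz \<Longrightarrow>
    u (\<lambda>x. a * \<phi> x + b * \<psi> x) = a * u \<phi> + b * u \<psi>"
  by (simp add: tempered_def)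

lemma tempered_scale:
  assumes "u \<in> tempered" "\<phi> \<in> schwartz"
  shows "u (\<lambda>x. c * \<phi> x) = c * u \<phi>"
  using tempered_lincomb[OF assms assms(2), of c 0] by simp

text \<open>For \<open>norm y \<le> \<rho>\<close> this is uniform continuity on a compact set.
  Beyond, \<open>B\<close> bounds both functions with one more power of the weight, so the
  difference is at most \<open>2 * B / (1 + norm y)\<close>, and \<open>\<rho>\<close> is chosen to
  make this at most \<open>e\<close>.\<close>

lemma gauss_poly_locally_uniform:
  fixes q :: "real \<times> 'n::finite rvec \<Rightarrow> real"
  assumes q: "real_polynomial_function q" and s0: "0 < s0" and e: "0 < e"
  shows "\<forall>\<^sub>F z in nhds (s0, x0).
    \<forall>y. (1 + norm y) ^ N * cmod (gauss_poly q (fst z) (snd z) y - gauss_poly q s0 x0 y) \<le> e"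
proof -
  define R where "R = norm x0 + 1"
  obtain B where B: "0 \<le> B"
    "\<And>s x y. s0 / 2 \<le> s \<Longrightarrow> s \<le> 2 * s0 \<Longrightarrow> norm x \<le> R \<Longrightarrow>
        (1 + norm y) ^ Suc N * cmod (gauss_poly q s x y) \<le> B"
    using gauss_poly_decay[OF q, of "s0 / 2" "2 * s0" R "Suc N"] s0 by auto
  define \<rho> where "\<rho> = 2 * B / e"
  have \<rho>: "0 \<le> \<rho>" using B(1) e by (simp add: \<rho>_def)
  define D where "D = ({s0 / 2..2 * s0} \<times> cball (0::'n rvec) R) \<times> cball (0::'n rvec) \<rho>"
  define H where "H = (\<lambda>w :: (real \<times> 'n rvec) \<times> 'n rvec.
      of_real ((1 + norm (snd w)) ^ N) * gauss_poly q (fst (fst w)) (snd (fst w)) (snd w))"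
  have cq: "continuous_on UNIV q"
    using q differentiable_imp_continuous_on differentiable_on_real_polynomial_function by blast
  have "continuous_on D H"
    unfolding H_def gauss_poly_def
    by (intro continuous_intros continuous_on_compose2[OF cq]) auto
  moreover have "compact D" unfolding D_def by (intro compact_Times compact_cball compact_Icc)
  ultimately have "uniformly_continuous_on D H" by (rule compact_uniformly_continuous)
  then obtain d where d: "0 < d" "\<And>w w'. w \<in> D \<Longrightarrow> w' \<in> D \<Longrightarrow> dist w' w < d \<Longrightarrow> dist (H w') (H w) < e"
    using e unfolding uniformly_continuous_on_def by meson
  define \<delta> where "\<delta> = Min {d, s0 / 2, 1}"
  have \<delta>: "0 < \<delta>" "\<delta> \<le> d" "\<delta> \<le> s0 / 2" "\<delta> \<le> 1" using d(1) s0 by (auto simp: \<delta>_def)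
  have main: "(1 + norm y) ^ N * cmod (gauss_poly q s x y - gauss_poly q s0 x0 y) \<le> e"
    if dst: "dist (s, x) (s0, x0) < \<delta>" for s x y
  proof -
    have "dist s s0 < \<delta>" "dist x x0 < \<delta>"
      using dst dist_fst_le[of "(s, x)" "(s0, x0)"] dist_snd_le[of "(s, x)" "(s0, x0)"] by auto
    then have s: "s0 / 2 \<le> s" "s \<le> 2 * s0" and x: "norm x \<le> R"
      using \<delta> norm_triangle_ineq2[of x x0] by (auto simp: dist_real_def R_def dist_norm)
    have x0: "norm x0 \<le> R" by (simp add: R_def)
    show ?thesis
    proof (cases "norm y \<le> \<rho>")
      case True
      then have "((s, x), y) \<in> D" "((s0, x0), y) \<in> D" using s x x0 s0 by (auto simp: D_def)
      moreover have "dist ((s, x), y) ((s0, x0), y) < d"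
        using dst \<delta> by (simp add: dist_Pair_Pair[of "(s, x)" y])
      ultimately have "dist (H ((s, x), y)) (H ((s0, x0), y)) < e" by (intro d(2))
      moreover have "dist (H ((s, x), y)) (H ((s0, x0), y)) =
          (1 + norm y) ^ N * cmod (gauss_poly q s x y - gauss_poly q s0 x0 y)"
        by (simp add: H_def dist_norm right_diff_distrib[symmetric] norm_mult norm_power
            del: of_real_power)
      ultimately show ?thesis by simp
    next
      case False
      have y: "0 < 1 + norm y" by (smt (verit) norm_ge_zero)
      have "(1 + norm y) * ((1 + norm y) ^ N * cmod (gauss_poly q s x y - gauss_poly q s0 x0 y))
         \<le> (1 + norm y) * ((1 + norm y) ^ N * (cmod (gauss_poly q s x y) + cmod (gauss_poly q s0 x0 y)))"
        by (intro mult_left_mono norm_triangle_ineq4) auto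
      also have "\<dots> = (1 + norm y) ^ Suc N * cmod (gauss_poly q s x y) + (1 + norm y) ^ Suc N * cmod (gauss_poly q s0 x0 y)"
        by (simp add: algebra_simps)
      also have "\<dots> \<le> B + B" using s0 by (intro add_mono B(2) s x x0) auto
      also have "\<dots> = \<rho> * e" using e by (simp add: \<rho>_def)
      also have "\<dots> \<le> (1 + norm y) * e" using False e by (intro mult_right_mono) auto
      finally show ?thesis using y by simp
    qed
  qed
  show ?thesis
    unfolding eventually_nhds_metric using \<delta>(1) main by (intro exI[of _ \<delta>]) auto
qed

text \<open>\<open>u\<close> is bounded by a seminorm with finitely many terms, and in each of them
  the Gaussians vary continuously with \<open>(s, x)\<close>. The purpose is joint measurability of
  the integrand of \<open>frac_ext\<close>.\<close>

lemma tempered_gauss_continuous: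
  fixes u :: "'n::{finite,linorder} distribution"
  assumes u: "u \<in> tempered"
  shows "continuous_on ({0<..} \<times> UNIV) (\<lambda>z. u (gauss (fst z) (snd z)))"
proof -
  obtain C N where CN: "\<And>\<phi>. \<phi> \<in> schwartz \<Longrightarrow> cmod (u \<phi>) \<le> C * schwartz_norm N \<phi>"
    using u unfolding tempered_def by blast
  define c where "c = \<bar>C\<bar> * real (num_multiindices TYPE('n) N) + 1"
  have c: "0 < c" unfolding c_def by (smt (verit) abs_ge_zero mult_nonneg_nonneg of_nat_0_le_iff)
  have "isCont (\<lambda>z. u (gauss (fst z) (snd z))) (s0, x0)" if s0: "0 < s0" for s0 x0
    unfolding isCont_def
  proof (rule tendstoI)
    fix e :: real assume e: "0 < e"
    define e' where "e' = e / (2 * c)"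
    have e': "0 < e'" using e c by (simp add: e'_def)
    have ev: "\<forall>\<^sub>F z in nhds (s0, x0). \<forall>y.
        (1 + norm y) ^ N * cmod (multi_partial \<beta> (gauss (fst z) (snd z)) y - multi_partial \<beta> (gauss s0 x0) y) \<le> e'" for \<beta>
    proof -
      obtain q' where q': "real_polynomial_function q'"
        "\<And>s x :: 'n rvec. multi_partial \<beta> (gauss s x) = gauss_poly q' s x"
      using multi_partial_gauss[of \<beta>] by blast
      show ?thesis unfolding q'(2) by (rule gauss_poly_locally_uniform[OF q'(1) s0 e'])
    qed
    have ev2: "\<forall>\<^sub>F z in nhds (s0, x0). \<forall>\<beta>\<in>{\<beta>. (\<Sum>i\<in>UNIV. \<beta> i) \<le> N}. \<forall>y.
        (1 + norm y) ^ N * cmod (multi_partial \<beta> (gauss (fst z) (snd z)) y - multi_partial \<beta> (gauss s0 x0) y) \<le> e'"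
      by (intro eventually_ball_finite ballI ev finite_multiindices)
    have ev3: "\<forall>\<^sub>F z in nhds (s0, x0). 0 < fst z"
    proof -
      have "open ({0::real<..} \<times> (UNIV :: 'n rvec set))" by (intro open_Times) auto
      then have "\<forall>\<^sub>F z in nhds (s0, x0). z \<in> {0::real<..} \<times> (UNIV :: 'n rvec set)"
        using s0 by (intro eventually_nhds_in_open) auto
      then show ?thesis by eventually_elim auto
    qed
    have "\<forall>\<^sub>F z in nhds (s0, x0). dist (u (gauss (fst z) (snd z))) (u (gauss s0 x0)) < e"
      using ev2 ev3
    proof eventually_elim
      case (elim z)
      have g: "gauss (fst z) (snd z) \<in> schwartz" "gauss s0 x0 \<in> schwartz"
        using elim(2) s0 gauss_schwartz by auto
      define \<phi> where "\<phi> = (\<lambda>y. 1 * gauss (fst z) (snd z) y + (- 1) * gauss s0 x0 y)"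
      have \<phi>: "\<phi> \<in> schwartz" unfolding \<phi>_def by (rule schwartz_lincomb[OF g])
      have "u \<phi> = u (gauss (fst z) (snd z)) - u (gauss s0 x0)"
        unfolding \<phi>_def by (subst tempered_lincomb[OF u g]) simp
      then have "dist (u (gauss (fst z) (snd z))) (u (gauss s0 x0)) = cmod (u \<phi>)" by (simp add: dist_norm)
      also have "\<dots> \<le> C * schwartz_norm N \<phi>" by (rule CN[OF \<phi>])
      also have "\<dots> \<le> \<bar>C\<bar> * schwartz_norm N \<phi>" by (intro mult_right_mono schwartz_norm_nonneg \<phi>) auto
      also have "\<dots> \<le> \<bar>C\<bar> * (real (num_multiindices TYPE('n) N) * e')"
      proof (intro mult_left_mono schwartz_norm_le)
        fix \<beta> :: "'n \<Rightarrow> nat" and x :: "'n rvec" assume "(\<Sum>i\<in>UNIV. \<beta> i) \<le> N"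
        moreover have "multi_partial \<beta> \<phi> x = multi_partial \<beta> (gauss (fst z) (snd z)) x - multi_partial \<beta> (gauss s0 x0) x"
          unfolding \<phi>_def by (subst multi_partial_lincomb) (use g schwartz_smooth in auto)
        ultimately show "(1 + norm x) ^ N * cmod (multi_partial \<beta> \<phi> x) \<le> e'" using elim(1) by auto
      qed simp
      also have "\<dots> \<le> c * e'" using e' by (simp add: c_def distrib_right mult.assoc)
      also have "\<dots> < e" using c e by (simp add: e'_def)
      finally show ?case .
    qed
    then show "\<forall>\<^sub>F z in at (s0, x0). dist (u (gauss (fst z) (snd z))) (u (gauss (fst (s0, x0)) (snd (s0, x0)))) < e"
      by (simp add: eventually_nhds_conv_at)
  qed
  then show ?thesis by (intro continuous_at_imp_continuous_on) auto
qed

lemma tempered_gauss_measurable: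
  fixes u :: "'n::{finite,linorder} distribution"
  assumes u: "u \<in> tempered"
  shows "(\<lambda>(s, x). indicator {0<..} s * u (gauss s x)) \<in> borel_measurable (borel \<Otimes>\<^sub>M borel)"
proof -
  have "open ({0::real<..} \<times> (UNIV :: 'n rvec set))" by (intro open_Times) auto
  then have "(\<lambda>z. indicator ({0<..} \<times> UNIV) z *\<^sub>R u (gauss (fst z) (snd z))) \<in> borel_measurable borel"
    by (intro borel_measurable_continuous_on_indicator tempered_gauss_continuous u) auto
  also have "(\<lambda>z. indicator ({0<..} \<times> UNIV) z *\<^sub>R u (gauss (fst z) (snd z)))
     = (\<lambda>(s, x). indicator {0<..} s * u (gauss s x))"
    by (auto simp: fun_eq_iff indicator_def)
  finally show ?thesis by (simp add: borel_prod)
qed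

lemma dilate_reflected_schwartz:
  assumes \<psi>: "\<psi> \<in> schwartz" and t: "0 < t"
  shows "(\<lambda>y. dilate t \<psi> (x - y)) \<in> schwartz"
proof -
  have eq: "dilate t \<psi> (x - y) = complex_of_real (1 / t ^ CARD('a)) * \<psi> ((- inverse t) *\<^sub>R y + x /\<^sub>R t)" for y
    by (simp add: dilate_def scaleR_diff_right)
  show ?thesis unfolding eq using t by (intro schwartz_affine \<psi>) simp
qed

text \<open>With \<open>t = 1 / sqrt s\<close>, the Gaussian centred at \<open>x\<close> is, up to
  the factor \<open>C * t ^ n\<close>, the kernel of the convolution at \<open>x'\<close> with the
  dilate of a normalised unit Gaussian centred at \<open>h = (x' - x) / t\<close>. The hypothesis
  says \<open>norm h \<le> R\<close>, so \<open>gauss_translates_bounded\<close> makes this kernel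
  admissible.\<close>

lemma tempered_gauss_le_maximal:
  "\<exists>C>0. \<forall>(u :: 'n::{finite,linorder} distribution) s x x'. u \<in> tempered \<longrightarrow> 0 < s \<longrightarrow> sqrt s * norm (x - x') \<le> R \<longrightarrow>
     ennreal (cmod (u (gauss s x))) \<le> ennreal (C * s powr (- real CARD('n) / 2)) * grand_maximal N u x'"
proof -
  obtain C where C: "0 < C"
    "\<And>h :: 'n rvec. norm h \<le> R \<Longrightarrow> schwartz_norm N (\<lambda>y. complex_of_real (1 / C) * gauss 1 h y) \<le> 1"
    using gauss_translates_bounded by blast
  have "ennreal (cmod (u (gauss s x))) \<le> ennreal (C * s powr (- real CARD('n) / 2)) * grand_maximal N u x'"
    if u: "u \<in> tempered" and s: "0 < s" and R: "sqrt s * norm (x - x') \<le> R"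
    for u :: "'n distribution" and s x x'
  proof -
    define t where "t = 1 / sqrt s"
    have t: "0 < t" and st: "s = 1 / t\<^sup>2" using s by (auto simp: t_def power_divide)
    define h where "h = (x' - x) /\<^sub>R t"
    have h: "norm h \<le> R" using R s by (simp add: h_def t_def norm_minus_commute mult.commute)
    define \<psi> where "\<psi> = (\<lambda>y. complex_of_real (1 / C) * gauss 1 h y)"
    have \<psi>: "\<psi> \<in> schwartz"
      using schwartz_affine[OF gauss_schwartz[of 1 h], of 1 "complex_of_real (1 / C)" 0] by (simp add: \<psi>_def)
    define \<phi> where "\<phi> = (\<lambda>y. dilate t \<psi> (x' - y))"
    have \<phi>: "\<phi> \<in> schwartz" unfolding \<phi>_def by (rule dilate_reflected_schwartz[OF \<psi> t])
    have "gauss s x y = complex_of_real (C * t ^ CARD('n)) * \<phi> y" for y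
    proof -
      have "h - (x' - y) /\<^sub>R t = - ((x - y) /\<^sub>R t)"
        by (simp add: h_def scaleR_diff_right)
      then have "norm (h - (x' - y) /\<^sub>R t) = norm (x - y) / t"
        using t by (simp only: norm_minus_cancel norm_scaleR) (simp add: divide_inverse)
      then have "(norm (h - (x' - y) /\<^sub>R t))\<^sup>2 = (norm (x - y))\<^sup>2 / t\<^sup>2"
        by (simp add: power_divide)
      then have "gauss 1 h ((x' - y) /\<^sub>R t) = gauss s x y" by (simp add: gauss_eq st)
      then show ?thesis using C(1) t by (simp add: \<phi>_def dilate_def \<psi>_def)
    qed
    then have "gauss s x = (\<lambda>y. complex_of_real (C * t ^ CARD('n)) * \<phi> y)" by blast
    then have "u (gauss s x) = complex_of_real (C * t ^ CARD('n)) * convolve (dilate t \<psi>) u x'"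
      using tempered_scale[OF u \<phi>] by (simp add: convolve_def \<phi>_def)
    then have "cmod (u (gauss s x)) = (C * t ^ CARD('n)) * cmod (convolve (dilate t \<psi>) u x')"
      using C(1) t by (simp add: norm_mult norm_power)
    then have "ennreal (cmod (u (gauss s x))) = ennreal (C * t ^ CARD('n)) * ennreal (cmod (convolve (dilate t \<psi>) u x'))"
      using C(1) t by (simp add: ennreal_mult)
    also have "\<dots> \<le> ennreal (C * t ^ CARD('n)) * grand_maximal N u x'"
    proof (rule mult_left_mono)
      have "(t, \<psi>) \<in> {0<..} \<times> {\<psi> \<in> schwartz. schwartz_norm N \<psi> \<le> 1}"
        using t \<psi> C(2)[OF h] by (simp add: \<psi>_def)
      then show "ennreal (cmod (convolve (dilate t \<psi>) u x')) \<le> grand_maximal N u x'"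
        unfolding grand_maximal_def by (rule SUP_upper2) simp
    qed simp
    also have "t ^ CARD('n) = s powr (- real CARD('n) / 2)"
    proof -
      have "t = s powr (- 1 / 2)" using s by (simp add: t_def powr_minus_divide powr_half_sqrt)
      then show ?thesis using s by (simp add: powr_realpow[symmetric] powr_powr)
    qed
    finally show ?thesis .
  qed
  then show ?thesis using C(1) by blast
qed

section \<open>Integrals of Gaussians and decaying functions\<close>

lemma nn_integral_lborel_affine:
  fixes f :: "'a::euclidean_space \<Rightarrow> ennreal"
  assumes [measurable]: "f \<in> borel_measurable borel" and c: "c \<noteq> 0"
  shows "(\<integral>\<^sup>+x. f x \<partial>lborel) = ennreal (\<bar>c\<bar> ^ DIM('a)) * (\<integral>\<^sup>+x. f (t + c *\<^sub>R x) \<partial>lborel)"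
  by (subst lborel_affine[OF c, of t])
     (simp add: nn_integral_density nn_integral_distr nn_integral_cmult)

lemma integral_lborel_reflect:
  fixes f :: "'a::euclidean_space \<Rightarrow> 'b::{banach,second_countable_topology}"
  assumes [measurable]: "f \<in> borel_measurable borel"
  shows "(LINT x|lborel. f (t - x)) = (LINT x|lborel. f x)"
  by (subst (2) lborel_affine[of "-1" t])
     (simp_all add: density_1 integral_distr)

lemma nn_integral_lborel_reflect:
  fixes f :: "'a::euclidean_space \<Rightarrow> ennreal"
  assumes "f \<in> borel_measurable borel"
  shows "(\<integral>\<^sup>+x. f (t - x) \<partial>lborel) = (\<integral>\<^sup>+x. f x \<partial>lborel)"
  using nn_integral_lborel_affine[OF assms, of "-1" t] by simp

lemma nn_integral_decay_line:
  assumes k: "1 < k"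
  shows "(\<integral>\<^sup>+t. ennreal ((1 + \<bar>t\<bar>) powr (- k)) \<partial>lborel) < \<infinity>"
proof -
  define F where "F = (\<lambda>t::real. - ((1 + t) powr (1 - k)) / (k - 1))"
  have "(F \<longlongrightarrow> - 0 / (k - 1)) at_top"
    unfolding F_def
  proof (intro tendsto_intros)
    have "filterlim (\<lambda>t::real. 1 + t) at_top at_top"
      by (rule filterlim_tendsto_add_at_top[OF tendsto_const filterlim_ident])
    then show "((\<lambda>t. (1 + t) powr (1 - k)) \<longlongrightarrow> 0) at_top"
      using k by (intro tendsto_neg_powr) auto
  qed (use k in auto)
  moreover have "(F has_real_derivative (1 + t) powr (- k)) (at t)" if "0 \<le> t" for t
  proof -
    have "((\<lambda>t. (1 + t) powr (1 - k)) has_real_derivative (1 - k) * (1 + t) powr (- k)) (at t)"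
      using that by (auto intro!: derivative_eq_intros)
    then have "(F has_real_derivative - ((1 - k) * (1 + t) powr (- k)) / (k - 1)) (at t)"
      unfolding F_def by (intro DERIV_cdivide DERIV_minus)
    also have "- ((1 - k) * (1 + t) powr (- k)) / (k - 1) = (1 + t) powr (- k)"
      using k by (simp add: minus_mult_left)
    finally show ?thesis .
  qed
  ultimately have "(\<integral>\<^sup>+t\<in>{0..}. ennreal ((1 + t) powr (- k)) \<partial>lborel) = ennreal (- 0 / (k - 1) - F 0)"
    by (intro nn_integral_FTC_atLeast) auto
  then have half: "(\<integral>\<^sup>+t\<in>{0..}. ennreal ((1 + t) powr (- k)) \<partial>lborel) < \<infinity>" by simp
  let ?g = "\<lambda>t::real. ennreal ((1 + t) powr (- k)) * indicator {0..} t"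
  have "(\<integral>\<^sup>+t. ennreal ((1 + \<bar>t\<bar>) powr (- k)) \<partial>lborel) \<le> (\<integral>\<^sup>+t. ?g t + ?g (- t) \<partial>lborel)"
    by (intro nn_integral_mono) (auto simp: indicator_def)
  also have "\<dots> = (\<integral>\<^sup>+t. ?g t \<partial>lborel) + (\<integral>\<^sup>+t. ?g (- t) \<partial>lborel)"
    by (rule nn_integral_add) auto
  also have "(\<integral>\<^sup>+t. ?g (- t) \<partial>lborel) = (\<integral>\<^sup>+t. ?g t \<partial>lborel)"
    using nn_integral_lborel_reflect[of ?g 0] by simp
  finally show ?thesis using half by (auto intro: order.strict_trans1)
qed

text \<open>The power is shared equally among the coordinates, each of which satisfies
  \<open>\<bar>x $ i\<bar> \<le> norm x\<close>. The outcome is a product, whose mixed norms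
  factorise.\<close>

lemma decay_le_prod:
  fixes x :: "'n::finite rvec"
  assumes "0 \<le> K"
  shows "(1 + norm x) powr (- K) \<le> (\<Prod>i\<in>UNIV. (1 + \<bar>x $ i\<bar>) powr (- (K / real CARD('n))))"
proof -
  have "(1 + norm x) powr (- K) = (\<Prod>i\<in>(UNIV::'n set). (1 + norm x) powr (- (K / real CARD('n))))"
    by (simp add: powr_realpow[symmetric] powr_powr add_nonneg_eq_0_iff powr_power)
  also have "\<dots> \<le> (\<Prod>i\<in>UNIV. (1 + \<bar>x $ i\<bar>) powr (- (K / real CARD('n))))"
    using assms component_le_norm_cart[of x]
    by (intro prod_mono conjI powr_mono2') auto
  finally show ?thesis .
qed

lemma mixed_norm_decay_finite:
  fixes p :: "'n::{finite,linorder} \<Rightarrow> real"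
  assumes p: "\<And>i. 0 < p i" and K: "\<And>i. real CARD('n) / p i < K"
  shows "mixed_norm p (\<lambda>x. ennreal ((1 + norm x) powr (- K))) < \<infinity>"
proof -
  define k where "k = K / real CARD('n)"
  have kp: "1 < k * p i" for i using p[of i] K[of i] by (simp add: k_def field_simps)
  \<comment> \<open>Any index will do for the sign of \<open>K\<close>.\<close>
  have "0 \<le> K" using K[of undefined] p[of undefined] by (smt (verit) divide_nonneg_nonneg of_nat_0_le_iff)
  then have "mixed_norm p (\<lambda>x. ennreal ((1 + norm x) powr (- K)))
      \<le> mixed_norm p (\<lambda>x. \<Prod>i\<in>UNIV. ennreal ((1 + \<bar>x $ i\<bar>) powr (- k)))"
    using decay_le_prod by (intro mixed_norm_mono p) (auto simp: prod_ennreal k_def intro!: ennreal_leI)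
  also have "\<dots> = (\<Prod>i\<in>UNIV. (\<integral>\<^sup>+t. ennreal ((1 + \<bar>t\<bar>) powr (- k)) powe p i \<partial>lborel) powe (1 / p i))"
    by (rule mixed_norm_prod) (auto simp: p)
  also have "\<dots> < \<infinity>"
  proof -
    have "(\<integral>\<^sup>+t. ennreal ((1 + \<bar>t\<bar>) powr (- k)) powe p i \<partial>lborel) < \<infinity>" for i
      using nn_integral_decay_line[OF kp[of i]] by (simp add: powe_ennreal powr_powr)
    then show ?thesis by (simp add: ennreal_prod_eq_top less_top[symmetric])
  qed
  finally show ?thesis .
qed

lemma nn_integral_decay_finite:
  assumes K: "real CARD('n) < K"
  shows "(\<integral>\<^sup>+x. ennreal ((1 + norm (x :: 'n::finite rvec)) powr (- K)) \<partial>lborel) < \<infinity>"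
proof -
  interpret product_sigma_finite "\<lambda>_::'n. lborel :: real measure" ..
  define k where "k = K / real CARD('n)"
  have k: "1 < k" using K by (simp add: k_def field_simps)
  have "(\<integral>\<^sup>+x. ennreal ((1 + norm (x :: 'n rvec)) powr (- K)) \<partial>lborel)
      \<le> (\<integral>\<^sup>+x. (\<Prod>i\<in>UNIV. ennreal ((1 + \<bar>x $ i\<bar>) powr (- k))) \<partial>(lborel :: 'n rvec measure))"
    using K by (intro nn_integral_mono) (auto simp: prod_ennreal k_def intro!: ennreal_leI decay_le_prod)
  also have "\<dots> = (\<integral>\<^sup>+w. (\<Prod>i\<in>UNIV. ennreal ((1 + \<bar>w i\<bar>) powr (- k))) \<partial>(\<Pi>\<^sub>M i\<in>(UNIV::'n set). lborel))"
    by (subst nn_integral_lborel_vec) auto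
  also have "\<dots> = (\<Prod>i\<in>(UNIV::'n set). \<integral>\<^sup>+t. ennreal ((1 + \<bar>t\<bar>) powr (- k)) \<partial>lborel)"
    by (rule product_nn_integral_prod) auto
  also have "\<dots> < \<infinity>"
    using nn_integral_decay_line[OF k] by (simp add: power_less_top_ennreal)
  finally show ?thesis .
qed

lemma nn_integral_gaussian_finite:
  "(\<integral>\<^sup>+x. ennreal (exp (- (norm (x :: 'n::finite rvec))\<^sup>2)) \<partial>lborel) < \<infinity>"
proof -
  define L where "L = Suc (CARD('n))"
  define C where "C = exp 1 * (2 * real (Suc L) / 1) ^ Suc L"
  have "exp (- (norm x)\<^sup>2) \<le> C * (1 + norm x) powr (- real L)" for x :: "'n rvec"
  proof -
    have "(1 + norm x) ^ L * exp (- (norm x)\<^sup>2) \<le> C"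
      using power_times_gaussian_le[of 1 "norm x" "Suc L" L] by (simp add: C_def)
    moreover have "0 < 1 + norm x" by (smt (verit) norm_ge_zero)
    ultimately show ?thesis by (simp add: powr_minus powr_realpow field_simps)
  qed
  then have "(\<integral>\<^sup>+x. ennreal (exp (- (norm (x :: 'n rvec))\<^sup>2)) \<partial>lborel)
    \<le> (\<integral>\<^sup>+x. ennreal C * ennreal ((1 + norm (x :: 'n rvec)) powr (- real L)) \<partial>lborel)"
    by (intro nn_integral_mono) (auto simp: ennreal_mult[symmetric] C_def intro!: ennreal_leI)
  also have "\<dots> = ennreal C * (\<integral>\<^sup>+x. ennreal ((1 + norm (x :: 'n rvec)) powr (- real L)) \<partial>lborel)"
    by (rule nn_integral_cmult) simp
  also have "\<dots> < \<infinity>"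
    using nn_integral_decay_finite[of "real L", where 'n = 'n] by (simp add: ennreal_mult_less_top L_def)
  finally show ?thesis .
qed

lemma nn_integral_gaussian_scaled:
  fixes x :: "'n::finite rvec"
  assumes s: "0 < s"
  shows "(\<integral>\<^sup>+y. ennreal (exp (- s * (norm (x - y))\<^sup>2)) \<partial>lborel) =
    ennreal (s powr (- real CARD('n) / 2)) * (\<integral>\<^sup>+y. ennreal (exp (- (norm (y :: 'n rvec))\<^sup>2)) \<partial>lborel)"
proof -
  define c where "c = 1 / sqrt s"
  have c: "0 < c" "s * c\<^sup>2 = 1" using s by (simp_all add: c_def power_divide)
  have "s * (norm (x - (x + c *\<^sub>R y)))\<^sup>2 = (norm y)\<^sup>2" for y :: "'n rvec"
    using c by (simp add: power_mult_distrib mult.assoc[symmetric])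
  then have "(\<integral>\<^sup>+y. ennreal (exp (- s * (norm (x - y))\<^sup>2)) \<partial>lborel) =
     ennreal (\<bar>c\<bar> ^ CARD('n)) * (\<integral>\<^sup>+y. ennreal (exp (- (norm (y :: 'n rvec))\<^sup>2)) \<partial>lborel)"
    using c by (subst nn_integral_lborel_affine[of _ c x]) simp_all
  also have "\<bar>c\<bar> ^ CARD('n) = s powr (- real CARD('n) / 2)"
  proof -
    have "\<bar>c\<bar> = s powr (- 1 / 2)" using s by (simp add: c_def powr_minus_divide powr_half_sqrt)
    then show ?thesis using s by (simp add: powr_realpow[symmetric] powr_powr)
  qed
  finally show ?thesis .
qed

section \<open>The Gamma integral and convergence in the parameter \<open>s\<close>\<close>

lemma Gamma_kernel_nn:
  fixes a r :: real
  assumes a: "0 < a" and r: "0 < r"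
  shows "(\<integral>\<^sup>+s. ennreal (indicator {0<..} s * (s powr (a - 1) * exp (- s * r))) \<partial>lborel) = ennreal (Gamma a * r powr (- a))"
proof -
  have "(\<integral>\<^sup>+s. ennreal (indicat_real {0..} s * (s powr (a - 1) / exp s)) \<partial>lborel) = ennreal (Gamma a)"
    by (rule nn_integral_has_integral_lebesgue[OF _ Gamma_integral_real[OF a]]) simp
  \<comment> \<open>Substitution of \<open>r * s\<close> for \<open>s\<close>.\<close>
  also have "(\<integral>\<^sup>+s. ennreal (indicat_real {0..} s * (s powr (a - 1) / exp s)) \<partial>lborel)
      = ennreal r * (\<integral>\<^sup>+s. ennreal (indicat_real {0..} (r * s) * ((r * s) powr (a - 1) / exp (r * s))) \<partial>lborel)"
    using r by (subst nn_integral_real_affine[of _ r 0]) auto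
  also have "(\<integral>\<^sup>+s. ennreal (indicat_real {0..} (r * s) * ((r * s) powr (a - 1) / exp (r * s))) \<partial>lborel)
      = (\<integral>\<^sup>+s. ennreal (r powr (a - 1)) * ennreal (indicator {0<..} s * (s powr (a - 1) * exp (- s * r))) \<partial>lborel)"
  proof (rule nn_integral_cong)
    fix s :: real
    show "ennreal (indicat_real {0..} (r * s) * ((r * s) powr (a - 1) / exp (r * s)))
      = ennreal (r powr (a - 1)) * ennreal (indicator {0<..} s * (s powr (a - 1) * exp (- s * r)))"
    proof (cases "s > 0")
      case True
      then show ?thesis using r
        by (subst ennreal_mult[symmetric]) (auto simp: powr_mult exp_minus divide_inverse mult_ac)
    next
      case False
      then show ?thesis using r by (cases "s = 0") (auto simp: zero_le_mult_iff)
    qed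
  qed
  also have "\<dots> = ennreal (r powr (a - 1)) * (\<integral>\<^sup>+s. ennreal (indicator {0<..} s * (s powr (a - 1) * exp (- s * r))) \<partial>lborel)"
    by (rule nn_integral_cmult) auto
  finally have eq: "ennreal r * (ennreal (r powr (a - 1)) * (\<integral>\<^sup>+s. ennreal (indicator {0<..} s * (s powr (a - 1) * exp (- s * r))) \<partial>lborel)) = ennreal (Gamma a)"
    by simp
  define X where "X = (\<integral>\<^sup>+s. ennreal (indicator {0<..} s * (s powr (a - 1) * exp (- s * r))) \<partial>lborel)"
  have "ennreal r * ennreal (r powr (a - 1)) = ennreal (r powr a)"
    using r by (simp add: ennreal_mult[symmetric] powr_mult_base)
  then have *: "ennreal (r powr a) * X = ennreal (Gamma a)"
    using eq by (simp add: X_def mult.assoc[symmetric])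
  \<comment> \<open>Cancellation by a finite positive factor, valid before \<open>X\<close> is known
    to be finite.\<close>
  have "X = (ennreal (r powr (- a)) * ennreal (r powr a)) * X"
    using r by (simp add: ennreal_mult[symmetric] powr_add[symmetric])
  also have "\<dots> = ennreal (r powr (- a)) * ennreal (Gamma a)" by (simp only: mult.assoc *)
  also have "\<dots> = ennreal (Gamma a * r powr (- a))"
    using Gamma_real_pos[OF a] by (simp add: ennreal_mult[symmetric] mult.commute)
  finally show ?thesis by (simp only: X_def)
qed

lemma Gamma_kernel_integral:
  fixes a r :: real
  assumes a: "0 < a" and r: "0 < r"
  shows "has_bochner_integral lborel (\<lambda>s. indicator {0<..} s * (s powr (a - 1) * exp (- s * r))) (Gamma a * r powr (- a))"
  using Gamma_kernel_nn[OF assms] Gamma_real_pos[OF a]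
  by (intro has_bochner_integral_nn_integral) auto

text \<open>Near 0 the constant \<open>A\<close> and \<open>0 < b\<close> give convergence, near
  infinity \<open>B * s powr (- c)\<close> and \<open>b < c\<close> do. The comparison functions are
  the Gamma integrand for \<open>s \<le> 1\<close> and a power of \<open>1 + s\<close>
  beyond.\<close>

lemma nn_integral_powr_cases_finite:
  assumes b: "0 < b" and c: "b < c" and A: "A < \<infinity>" "B < \<infinity>"
  shows "(\<integral>\<^sup>+s. ennreal (indicator {0<..} s * s powr (b - 1)) * min A (B * ennreal (s powr (- c))) \<partial>lborel) < \<infinity>"
proof -
  define d where "d = 1 + (c - b)"
  let ?g = "\<lambda>s::real. indicator {0<..} s * (s powr (b - 1) * exp (- s * 1))"
  let ?h = "\<lambda>s::real. (1 + \<bar>s\<bar>) powr (- d)"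
  have cb: "1 < d" using c by (simp add: d_def)
  have "ennreal (indicator {0<..} s * s powr (b - 1)) * min A (B * ennreal (s powr (- c)))
      \<le> A * ennreal (exp 1) * ennreal (?g s) + B * ennreal (2 powr d) * ennreal (?h s)" for s
  proof -
    consider "s \<le> 0" | "0 < s" "s \<le> 1" | "1 < s" by linarith
    then show ?thesis
    proof cases
      case 2
      have "s powr (b - 1) \<le> exp 1 * (s powr (b - 1) * exp (- s))"
      proof -
        have "1 \<le> exp 1 * exp (- s)" using 2 by (simp add: exp_add[symmetric])
        then have "s powr (b - 1) * 1 \<le> s powr (b - 1) * (exp 1 * exp (- s))" by (intro mult_left_mono) auto
        then show ?thesis by (simp add: mult_ac)
      qed
      then have "ennreal (s powr (b - 1)) \<le> ennreal (exp 1) * ennreal (s powr (b - 1) * exp (- s))"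
        by (simp add: ennreal_mult[symmetric] ennreal_leI)
      then have "ennreal (s powr (b - 1)) * min A (B * ennreal (s powr (- c))) \<le>
          ennreal (exp 1) * ennreal (s powr (b - 1) * exp (- s)) * A" by (intro mult_mono) auto
      then show ?thesis using 2 by (simp add: mult_ac add_increasing2)
    next
      case 3
      have "s powr (b - 1) * s powr (- c) \<le> 2 powr d * ?h s"
      proof -
        have "s powr (b - 1) * s powr (- c) = s powr (- d)"
          by (simp add: powr_add[symmetric] d_def algebra_simps)
        also have "\<dots> \<le> ((1 + s) / 2) powr (- d)"
          using 3 cb by (intro powr_mono2') auto
        also have "\<dots> = 2 powr d * ?h s"
          using 3 by (simp add: powr_divide powr_minus_divide)
        finally show ?thesis .
      qed
      then have "ennreal (s powr (b - 1)) * ennreal (s powr (- c)) \<le> ennreal (2 powr d) * ennreal (?h s)"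
        by (simp add: ennreal_mult[symmetric] ennreal_leI)
      then have "ennreal (s powr (b - 1)) * ennreal (s powr (- c)) * B \<le> ennreal (2 powr d) * ennreal (?h s) * B"
        by (rule mult_right_mono) simp
      moreover have "ennreal (s powr (b - 1)) * min A (B * ennreal (s powr (- c))) \<le> ennreal (s powr (b - 1)) * (B * ennreal (s powr (- c)))"
        by (intro mult_left_mono) auto
      ultimately have "ennreal (s powr (b - 1)) * min A (B * ennreal (s powr (- c))) \<le> B * ennreal (2 powr d) * ennreal (?h s)"
        by (simp add: mult_ac)
      then show ?thesis using 3 by (simp add: add_increasing)
    qed simp
  qed
  then have "(\<integral>\<^sup>+s. ennreal (indicator {0<..} s * s powr (b - 1)) * min A (B * ennreal (s powr (- c))) \<partial>lborel)
     \<le> (\<integral>\<^sup>+s. A * ennreal (exp 1) * ennreal (?g s) + B * ennreal (2 powr d) * ennreal (?h s) \<partial>lborel)"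
    by (rule nn_integral_mono)
  also have "\<dots> = A * ennreal (exp 1) * (\<integral>\<^sup>+s. ennreal (?g s) \<partial>lborel)
      + B * ennreal (2 powr d) * (\<integral>\<^sup>+s. ennreal (?h s) \<partial>lborel)"
    by (simp add: nn_integral_add nn_integral_cmult)
  also have "\<dots> < \<infinity>"
    using A Gamma_kernel_nn[OF b zero_less_one] nn_integral_decay_line[OF cb]
    by (simp add: ennreal_mult_less_top)
  finally show ?thesis .
qed

section \<open>Agreement with the fractional integral\<close>

lemma prod_mono_ennreal:
  fixes f g :: "'i \<Rightarrow> ennreal"
  assumes "\<And>i. i \<in> A \<Longrightarrow> f i \<le> g i"
  shows "prod f A \<le> prod g A"
  using assms by (induction A rule: infinite_finite_induct) (auto intro: mult_mono)

lemma vec_nth_measurable [measurable]: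
  "(\<lambda>y :: 'a::euclidean_space ^ 'm::finite. y $ k) \<in> borel_measurable borel"
  by (intro borel_measurable_continuous_onI continuous_intros)

lemma nn_integral_lborel_vec_prod:
  fixes f :: "'m::finite \<Rightarrow> 'a::euclidean_space \<Rightarrow> ennreal"
  assumes [measurable]: "\<And>k. f k \<in> borel_measurable borel"
  shows "(\<integral>\<^sup>+y. (\<Prod>k\<in>UNIV. f k (y $ k)) \<partial>(lborel :: ('a ^ 'm) measure)) = (\<Prod>k\<in>UNIV. \<integral>\<^sup>+z. f k z \<partial>lborel)"
proof -
  interpret product_sigma_finite "\<lambda>_::'m. lborel :: 'a measure" ..
  have "(\<integral>\<^sup>+y. (\<Prod>k\<in>UNIV. f k (y $ k)) \<partial>(lborel :: ('a ^ 'm) measure))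
     = (\<integral>\<^sup>+w. (\<Prod>k\<in>UNIV. f k (w k)) \<partial>(\<Pi>\<^sub>M i\<in>UNIV. lborel))"
    by (subst nn_integral_lborel_vec) simp_all
  then show ?thesis by (simp add: product_nn_integral_prod)
qed

lemma integral_lborel_vec_prod:
  fixes f :: "'m::finite \<Rightarrow> 'a::euclidean_space \<Rightarrow> complex"
  assumes f: "\<And>k. integrable lborel (f k)"
  shows "(LINT y|(lborel :: ('a ^ 'm) measure). (\<Prod>k\<in>UNIV. f k (y $ k))) = (\<Prod>k\<in>UNIV. LINT z|lborel. f k z)"
proof -
  interpret product_sigma_finite "\<lambda>_::'m. lborel :: 'a measure" ..
  have [measurable]: "f k \<in> borel_measurable borel" for k
    using borel_measurable_integrable[OF f] by simp
  have "(LINT y|(lborel :: ('a ^ 'm) measure). (\<Prod>k\<in>UNIV. f k (y $ k)))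
     = (LINT w|(\<Pi>\<^sub>M i\<in>UNIV. lborel). (\<Prod>k\<in>UNIV. f k (w k)))"
    by (subst lborel_vec_eq) (subst integral_distr; simp)
  then show ?thesis using f by (simp add: product_integral_prod)
qed

text \<open>The exceptional set lies in a product set one of whose factors has measure 0;
  \<open>0 * \<infinity> = 0\<close> takes care of the factors of infinite measure.\<close>

lemma AE_lborel_vec_component:
  fixes x :: "'a::euclidean_space"
  assumes "AE z in lborel. P z"
  shows "AE y in (lborel :: ('a ^ 'm::finite) measure). P (x - y $ k)"
proof -
  obtain N where N: "{z. \<not> P z} \<subseteq> N" "emeasure lborel N = 0" and [measurable]: "N \<in> sets borel"
    using AE_E[OF assms] by auto
  have 0: "(\<integral>\<^sup>+z. indicator N (x - z) \<partial>lborel) = 0"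
    using N(2) by (subst nn_integral_lborel_reflect) auto
  have "(\<integral>\<^sup>+y. indicator N (x - y $ k) \<partial>(lborel :: ('a ^ 'm) measure))
     = (\<integral>\<^sup>+y. (\<Prod>j\<in>UNIV. if j = k then indicator N (x - y $ j) else 1) \<partial>(lborel :: ('a ^ 'm) measure))"
    by (simp add: prod.delta)
  also have "\<dots> = (\<Prod>j\<in>(UNIV::'m set). \<integral>\<^sup>+z. (if j = k then indicator N (x - z) else 1) \<partial>lborel)"
    by (rule nn_integral_lborel_vec_prod) measurable
  also have "\<dots> = 0"
  proof (rule prod_zero)
    show "\<exists>j\<in>(UNIV::'m set). (\<integral>\<^sup>+z. (if j = k then indicator N (x - z) else 1) \<partial>lborel) = 0"
      by (rule bexI[of _ k]) (use 0 in simp_all)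
  qed simp
  finally have "(\<integral>\<^sup>+y. indicator N (x - y $ k) \<partial>(lborel :: ('a ^ 'm) measure)) = 0" .
  then have "AE y in (lborel :: ('a ^ 'm) measure). (indicator N (x - y $ k) :: ennreal) = 0"
    by (subst (asm) nn_integral_0_iff_AE) simp_all
  then show ?thesis by eventually_elim (use N(1) in \<open>auto simp: indicator_def split: if_splits\<close>)
qed

text \<open>What Fubini and the convolution estimates use of a finite sum of atoms. As for atoms,
  the bound holds almost everywhere and the support condition everywhere.\<close>

definition bounded_supported :: "real \<Rightarrow> real \<Rightarrow> ('n::finite rvec \<Rightarrow> complex) \<Rightarrow> bool" where
  "bounded_supported A R f \<longleftrightarrow> f \<in> borel_measurable lebesgue \<and> 0 \<le> A \<and>
     (AE x in lebesgue. cmod (f x) \<le> A) \<and> (\<forall>x. x \<notin> cball 0 R \<longrightarrow> f x = 0)"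

text \<open>Fubini is applied to Borel functions, while atoms are only Lebesgue measurable. The
  representative is cut off so that its bound and its support condition hold at every point.\<close>

lemma borel_representative:
  assumes f: "bounded_supported A R f"
  obtains g where "g \<in> borel_measurable borel" "AE x in lebesgue. f x = g x"
    "\<And>x. cmod (g x) \<le> A * indicator (cball 0 R) x"
proof -
  have m: "f \<in> borel_measurable lebesgue" and A: "0 \<le> A" using f by (auto simp: bounded_supported_def)
  obtain r where r: "r \<in> borel_measurable lborel" "AE x in lborel. Re (f x) = r x"
    using completion_ex_borel_measurable_real[OF borel_measurable_Re[THEN measurable_compose_rev, OF m]]
    by (auto simp: o_def)
  obtain i where i: "i \<in> borel_measurable lborel" "AE x in lborel. Im (f x) = i x"
    using completion_ex_borel_measurable_real[OF borel_measurable_Im[THEN measurable_compose_rev, OF m]]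
    by (auto simp: o_def)
  define g0 where "g0 = (\<lambda>x. Complex (r x) (i x))"
  have g0 [measurable]: "g0 \<in> borel_measurable borel"
    using r(1) i(1) unfolding g0_def Complex_eq by simp
  define g where "g = (\<lambda>x. if x \<in> cball 0 R \<and> cmod (g0 x) \<le> A then g0 x else 0)"
  have [measurable]: "cball (0::'a rvec) R \<in> sets borel" by simp
  have "g \<in> borel_measurable borel" unfolding g_def by measurable
  moreover have "AE x in lebesgue. f x = g x"
  proof -
    have "AE x in lebesgue. Re (f x) = r x" "AE x in lebesgue. Im (f x) = i x"
      using r(2) i(2) by (auto intro: AE_completion)
    moreover have "AE x in lebesgue. cmod (f x) \<le> A" using f by (simp add: bounded_supported_def)
    ultimately show ?thesis
    proof eventually_elim
      case (elim x)
      then have "g0 x = f x" by (simp add: g0_def complex_eq_iff)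
      then show ?case using elim f by (auto simp: g_def bounded_supported_def)
    qed
  qed
  moreover have "cmod (g x) \<le> A * indicator (cball 0 R) x" for x
    using A by (auto simp: g_def)
  ultimately show ?thesis using that by blast
qed

lemma schwartz_borel_measurable: "\<phi> \<in> schwartz \<Longrightarrow> \<phi> \<in> borel_measurable borel"
  by (intro borel_measurable_continuous_onI continuous_at_imp_continuous_on ballI
      differentiable_imp_continuous_within smooth_imp_differentiable schwartz_smooth)

lemma distr_of_borel:
  assumes f: "f \<in> borel_measurable lebesgue" and g: "g \<in> borel_measurable borel"
    and fg: "AE x in lebesgue. f x = g x" and \<phi>: "\<phi> \<in> schwartz"
  shows "distr_of f \<phi> = (LINT x|lborel. g x * \<phi> x)"
proof -
  have [measurable]: "\<phi> \<in> borel_measurable lborel" using schwartz_borel_measurable[OF \<phi>] by simp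
  have [measurable]: "g \<in> borel_measurable lborel" using g by simp
  have "distr_of f \<phi> = (LINT x|lebesgue. f x * \<phi> x)" using \<phi> by (simp add: distr_of_def)
  also have "\<dots> = (LINT x|lebesgue. g x * \<phi> x)"
  proof (rule integral_cong_AE)
    show "(\<lambda>x. f x * \<phi> x) \<in> borel_measurable lebesgue"
      by (rule borel_measurable_times[OF f measurable_completion]) simp
    show "(\<lambda>x. g x * \<phi> x) \<in> borel_measurable lebesgue" by (intro measurable_completion) simp
  qed (use fg in auto)
  also have "\<dots> = (LINT x|lborel. g x * \<phi> x)" by (rule integral_completion) simp
  finally show ?thesis .
qed

definition frac_integrand ::
    "real \<Rightarrow> ('m::finite \<Rightarrow> 'n::{finite,linorder} distribution) \<Rightarrow> 'n rvec \<Rightarrow> real \<Rightarrow> complex" where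
  "frac_integrand \<alpha> u x s =
     complex_of_real (indicator {0<..} s * s powr ((real CARD('m) * real CARD('n) - \<alpha>) / 2 - 1)) *
     (\<Prod>k\<in>UNIV. u k (gauss s x))"

definition frac_ext ::
    "real \<Rightarrow> ('m::finite \<Rightarrow> 'n::{finite,linorder} distribution) \<Rightarrow> 'n rvec \<Rightarrow> complex" where
  "frac_ext \<alpha> u x = complex_of_real (1 / Gamma ((real CARD('m) * real CARD('n) - \<alpha>) / 2)) *
     (LINT s|lborel. frac_integrand \<alpha> u x s)"

text \<open>Fubini for \<open>h s y\<close>. Integration in \<open>s\<close> first gives the kernel
  through the Gamma integral; integration in \<open>y\<close> first factorises and gives the values
  of the distributions. Integrability near \<open>s = 0\<close> comes from the bounded supports,
  near infinity from the mass \<open>s powr (- n / 2)\<close> of each of the \<open>m\<close>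
  Gaussian factors and \<open>b < m * n\<close>.\<close>

theorem frac_ext_distr_of:
  fixes f :: "'m::finite \<Rightarrow> 'n::{finite,linorder} rvec \<Rightarrow> complex"
  assumes \<alpha>: "0 < \<alpha>" "\<alpha> < real CARD('m) * real CARD('n)" and f: "\<And>k. bounded_supported A R (f k)"
  shows "frac_ext \<alpha> (\<lambda>k. distr_of (f k)) x = frac_int \<alpha> f x"
proof -
  define b where "b = real CARD('m) * real CARD('n) - \<alpha>"
  have b: "0 < b / 2" "b / 2 < real CARD('m) * real CARD('n) / 2" using \<alpha> by (auto simp: b_def)
  have A: "0 \<le> A" using f by (auto simp: bounded_supported_def)
  have fm: "f k \<in> borel_measurable lebesgue" for k using f by (auto simp: bounded_supported_def)
  have "\<exists>g. \<forall>k. g k \<in> borel_measurable borel \<and> (AE x in lebesgue. f k x = g k x) \<and>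
      (\<forall>x. cmod (g k x) \<le> A * indicator (cball 0 R) x)"
    by (intro choice allI) (metis borel_representative[OF f])
  then obtain g where g [measurable]: "\<And>k. g k \<in> borel_measurable borel"
    and fg: "\<And>k. AE x in lebesgue. f k x = g k x"
    and gb: "\<And>k x. cmod (g k x) \<le> A * indicator (cball 0 R) x"
    by blast
  define W where "W s = indicator {0<..} s * s powr (b / 2 - 1)" for s :: real
  have W [measurable]: "W \<in> borel_measurable borel" unfolding W_def by measurable
  have W0: "0 \<le> W s" for s by (simp add: W_def)
  define \<Phi> where "\<Phi> y = (\<Prod>k\<in>UNIV. g k (x - y $ k))" for y :: "('n rvec, 'm) vec"
  have \<Phi> [measurable]: "\<Phi> \<in> borel_measurable borel" unfolding \<Phi>_def by measurable
  define h where "h s y = complex_of_real (W s * exp (- s * (norm y)\<^sup>2)) * \<Phi> y" for s y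
  have norm2: "(norm y)\<^sup>2 = (\<Sum>k\<in>UNIV. (norm (y $ k))\<^sup>2)" for y :: "('n rvec, 'm) vec"
    by (simp add: norm_vec_def L2_set_def sum_nonneg)
  define F where "F k s z = complex_of_real (exp (- s * (norm z)\<^sup>2)) * g k (x - z)" for k s and z :: "'n rvec"
  have Fm [measurable]: "F k s \<in> borel_measurable borel" for k s unfolding F_def by measurable
  have hprod: "h s y = complex_of_real (W s) * (\<Prod>k\<in>UNIV. F k s (y $ k))" for s y
    by (simp add: h_def F_def \<Phi>_def norm2 sum_distrib_left exp_sum prod.distrib sum_negf[symmetric])

  define G where "G = (\<integral>\<^sup>+y. ennreal (exp (- (norm (y :: 'n rvec))\<^sup>2)) \<partial>lborel)"
  have G: "G < \<infinity>" unfolding G_def by (rule nn_integral_gaussian_finite)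
  have [measurable]: "cball (0::'n rvec) R \<in> sets borel" by simp
  define V where "V = emeasure lborel (cball (0::'n rvec) R)"
  have V: "V < \<infinity>" unfolding V_def by (rule emeasure_lborel_cball_finite)
  \<comment> \<open>The first bound drops the exponential, the second drops the support.\<close>
  have factor: "(\<integral>\<^sup>+z. ennreal (cmod (F k s z)) \<partial>lborel)
      \<le> min (ennreal A * V) (ennreal A * G * ennreal (s powr (- real CARD('n) / 2)))" if s: "0 < s" for s k
  proof (rule min.boundedI)
    have "(\<integral>\<^sup>+z. ennreal (cmod (F k s z)) \<partial>lborel)
        \<le> (\<integral>\<^sup>+z. ennreal A * indicator (cball 0 R) (x - z) \<partial>lborel)"
    proof (rule nn_integral_mono)
      fix z :: "'n rvec"
      have "cmod (F k s z) \<le> 1 * (A * indicator (cball 0 R) (x - z))"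
        unfolding F_def norm_mult using s by (intro mult_mono gb) auto
      then show "ennreal (cmod (F k s z))
         \<le> ennreal A * indicator (cball 0 R) (x - z)"
        by (auto simp: indicator_def intro: ennreal_leI split: if_splits)
    qed
    also have "\<dots> = (\<integral>\<^sup>+z. ennreal A * indicator (cball 0 R) z \<partial>(lborel :: 'n rvec measure))"
      by (rule nn_integral_lborel_reflect[of "\<lambda>z. ennreal A * indicator (cball 0 R) z"]) measurable
    also have "\<dots> = ennreal A * V" by (simp add: V_def nn_integral_cmult_indicator)
    finally show "(\<integral>\<^sup>+z. ennreal (cmod (F k s z)) \<partial>lborel) \<le> ennreal A * V" .
    have "(\<integral>\<^sup>+z. ennreal (cmod (F k s z)) \<partial>lborel)
        \<le> (\<integral>\<^sup>+z. ennreal A * ennreal (exp (- s * (norm (0 - z :: 'n rvec))\<^sup>2)) \<partial>lborel)"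
    proof (rule nn_integral_mono)
      fix z :: "'n rvec"
      have "cmod (F k s z) \<le> exp (- s * (norm z)\<^sup>2) * (A * 1)"
        unfolding F_def norm_mult using gb[of k "x - z"] A
        by (intro mult_mono) (auto intro: order_trans split: split_indicator_asm)
      then show "ennreal (cmod (F k s z))
         \<le> ennreal A * ennreal (exp (- s * (norm (0 - z))\<^sup>2))"
        using A by (auto simp: ennreal_mult[symmetric] mult.commute intro: ennreal_leI)
    qed
    also have "\<dots> = ennreal A * (ennreal (s powr (- real CARD('n) / 2)) * G)"
      using nn_integral_gaussian_scaled[OF s, of "0 :: 'n rvec"] by (subst nn_integral_cmult) (simp_all add: G_def)
    finally show "(\<integral>\<^sup>+z. ennreal (cmod (F k s z)) \<partial>lborel)
        \<le> ennreal A * G * ennreal (s powr (- real CARD('n) / 2))" by (simp add: mult_ac)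
  qed
  let ?m = "CARD('m)"
  have hn: "(\<integral>\<^sup>+y. ennreal (cmod (h s y)) \<partial>lborel) \<le>
     ennreal (W s) * min ((ennreal A * V) ^ ?m) ((ennreal A * G) ^ ?m * ennreal (s powr (- (real CARD('m) * real CARD('n) / 2))))" for s
  proof (cases "0 < s")
    case False
    then show ?thesis by (simp add: h_def W_def)
  next
    case True
    have "(\<integral>\<^sup>+y. ennreal (cmod (h s y)) \<partial>lborel) = (\<integral>\<^sup>+y. ennreal (W s) *
        (\<Prod>k\<in>UNIV. ennreal (cmod (F k s (y $ k)))) \<partial>lborel)"
      using W0 by (intro nn_integral_cong)
        (simp add: hprod norm_mult prod_norm prod_ennreal ennreal_mult)
    also have "\<dots> = ennreal (W s) * (\<Prod>k\<in>UNIV. \<integral>\<^sup>+z. ennreal (cmod (F k s z)) \<partial>lborel)"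
      by (subst nn_integral_cmult) (simp_all add: nn_integral_lborel_vec_prod[where f = "\<lambda>k z. ennreal (cmod (F k s z))"])
    also have "\<dots> \<le> ennreal (W s) * (\<Prod>k\<in>(UNIV::'m set). min (ennreal A * V) (ennreal A * G * ennreal (s powr (- real CARD('n) / 2))))"
      by (intro mult_left_mono prod_mono_ennreal factor True) auto
    also have "\<dots> \<le> ennreal (W s) * min ((ennreal A * V) ^ ?m) ((ennreal A * G) ^ ?m * ennreal (s powr (- (real CARD('m) * real CARD('n) / 2))))"
    proof (intro mult_left_mono min.boundedI)
      show "(\<Prod>k\<in>(UNIV::'m set). min (ennreal A * V) (ennreal A * G * ennreal (s powr (- real CARD('n) / 2)))) \<le> (ennreal A * V) ^ ?m"
        by (simp add: power_mono)
      have "(\<Prod>k\<in>(UNIV::'m set). min (ennreal A * V) (ennreal A * G * ennreal (s powr (- real CARD('n) / 2))))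
          \<le> (ennreal A * G * ennreal (s powr (- real CARD('n) / 2))) ^ ?m"
        by (simp add: power_mono)
      also have "\<dots> = (ennreal A * G) ^ ?m * ennreal (s powr (- (real CARD('m) * real CARD('n) / 2)))"
      proof -
        have "(s powr (- real CARD('n) / 2)) ^ ?m = s powr (- (real CARD('m) * real CARD('n) / 2))"
          using True by (simp add: powr_realpow[symmetric] powr_powr mult.commute)
        then show ?thesis by (simp add: power_mult_distrib ennreal_power)
      qed
      finally show "(\<Prod>k\<in>(UNIV::'m set). min (ennreal A * V) (ennreal A * G * ennreal (s powr (- real CARD('n) / 2))))
          \<le> (ennreal A * G) ^ ?m * ennreal (s powr (- (real CARD('m) * real CARD('n) / 2)))" .
    qed simp
    finally show ?thesis .
  qed
  have hm [measurable]: "(\<lambda>(s, y). h s y) \<in> borel_measurable (lborel \<Otimes>\<^sub>M lborel)"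
    unfolding h_def by measurable
  have int: "integrable (lborel \<Otimes>\<^sub>M lborel) (\<lambda>(s, y). h s y)"
  proof (rule integrableI_bounded[OF hm])
    have "(\<integral>\<^sup>+z. ennreal (norm (case z of (s, y) \<Rightarrow> h s y)) \<partial>(lborel \<Otimes>\<^sub>M lborel))
        = (\<integral>\<^sup>+s. \<integral>\<^sup>+y. ennreal (cmod (h s y)) \<partial>lborel \<partial>lborel)"
      by (subst lborel.nn_integral_fst[symmetric]) auto
    also have "\<dots> \<le> (\<integral>\<^sup>+s. ennreal (indicator {0<..} s * s powr (b / 2 - 1)) *
        min ((ennreal A * V) ^ ?m) ((ennreal A * G) ^ ?m * ennreal (s powr (- (real CARD('m) * real CARD('n) / 2)))) \<partial>lborel)"
      by (intro nn_integral_mono) (use hn in \<open>simp add: W_def\<close>)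
    also have "\<dots> < \<infinity>"
      using V G by (intro nn_integral_powr_cases_finite b) (auto simp: power_less_top_ennreal ennreal_mult_less_top)
    finally show "(\<integral>\<^sup>+z. ennreal (norm (case z of (s, y) \<Rightarrow> h s y)) \<partial>(lborel \<Otimes>\<^sub>M lborel)) < \<infinity>" .
  qed
  have fubini: "(LINT y|lborel. LINT s|lborel. h s y) = (LINT s|lborel. LINT y|lborel. h s y)"
    by (rule lborel_pair.Fubini_integral[OF int])

  have inner_s: "(LINT s|lborel. h s y) = complex_of_real (Gamma (b / 2)) * (complex_of_real (1 / norm y powr b) * \<Phi> y)"
    if "y \<noteq> 0" for y
  proof -
    have r: "0 < (norm y)\<^sup>2" using that by simp
    have "(LINT s|lborel. h s y) = complex_of_real (LINT s|lborel. W s * exp (- s * (norm y)\<^sup>2)) * \<Phi> y"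
      unfolding h_def by (simp only: integral_mult_left_zero integral_complex_of_real)
    also have "(LINT s|lborel. W s * exp (- s * (norm y)\<^sup>2)) = Gamma (b / 2) * ((norm y)\<^sup>2) powr (- (b / 2))"
      using has_bochner_integral_integral_eq[OF Gamma_kernel_integral[OF b(1) r]] by (simp add: W_def mult.assoc)
    also have "((norm y)\<^sup>2) powr (- (b / 2)) = 1 / norm y powr b"
    proof -
      have "(norm y)\<^sup>2 = norm y powr 2" using that by simp
      then show ?thesis by (simp only: powr_powr) (simp add: powr_minus_divide)
    qed
    finally show ?thesis by simp
  qed
  have inner_y: "(LINT y|lborel. h s y) = complex_of_real (W s) * (\<Prod>k\<in>UNIV. distr_of (f k) (gauss s x))" for s
  proof (cases "0 < s")
    case False
    then show ?thesis by (simp add: h_def W_def)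
  next
    case True
    have "integrable lborel (\<lambda>z. F k s z)" for k
    proof (rule integrableI_bounded)
      have "(\<integral>\<^sup>+z. ennreal (cmod (F k s z)) \<partial>lborel) \<le> ennreal A * V"
        using factor[OF True, of k] by simp
      also have "\<dots> < \<infinity>" using V by (simp add: ennreal_mult_less_top)
      finally show "(\<integral>\<^sup>+z. ennreal (cmod (F k s z)) \<partial>lborel) < \<infinity>" .
    qed measurable
    then have "(LINT y|lborel. h s y) = complex_of_real (W s) *
       (\<Prod>k\<in>UNIV. LINT z|lborel. F k s z)"
      unfolding hprod by (simp only: integral_mult_right_zero integral_lborel_vec_prod[where f = "\<lambda>k. F k s"])
    also have "(\<Prod>k\<in>UNIV. LINT z|lborel. F k s z)
        = (\<Prod>k\<in>UNIV. distr_of (f k) (gauss s x))"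
    proof (rule prod.cong)
      fix k :: 'm
      have "(LINT z|lborel. F k s z)
          = (LINT z|lborel. (\<lambda>z. g k z * gauss s x z) (x - z))"
        by (simp add: F_def gauss_eq mult.commute)
      also have "\<dots> = (LINT z|lborel. g k z * gauss s x z)"
        using schwartz_borel_measurable[OF gauss_schwartz[OF True, of x]]
        by (intro integral_lborel_reflect) simp
      also have "\<dots> = distr_of (f k) (gauss s x)"
        by (rule distr_of_borel[OF fm g fg gauss_schwartz[OF True], symmetric])
      finally show "(LINT z|lborel. F k s z) = distr_of (f k) (gauss s x)" .
    qed simp
    finally show ?thesis .
  qed
  have AEy: "AE y in (lborel :: ('n rvec, 'm) vec measure). \<forall>k. f k (x - y $ k) = g k (x - y $ k)"
  proof (subst AE_all_countable, intro allI AE_lborel_vec_component)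
    fix k
    show "AE z in lborel. f k z = g k z" using fg[of k] by (simp add: AE_completion_iff)
  qed
  have K [measurable]: "(\<lambda>y :: ('n rvec, 'm) vec. complex_of_real (1 / norm y powr b)) \<in> borel_measurable borel"
    by measurable
  have "frac_int \<alpha> f x = (LINT y|lebesgue. complex_of_real (1 / norm y powr b) * \<Phi> y)"
    unfolding frac_int_def b_def[symmetric]
  proof (rule integral_cong_AE)
    have m: "(\<lambda>y. complex_of_real (1 / norm y powr b) * \<Phi> y) \<in> borel_measurable lebesgue"
      by (intro measurable_completion) simp
    have eq: "AE y in lebesgue. complex_of_real (1 / norm y powr b) * (\<Prod>k\<in>UNIV. f k (x - y $ k)) = complex_of_real (1 / norm y powr b) * \<Phi> y"
      using AE_completion[OF AEy] by eventually_elim (simp add: \<Phi>_def)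
    have eq': "AE y in lebesgue. complex_of_real (1 / norm y powr b) * \<Phi> y = complex_of_real (1 / norm y powr b) * (\<Prod>k\<in>UNIV. f k (x - y $ k))"
      using eq by eventually_elim (rule sym)
    show "(\<lambda>y. complex_of_real (1 / norm y powr b) * \<Phi> y) \<in> borel_measurable lebesgue" by (rule m)
    show "(\<lambda>y. complex_of_real (1 / norm y powr b) * (\<Prod>k\<in>UNIV. f k (x - y $ k))) \<in> borel_measurable lebesgue"
      by (rule borel_measurable_AE[OF m eq'])
    show "AE y in lebesgue. complex_of_real (1 / norm y powr b) * (\<Prod>k\<in>UNIV. f k (x - y $ k)) = complex_of_real (1 / norm y powr b) * \<Phi> y"
      by (rule eq)
  qed
  also have "\<dots> = (LINT y|lborel. complex_of_real (1 / norm y powr b) * \<Phi> y)"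
    by (rule integral_completion) simp
  finally have fi: "frac_int \<alpha> f x = (LINT y|lborel. complex_of_real (1 / norm y powr b) * \<Phi> y)" .
  have "frac_ext \<alpha> (\<lambda>k. distr_of (f k)) x = complex_of_real (1 / Gamma (b / 2)) * (LINT s|lborel. LINT y|lborel. h s y)"
    unfolding frac_ext_def frac_integrand_def b_def[symmetric] inner_y W_def ..
  also have "\<dots> = complex_of_real (1 / Gamma (b / 2)) * (LINT y|lborel. LINT s|lborel. h s y)"
    by (simp only: fubini)
  also have "(LINT y|lborel. LINT s|lborel. h s y)
      = (LINT y|lborel. complex_of_real (Gamma (b / 2)) * (complex_of_real (1 / norm y powr b) * \<Phi> y))"
  proof (rule integral_cong_AE)
    show "(\<lambda>y. LINT s|lborel. h s y) \<in> borel_measurable lborel"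
    proof (rule lborel.borel_measurable_lebesgue_integral)
      show "(\<lambda>(y, s). h s y) \<in> borel_measurable (lborel \<Otimes>\<^sub>M lborel)" unfolding h_def by measurable
    qed
    \<comment> \<open>At \<open>y = 0\<close> the Gamma formula does not apply, but a point is a
      null set.\<close>
    have "AE y in (lborel :: ('n rvec, 'm) vec measure). y \<noteq> 0" by (rule AE_lborel_singleton)
    then show "AE y in lborel. (LINT s|lborel. h s y) = complex_of_real (Gamma (b / 2)) * (complex_of_real (1 / norm y powr b) * \<Phi> y)"
      by eventually_elim (rule inner_s)
  qed simp
  also have "\<dots> = complex_of_real (Gamma (b / 2)) * frac_int \<alpha> f x"
    unfolding fi by (rule integral_mult_right_zero)
  also have "complex_of_real (1 / Gamma (b / 2)) * (complex_of_real (Gamma (b / 2)) * frac_int \<alpha> f x) = frac_int \<alpha> f x"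
    using Gamma_real_pos[OF b(1)] by simp
  finally show ?thesis .
qed

section \<open>Boundedness on Hardy spaces\<close>

definition same_cell :: "int \<Rightarrow> 'n::finite rvec \<Rightarrow> 'n rvec \<Rightarrow> bool" where
  "same_cell j x y \<longleftrightarrow> (\<forall>i. \<lfloor>x $ i / 2 powr real_of_int j\<rfloor> = \<lfloor>y $ i / 2 powr real_of_int j\<rfloor>)"

text \<open>The largest function below \<open>F\<close> that is constant on the dyadic cells of side
  \<open>2 powr j\<close>; as such it is Borel measurable for every \<open>F\<close>.\<close>

definition cell_inf :: "int \<Rightarrow> ('n::finite rvec \<Rightarrow> ennreal) \<Rightarrow> 'n rvec \<Rightarrow> ennreal" where
  "cell_inf j F x = (INF y\<in>{y. same_cell j x y}. F y)"

lemma dyadic_cell_inf: "dyadic j (cell_inf j F)"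
  unfolding dyadic_def cell_inf_def same_cell_def by simp

lemma cell_inf_le: "cell_inf j F x \<le> F x"
  unfolding cell_inf_def by (rule INF_lower) (simp add: same_cell_def)

definition cell_majorant :: "real \<Rightarrow> ('n::finite rvec \<Rightarrow> ennreal) \<Rightarrow> 'n rvec \<Rightarrow> ennreal" where
  "cell_majorant a F x = (\<Sum>\<^sup>+j. pow2 a j * cell_inf j F x)"

definition frac_majorant ::
    "('m::finite \<Rightarrow> nat) \<Rightarrow> real \<Rightarrow> ('m \<Rightarrow> 'n::{finite,linorder} distribution) \<Rightarrow> 'n rvec \<Rightarrow> ennreal" where
  "frac_majorant N a u x = (\<Prod>k\<in>UNIV. cell_majorant a (grand_maximal (N k) (u k)) x)"

lemma cell_majorant_measurable: "cell_majorant a F \<in> borel_measurable borel"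
  unfolding cell_majorant_def[abs_def]
proof (rule borel_measurable_nn_integral_int)
  fix j :: int
  have [measurable]: "cell_inf j F \<in> borel_measurable borel"
    by (rule dyadic_measurable[OF dyadic_cell_inf])
  show "(\<lambda>x. pow2 a j * cell_inf j F x) \<in> borel_measurable borel" by measurable
qed

lemma frac_majorant_measurable: "frac_majorant N a u \<in> borel_measurable borel"
  unfolding frac_majorant_def[abs_def]
  by (intro borel_measurable_prod_ennreal cell_majorant_measurable)

lemma same_cell_norm:
  fixes x y :: "'n::finite rvec"
  assumes "same_cell j x y"
  shows "norm (x - y) \<le> real CARD('n) * 2 powr real_of_int j"
proof -
  let ?d = "2 powr real_of_int j"
  have "\<bar>(x - y) $ i\<bar> \<le> ?d" for i
  proof -
    have "\<lfloor>x $ i / ?d\<rfloor> = \<lfloor>y $ i / ?d\<rfloor>" using assms by (simp add: same_cell_def)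
    then have "\<bar>x $ i / ?d - y $ i / ?d\<bar> \<le> 1" by linarith
    then have "\<bar>(x $ i - y $ i) / ?d\<bar> \<le> 1" by (simp add: diff_divide_distrib)
    then show ?thesis by (simp add: abs_divide)
  qed
  then have "(\<Sum>i\<in>UNIV. \<bar>(x - y) $ i\<bar>) \<le> (\<Sum>i\<in>(UNIV::'n set). ?d)" by (rule sum_mono)
  then show ?thesis using norm_le_l1_cart[of "x - y"] by simp
qed

text \<open>For \<open>s\<close> in this shell and \<open>x\<close>, \<open>y\<close> in one cell,
  \<open>sqrt s * norm (x - y) \<le> n\<close>. So \<open>tempered_gauss_le_maximal\<close> holds
  with every point of the cell in place of \<open>x'\<close> and passes to the infimum. The lower
  end of the shell gives \<open>s powr (- n / 2) \<le> 2 powr n * 2 powr (j * n)\<close>.\<close>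

lemma tempered_gauss_le_cell_inf:
  "\<exists>C>0. \<forall>(u :: 'n::{finite,linorder} distribution) s x j. u \<in> tempered \<longrightarrow>
     s \<in> {2 powr (- 2 * (real_of_int j + 1))<..2 powr (- 2 * real_of_int j)} \<longrightarrow>
     ennreal (cmod (u (gauss s x))) \<le> ennreal C * (pow2 (real CARD('n)) j * cell_inf j (grand_maximal N u) x)"
proof -
  let ?n = "real CARD('n)"
  obtain C where C: "0 < C"
    "\<And>(u :: 'n distribution) s x x'. u \<in> tempered \<Longrightarrow> 0 < s \<Longrightarrow> sqrt s * norm (x - x') \<le> ?n \<Longrightarrow>
     ennreal (cmod (u (gauss s x))) \<le> ennreal (C * s powr (- ?n / 2)) * grand_maximal N u x'"
    using tempered_gauss_le_maximal[of ?n N] by blast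
  define C' where "C' = C * 2 powr ?n"
  have "ennreal (cmod (u (gauss s x))) \<le> ennreal C' * (pow2 ?n j * cell_inf j (grand_maximal N u) x)"
    if u: "u \<in> tempered" and s: "s \<in> {2 powr (- 2 * (real_of_int j + 1))<..2 powr (- 2 * real_of_int j)}"
    for u :: "'n distribution" and s x j
  proof -
    have s0: "0 < s" using s by (auto intro: less_trans[of 0 "2 powr _"])
    have sq: "sqrt s \<le> 2 powr (- real_of_int j)"
    proof -
      have "sqrt s \<le> sqrt (2 powr (- 2 * real_of_int j))" using s by simp
      also have "\<dots> = 2 powr (- real_of_int j)" by (simp add: powr_half_sqrt[symmetric] powr_powr)
      finally show ?thesis .
    qed
    have sn: "s powr (- ?n / 2) \<le> 2 powr ?n * 2 powr (real_of_int j * ?n)"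
    proof -
      have "s powr (- ?n / 2) \<le> (2 powr (- 2 * (real_of_int j + 1))) powr (- ?n / 2)"
        using s by (intro powr_mono2') auto
      also have "\<dots> = 2 powr (?n + real_of_int j * ?n)" by (simp add: powr_powr algebra_simps)
      finally show ?thesis by (simp add: powr_add)
    qed
    define c where "c = C' * 2 powr (real_of_int j * ?n)"
    have c: "0 < c" using C(1) by (simp add: c_def C'_def)
    \<comment> \<open>With the constant moved to the left, a bound for each \<open>y\<close>
      separately is a bound for the infimum.\<close>
    have "ennreal (1 / c) * ennreal (cmod (u (gauss s x))) \<le> cell_inf j (grand_maximal N u) x"
      unfolding cell_inf_def
    proof (rule INF_greatest)
      fix y assume "y \<in> {y. same_cell j x y}"
      then have "sqrt s * norm (x - y) \<le> 2 powr (- real_of_int j) * (?n * 2 powr real_of_int j)"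
        using same_cell_norm[of j x y] sq by (intro mult_mono) auto
      also have "\<dots> = ?n" by (simp add: powr_minus)
      finally have "ennreal (cmod (u (gauss s x))) \<le> ennreal (C * s powr (- ?n / 2)) * grand_maximal N u y"
        by (rule C(2)[OF u s0])
      also have "\<dots> \<le> ennreal c * grand_maximal N u y"
        using sn C(1) by (intro mult_right_mono ennreal_leI) (auto simp: c_def C'_def mult.assoc)
      finally have "ennreal (1 / c) * ennreal (cmod (u (gauss s x))) \<le> ennreal (1 / c) * (ennreal c * grand_maximal N u y)"
        by (rule mult_left_mono) simp
      also have "\<dots> = grand_maximal N u y"
        using c by (simp add: mult.assoc[symmetric] ennreal_mult[symmetric])
      finally show "ennreal (1 / c) * ennreal (cmod (u (gauss s x))) \<le> grand_maximal N u y" .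
    qed
    then have "ennreal c * (ennreal (1 / c) * ennreal (cmod (u (gauss s x)))) \<le> ennreal c * cell_inf j (grand_maximal N u) x"
      by (rule mult_left_mono) simp
    moreover have "ennreal c * (ennreal (1 / c) * ennreal (cmod (u (gauss s x)))) = ennreal (cmod (u (gauss s x)))"
      using c by (simp add: mult.assoc[symmetric] ennreal_mult[symmetric])
    moreover have "ennreal c = ennreal C' * pow2 ?n j"
      using C(1) by (simp add: c_def C'_def ennreal_mult)
    ultimately show ?thesis by (simp add: mult.assoc)
  qed
  moreover have "0 < C'" using C(1) by (simp add: C'_def)
  ultimately show ?thesis by blast
qed

text \<open>The left side is the diagonal part of the expanded product. \<open>K\<close> is
  nonempty, for an empty product would contribute 1 for each \<open>j\<close>.\<close>

lemma nn_integral_count_prod_le: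
  fixes a :: "'k \<Rightarrow> 'j \<Rightarrow> ennreal"
  assumes "finite K" "K \<noteq> {}"
  shows "(\<Sum>\<^sup>+j. (\<Prod>k\<in>K. a k j)) \<le> (\<Prod>k\<in>K. \<Sum>\<^sup>+j. a k j)"
  using assms
proof (induction K rule: finite_ne_induct)
  case (insert k K)
  have "(\<Sum>\<^sup>+j. a k j * (\<Prod>k\<in>K. a k j))
      \<le> (\<Sum>\<^sup>+j. (\<Sum>\<^sup>+j. a k j) * (\<Prod>k\<in>K. a k j))"
    by (intro nn_integral_mono mult_right_mono nn_integral_ge_point) auto
  also have "\<dots> = (\<Sum>\<^sup>+j. a k j) * (\<Sum>\<^sup>+j. (\<Prod>k\<in>K. a k j))"
    by (rule nn_integral_cmult) simp
  also have "\<dots> \<le> (\<Sum>\<^sup>+j. a k j) * (\<Prod>k\<in>K. \<Sum>\<^sup>+j. a k j)"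
    by (intro mult_left_mono insert.IH) simp
  finally show ?case using insert.hyps by simp
qed simp

text \<open>In the shell, \<open>s\<close> differs from \<open>2 powr (- 2 * j)\<close> by a factor
  of at most 4; which end is extremal depends on the sign of \<open>c\<close>.\<close>

lemma powr_shell_le:
  fixes s j c :: real
  assumes s: "s \<in> {2 powr (- 2 * (j + 1))<..2 powr (- 2 * j)}"
  shows "s powr c \<le> 4 powr \<bar>c\<bar> * 2 powr (- 2 * j * c)"
proof (cases "c \<ge> 0")
  case True
  have "0 < s" using s less_trans[of 0 "2 powr (- 2 * (j + 1))" s] by simp
  then have "s powr c \<le> (2 powr (- 2 * j)) powr c"
    using s True by (intro powr_mono2) auto
  also have "\<dots> = 1 * 2 powr (- 2 * j * c)" by (simp add: powr_powr)
  also have "\<dots> \<le> 4 powr \<bar>c\<bar> * 2 powr (- 2 * j * c)"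
    by (intro mult_right_mono) (auto simp: ge_one_powr_ge_zero)
  finally show ?thesis .
next
  case False
  have "s powr c \<le> (2 powr (- 2 * (j + 1))) powr c"
    using s False by (intro powr_mono2') auto
  also have "\<dots> = 2 powr (2 * \<bar>c\<bar>) * 2 powr (- 2 * j * c)"
    using False by (simp add: powr_powr powr_add[symmetric] algebra_simps)
  also have "2 powr (2 * \<bar>c\<bar>) = 4 powr \<bar>c\<bar>"
    by (simp add: powr_powr[symmetric])
  finally show ?thesis .
qed

text \<open>Exponents of 2 in the shell \<open>j\<close>: the \<open>m\<close> factors give
  \<open>j * m * n\<close>; the weight and the length of the shell give
  \<open>- 2 * j * (c + 1) = - j * (m * n - \<alpha>)\<close>. There remains
  \<open>j * \<alpha>\<close>, shared equally by the \<open>m\<close> factors as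
  \<open>j * (\<alpha> / m)\<close>.\<close>

lemma frac_kernel_bound:
  fixes N :: "'m::finite \<Rightarrow> nat"
  shows "\<exists>C<\<infinity>. \<forall>(u :: 'm \<Rightarrow> 'n::{finite,linorder} distribution) x. (\<forall>k. u k \<in> tempered) \<longrightarrow>
    (\<integral>\<^sup>+s. ennreal (cmod (frac_integrand \<alpha> u x s)) \<partial>lborel) \<le> C * frac_majorant N (\<alpha> / real CARD('m)) u x"
proof -
  let ?n = "real CARD('n)" and ?m = "real CARD('m)"
  define I where "I j = {2 powr (- 2 * (real_of_int j + 1))<..2 powr (- 2 * real_of_int j)}" for j
  have "\<forall>k. \<exists>C>0. \<forall>(u :: 'n::{finite,linorder} distribution) s x j. u \<in> tempered \<longrightarrow> s \<in> I j \<longrightarrow>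
     ennreal (cmod (u (gauss s x))) \<le> ennreal C * (pow2 ?n j * cell_inf j (grand_maximal (N k) u) x)"
    using tempered_gauss_le_cell_inf unfolding I_def by blast
  then obtain C where C: "\<And>k::'m. 0 < C k" "\<And>k (u :: 'n distribution) s x j. u \<in> tempered \<Longrightarrow> s \<in> I j \<Longrightarrow>
     ennreal (cmod (u (gauss s x))) \<le> ennreal (C k) * (pow2 ?n j * cell_inf j (grand_maximal (N k) u) x)"
    by metis
  define c where "c = (?m * ?n - \<alpha>) / 2 - 1"
  define K where "K = ennreal (4 powr \<bar>c\<bar>) * (\<Prod>k\<in>UNIV. ennreal (C k))"
  have "K < \<infinity>" by (simp add: K_def ennreal_mult_less_top prod_ennreal less_imp_le[OF C(1)])
  moreover have "(\<integral>\<^sup>+s. ennreal (cmod (frac_integrand \<alpha> u x s)) \<partial>lborel) \<le> K * frac_majorant N (\<alpha> / ?m) u x"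
    if u: "\<And>k. u k \<in> tempered" for u :: "'m \<Rightarrow> 'n distribution" and x
  proof -
    define U where "U k j = cell_inf j (grand_maximal (N k) (u k)) x" for k j
    define d where "d j = ennreal (2 powr (- 2 * real_of_int j * c)) * (\<Prod>k\<in>UNIV. pow2 ?n j * U k j)" for j
    have eq: "ennreal (cmod (frac_integrand \<alpha> u x s)) =
        ennreal (indicator {0<..} s * s powr c) * (\<Prod>k\<in>UNIV. ennreal (cmod (u k (gauss s x))))" for s
      unfolding frac_integrand_def c_def[symmetric]
      by (simp add: norm_mult prod_norm[symmetric] prod_ennreal ennreal_mult prod_nonneg)
    have pt: "ennreal (cmod (frac_integrand \<alpha> u x s)) \<le> (\<Sum>\<^sup>+j. K * d j * indicator (I j) s)" for s :: real
    proof (cases "0 < s")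
      case True
      \<comment> \<open>The shell containing \<open>s\<close>, that is
        \<open>- 2 * (j + 1) < log 2 s \<le> - 2 * j\<close>.\<close>
      define j where "j = \<lfloor>- log 2 s / 2\<rfloor>"
      have j: "s \<in> I j"
      proof -
        have "real_of_int j \<le> - log 2 s / 2" "- log 2 s / 2 < real_of_int j + 1"
          by (simp_all add: j_def)
        then have "- 2 * (real_of_int j + 1) < log 2 s" by (simp add: field_simps)
        moreover have "log 2 s \<le> - 2 * real_of_int j" using \<open>real_of_int j \<le> - log 2 s / 2\<close> by linarith
        ultimately show ?thesis unfolding I_def using True by (simp add: less_log_iff log_le_iff)
      qed
      have "ennreal (s powr c) * (\<Prod>k\<in>UNIV. ennreal (cmod (u k (gauss s x))))
         \<le> ennreal (4 powr \<bar>c\<bar> * 2 powr (- 2 * real_of_int j * c)) * (\<Prod>k\<in>UNIV. ennreal (C k) * (pow2 ?n j * U k j))"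
      proof (rule mult_mono)
        show "ennreal (s powr c) \<le> ennreal (4 powr \<bar>c\<bar> * 2 powr (- 2 * real_of_int j * c))"
          by (rule ennreal_leI[OF powr_shell_le[OF j[unfolded I_def]]])
        show "(\<Prod>k\<in>UNIV. ennreal (cmod (u k (gauss s x)))) \<le> (\<Prod>k\<in>UNIV. ennreal (C k) * (pow2 ?n j * U k j))"
          unfolding U_def by (rule prod_mono_ennreal) (rule C(2)[OF u j])
      qed simp_all
      also have "\<dots> = K * d j * indicator (I j) s"
        using j by (simp add: K_def d_def prod.distrib ennreal_mult mult_ac)
      also have "\<dots> \<le> (\<Sum>\<^sup>+j. K * d j * indicator (I j) s)"
        by (rule nn_integral_ge_point) simp
      finally show ?thesis using True by (simp add: eq)
    qed (simp add: eq)
    have "(\<integral>\<^sup>+s. ennreal (cmod (frac_integrand \<alpha> u x s)) \<partial>lborel)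
       \<le> (\<integral>\<^sup>+s. (\<Sum>\<^sup>+j. K * d j * indicator (I j) s) \<partial>lborel)"
      by (rule nn_integral_mono) (rule pt)
    also have "\<dots> = (\<integral>\<^sup>+j. \<integral>\<^sup>+s. K * d j * indicator (I j) s \<partial>lborel \<partial>count_space UNIV)"
      by (rule nn_integral_count_space_nn_integral) (auto simp: I_def)
    also have "\<dots> \<le> (\<Sum>\<^sup>+j. K * (\<Prod>k\<in>UNIV. pow2 (\<alpha> / ?m) j * U k j))"
    proof (rule nn_integral_mono)
      fix j :: int
      have le: "2 powr (- 2 * (real_of_int j + 1)) \<le> 2 powr (- 2 * real_of_int j)" by (rule powr_mono) auto
      have "(\<integral>\<^sup>+s. K * d j * indicator (I j) s \<partial>lborel) = K * d j * emeasure lborel (I j)"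
        by (rule nn_integral_cmult_indicator) (simp add: I_def)
      also have "\<dots> \<le> K * d j * ennreal (2 powr (- 2 * real_of_int j))"
        using le by (intro mult_left_mono) (auto simp: I_def intro!: ennreal_leI)
      also have "\<dots> = K * (\<Prod>k\<in>UNIV. pow2 (\<alpha> / ?m) j * U k j)"
      proof -
        have "ennreal (2 powr (- 2 * real_of_int j * c)) * ennreal (2 powr (- 2 * real_of_int j)) * (pow2 ?n j) ^ CARD('m)
           = ennreal (2 powr (- 2 * real_of_int j * c) * 2 powr (- 2 * real_of_int j) * (2 powr (real_of_int j * ?n)) ^ CARD('m))"
          by (simp add: ennreal_mult ennreal_power)
        also have "2 powr (- 2 * real_of_int j * c) * 2 powr (- 2 * real_of_int j) * (2 powr (real_of_int j * ?n)) ^ CARD('m)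
            = 2 powr (- 2 * real_of_int j * c + - 2 * real_of_int j + (real_of_int j * ?n) * ?m)"
        proof -
          have "(2 powr (real_of_int j * ?n)) ^ CARD('m) = (2::real) powr ((real_of_int j * ?n) * ?m)"
            by (simp add: powr_powr powr_realpow[symmetric])
          then show ?thesis by (simp only: powr_add)
        qed
        also have "- 2 * real_of_int j * c + - 2 * real_of_int j + (real_of_int j * ?n) * ?m = (real_of_int j * (\<alpha> / ?m)) * ?m"
          by (simp add: c_def field_simps)
        also have "2 powr ((real_of_int j * (\<alpha> / ?m)) * ?m) = (2 powr (real_of_int j * (\<alpha> / ?m))) ^ CARD('m)"
          by (simp add: powr_powr powr_realpow[symmetric])
        finally have eq: "ennreal (2 powr (- 2 * real_of_int j * c)) * ennreal (2 powr (- 2 * real_of_int j)) * (pow2 ?n j) ^ CARD('m)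
           = (pow2 (\<alpha> / ?m) j) ^ CARD('m)" by (simp add: ennreal_power)
        have "d j * ennreal (2 powr (- 2 * real_of_int j)) =
           (ennreal (2 powr (- 2 * real_of_int j * c)) * ennreal (2 powr (- 2 * real_of_int j)) * (pow2 ?n j) ^ CARD('m)) * (\<Prod>k\<in>UNIV. U k j)"
          by (simp only: d_def prod.distrib prod_constant mult_ac)
        then show ?thesis unfolding eq by (simp only: prod.distrib prod_constant mult_ac)
      qed
      finally show "(\<integral>\<^sup>+s. K * d j * indicator (I j) s \<partial>lborel) \<le> K * (\<Prod>k\<in>UNIV. pow2 (\<alpha> / ?m) j * U k j)" .
    qed
    also have "\<dots> = K * (\<Sum>\<^sup>+j. (\<Prod>k\<in>UNIV. pow2 (\<alpha> / ?m) j * U k j))"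
      by (rule nn_integral_cmult) simp
    also have "\<dots> \<le> K * (\<Prod>k\<in>UNIV. \<Sum>\<^sup>+j. pow2 (\<alpha> / ?m) j * U k j)"
      by (intro mult_left_mono nn_integral_count_prod_le) auto
    finally show ?thesis by (simp add: U_def frac_majorant_def cell_majorant_def)
  qed
  ultimately show ?thesis by blast
qed

lemma frac_integrand_measurable:
  fixes u :: "'m::finite \<Rightarrow> 'n::{finite,linorder} distribution"
  assumes u: "\<And>k. u k \<in> tempered"
  shows "(\<lambda>(x, s). frac_integrand \<alpha> u x s) \<in> borel_measurable (borel \<Otimes>\<^sub>M lborel)"
proof -
  let ?c = "(real CARD('m) * real CARD('n) - \<alpha>) / 2 - 1"
  have [measurable]: "(\<lambda>(s, x). indicator {0<..} s * u k (gauss s x)) \<in> borel_measurable (borel \<Otimes>\<^sub>M borel)" for k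
    by (rule tempered_gauss_measurable[OF u])
  \<comment> \<open>Each factor may carry its own copy of the indicator, as the whole expression
    vanishes for \<open>s \<le> 0\<close>. This is the form in which
    \<open>tempered_gauss_measurable\<close> applies.\<close>
  have "(\<lambda>(x, s). frac_integrand \<alpha> u x s)
    = (\<lambda>z. complex_of_real (indicator {0<..} (snd z) * snd z powr ?c) *
        (\<Prod>k\<in>UNIV. (\<lambda>(s, x). indicator {0<..} s * u k (gauss s x)) (snd z, fst z)))"
    by (auto simp: frac_integrand_def fun_eq_iff indicator_def)
  also have "\<dots> \<in> borel_measurable (borel \<Otimes>\<^sub>M lborel)" by measurable
  finally show ?thesis .
qed

lemma frac_ext_measurable:
  fixes u :: "'m::finite \<Rightarrow> 'n::{finite,linorder} distribution"
  assumes u: "\<And>k. u k \<in> tempered"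
  shows "frac_ext \<alpha> u \<in> borel_measurable borel"
proof -
  have "(\<lambda>x. LINT s|lborel. frac_integrand \<alpha> u x s) \<in> borel_measurable borel"
    by (rule lborel.borel_measurable_lebesgue_integral[OF frac_integrand_measurable]) (rule u)
  then show ?thesis unfolding frac_ext_def[abs_def] by measurable
qed

section \<open>The extension: norm bound, absolute convergence, multilinearity\<close>

lemma hardy_tempered: "u \<in> hardy_space N p \<Longrightarrow> u \<in> tempered"
  by (simp add: hardy_space_def)

text \<open>The formula for \<open>Q\<close> says \<open>1 / Q k i = 1 / P k i - a\<close> with
  \<open>a = \<alpha> / (m * n)\<close>, which is the relation in the dyadic embedding; the weight
  \<open>a * n\<close> there is the \<open>\<alpha> / m\<close> of the majorant. The embedding is
  applied for each \<open>k\<close>, after Hoelder has separated the factors.\<close>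

lemma mixed_norm_frac_majorant:
  fixes P :: "'m::finite \<Rightarrow> 'n::{finite,linorder} \<Rightarrow> real"
  assumes \<alpha>: "0 < \<alpha>" and P: "\<And>k i. 0 < P k i" and Q: "\<And>k i. 0 < Q k i" and q: "\<And>i. 0 < q i"
    and sum: "\<And>i. 1 / q i = (\<Sum>k\<in>UNIV. 1 / Q k i)"
    and PQ: "\<And>k i. Q k i = real CARD('m) * real CARD('n) * P k i / (real CARD('m) * real CARD('n) - \<alpha> * P k i)"
  shows "\<exists>C<\<infinity>. \<forall>u. mixed_norm q (frac_majorant N (\<alpha> / real CARD('m)) u)
    \<le> C * (\<Prod>k\<in>UNIV. hardy_norm (N k) (P k) (u k))"
proof -
  define M where "M = real CARD('m) * real CARD('n)"
  have M: "0 < M" by (simp add: M_def)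
  define a where "a = \<alpha> / M"
  have a: "0 < a" using \<alpha> M by (simp add: a_def)
  \<comment> \<open>Positivity of \<open>Q\<close> forces the denominator in its formula to be
    positive.\<close>
  have aP: "a * P k i < 1" for k i
  proof -
    have "0 < M * P k i / (M - \<alpha> * P k i)" using Q[of k i] PQ[of k i] by (simp add: M_def)
    then have "0 < M - \<alpha> * P k i" using M P[of k i] by (simp add: zero_less_divide_iff mult_less_0_iff)
    then show ?thesis using M by (simp add: a_def field_simps)
  qed
  have Qa: "Q k i = P k i / (1 - a * P k i)" for k i
  proof -
    have "M - \<alpha> * P k i = M * (1 - a * P k i)" using M by (simp add: a_def algebra_simps)
    then show ?thesis unfolding PQ M_def[symmetric] using M by simp
  qed
  have an: "a * real CARD('n) = \<alpha> / real CARD('m)" by (simp add: a_def M_def)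
  have "\<forall>k. \<exists>C<\<infinity>. \<forall>F. mixed_norm (Q k) (cell_majorant (\<alpha> / real CARD('m)) F) \<le> C * mixed_norm (P k) F"
  proof
    fix k
    obtain C where C: "C < \<infinity>" "\<forall>U F. (\<forall>j. dyadic j (U j)) \<longrightarrow> (\<forall>j x. U j x \<le> F x) \<longrightarrow>
      mixed_norm (Q k) (\<lambda>x. \<Sum>\<^sup>+j. pow2 (a * real CARD('n)) j * U j x) \<le> C * mixed_norm (P k) F"
      using mixed_norm_dyadic_sum_le[where p = "P k" and q = "Q k", OF a P aP Qa] by blast
    have "mixed_norm (Q k) (cell_majorant (a * real CARD('n)) F) \<le> C * mixed_norm (P k) F" for F
      unfolding cell_majorant_def by (rule C(2)[rule_format]) (rule dyadic_cell_inf cell_inf_le)+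
    then show "\<exists>C<\<infinity>. \<forall>F. mixed_norm (Q k) (cell_majorant (\<alpha> / real CARD('m)) F) \<le> C * mixed_norm (P k) F"
      unfolding an[symmetric] using C(1) by blast
  qed
  from choice[OF this] obtain C where C: "\<And>k. C k < \<infinity>"
    "\<And>k F. mixed_norm (Q k) (cell_majorant (\<alpha> / real CARD('m)) F) \<le> C k * mixed_norm (P k) F"
    by blast
  have "(\<Prod>k\<in>UNIV. C k) < \<infinity>" using C(1) by (simp add: ennreal_prod_eq_top less_top[symmetric])
  moreover have "mixed_norm q (frac_majorant N (\<alpha> / real CARD('m)) u)
    \<le> (\<Prod>k\<in>UNIV. C k) * (\<Prod>k\<in>UNIV. hardy_norm (N k) (P k) (u k))" for u
  proof -
    have "mixed_norm q (frac_majorant N (\<alpha> / real CARD('m)) u)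
      \<le> (\<Prod>k\<in>UNIV. mixed_norm (Q k) (cell_majorant (\<alpha> / real CARD('m)) (grand_maximal (N k) (u k))))"
      unfolding frac_majorant_def by (rule mixed_norm_Holder[OF cell_majorant_measurable q Q sum])
    also have "\<dots> \<le> (\<Prod>k\<in>UNIV. C k * hardy_norm (N k) (P k) (u k))"
      unfolding hardy_norm_def by (rule prod_mono_ennreal) (rule C(2))
    finally show ?thesis by (simp add: prod.distrib)
  qed
  ultimately show ?thesis by blast
qed

theorem frac_ext_bounded:
  fixes P :: "'m::finite \<Rightarrow> 'n::{finite,linorder} \<Rightarrow> real"
  assumes \<alpha>: "0 < \<alpha>" "\<alpha> < real CARD('m) * real CARD('n)"
    and P: "\<And>k i. 0 < P k i" and Q: "\<And>k i. 0 < Q k i" and q: "\<And>i. 0 < q i"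
    and sum: "\<And>i. 1 / q i = (\<Sum>k\<in>UNIV. 1 / Q k i)"
    and PQ: "\<And>k i. Q k i = real CARD('m) * real CARD('n) * P k i / (real CARD('m) * real CARD('n) - \<alpha> * P k i)"
  shows "\<exists>C>0. \<forall>f. (\<forall>k. f k \<in> hardy_space (N k) (P k)) \<longrightarrow>
     Lp_norm q (frac_ext \<alpha> f) \<le> ennreal C * (\<Prod>k\<in>UNIV. hardy_norm (N k) (P k) (f k)) \<and>
     (AE x in lebesgue. integrable lborel (frac_integrand \<alpha> f x))"
proof -
  define b where "b = real CARD('m) * real CARD('n) - \<alpha>"
  have b: "0 < b / 2" using \<alpha> by (simp add: b_def)
  define a where "a = \<alpha> / real CARD('m)"
  obtain C1 where C1: "C1 < \<infinity>" "\<And>(u :: 'm \<Rightarrow> 'n distribution) x. (\<And>k. u k \<in> tempered) \<Longrightarrow>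
    (\<integral>\<^sup>+s. ennreal (cmod (frac_integrand \<alpha> u x s)) \<partial>lborel) \<le> C1 * frac_majorant N a u x"
    using frac_kernel_bound[of \<alpha> N] unfolding a_def by blast
  obtain C2 where C2: "C2 < \<infinity>" "\<And>u. mixed_norm q (frac_majorant N a u) \<le> C2 * (\<Prod>k\<in>UNIV. hardy_norm (N k) (P k) (u k))"
    using mixed_norm_frac_majorant[where P = P and Q = Q and q = q and N = N and \<alpha> = \<alpha>, OF \<alpha>(1) P Q q sum PQ]
    unfolding a_def by blast
  define g where "g = 1 / Gamma (b / 2)"
  have g: "0 < g" using Gamma_real_pos[OF b] by (simp add: g_def)
  \<comment> \<open>The 1 makes \<open>C\<close> positive even if the product is 0.\<close>
  define C where "C = 1 + enn2real (ennreal g * C1 * C2)"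
  have fin: "ennreal g * C1 * C2 < \<infinity>" using C1(1) C2(1) by (simp add: ennreal_mult_less_top)
  then have gC: "ennreal g * C1 * C2 \<le> ennreal C"
    by (simp add: C_def ennreal_plus add_increasing less_top)
  have "Lp_norm q (frac_ext \<alpha> f) \<le> ennreal C * (\<Prod>k\<in>UNIV. hardy_norm (N k) (P k) (f k)) \<and>
     (AE x in lebesgue. integrable lborel (frac_integrand \<alpha> f x))"
    if f: "\<And>k. f k \<in> hardy_space (N k) (P k)" for f
  proof
    have ft: "f k \<in> tempered" for k by (rule hardy_tempered[OF f])
    define H where "H = frac_integrand \<alpha> f"
    have Hm: "(\<lambda>(x, s). H x s) \<in> borel_measurable (borel \<Otimes>\<^sub>M lborel)"
      unfolding H_def by (rule frac_integrand_measurable[OF ft])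
    have Hx [measurable]: "H x \<in> borel_measurable lborel" for x
      using measurable_compose[OF measurable_Pair1'[of x borel lborel] Hm] by simp
    have Hn: "(\<integral>\<^sup>+s. ennreal (norm (H x s)) \<partial>lborel) \<le> C1 * frac_majorant N a f x" for x
      unfolding H_def by (rule C1(2)[OF ft])
    have pt: "ennreal (cmod (frac_ext \<alpha> f x)) \<le> ennreal g * C1 * frac_majorant N a f x" for x
    proof -
      have "ennreal (cmod (LINT s|lborel. H x s)) \<le> C1 * frac_majorant N a f x"
      proof (cases "integrable lborel (H x)")
        case True
        then show ?thesis by (rule order_trans[OF integral_norm_bound_ennreal Hn])
      next
        case False
        \<comment> \<open>The integral is 0 by convention here, so the bound holds at every point
          \<open>x\<close>.\<close>
        then show ?thesis by (simp add: not_integrable_integral_eq)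
      qed
      then have "ennreal g * ennreal (cmod (LINT s|lborel. H x s)) \<le> ennreal g * (C1 * frac_majorant N a f x)"
        by (rule mult_left_mono) simp
      moreover have "cmod (frac_ext \<alpha> f x) = g * cmod (LINT s|lborel. H x s)"
        unfolding frac_ext_def b_def[symmetric] H_def g_def[symmetric] norm_mult using g by simp
      ultimately show ?thesis using g by (simp add: ennreal_mult mult.assoc)
    qed
    have "Lp_norm q (frac_ext \<alpha> f) \<le> mixed_norm q (\<lambda>x. (ennreal g * C1) * frac_majorant N a f x)"
      unfolding Lp_norm_def by (rule mixed_norm_mono[OF pt q])
    also have "\<dots> = (ennreal g * C1) * mixed_norm q (frac_majorant N a f)"
      by (rule mixed_norm_cmult[OF frac_majorant_measurable q])
    also have "\<dots> \<le> (ennreal g * C1) * (C2 * (\<Prod>k\<in>UNIV. hardy_norm (N k) (P k) (f k)))"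
      by (intro mult_left_mono C2(2)) simp
    also have "\<dots> = (ennreal g * C1 * C2) * (\<Prod>k\<in>UNIV. hardy_norm (N k) (P k) (f k))"
      by (simp add: mult.assoc)
    also have "\<dots> \<le> ennreal C * (\<Prod>k\<in>UNIV. hardy_norm (N k) (P k) (f k))"
      by (rule mult_right_mono[OF gC]) simp
    finally show "Lp_norm q (frac_ext \<alpha> f) \<le> ennreal C * (\<Prod>k\<in>UNIV. hardy_norm (N k) (P k) (f k))" .
    have "mixed_norm q (frac_majorant N a f) \<le> C2 * (\<Prod>k\<in>UNIV. hardy_norm (N k) (P k) (f k))" by (rule C2(2))
    also have "\<dots> < \<infinity>"
    proof -
      have "hardy_norm (N k) (P k) (f k) \<noteq> top" for k using f[of k] by (auto simp: hardy_space_def)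
      then have "(\<Prod>k\<in>UNIV. hardy_norm (N k) (P k) (f k)) < \<infinity>"
        by (simp add: ennreal_prod_eq_top less_top[symmetric])
      then show ?thesis using C2(1) by (simp add: ennreal_mult_less_top)
    qed
    \<comment> \<open>Finiteness of the norm yields more than the bound: the majorant, and with it
      the absolute integral in \<open>s\<close>, is finite almost everywhere.\<close>
    finally have "AE x in lebesgue. frac_majorant N a f x < \<infinity>"
      by (rule mixed_norm_finite_imp_AE_finite[OF frac_majorant_measurable q])
    then show "AE x in lebesgue. integrable lborel (frac_integrand \<alpha> f x)"
    proof eventually_elim
      case (elim x)
      have "integrable lborel (H x)"
      proof (rule integrableI_bounded[OF Hx])
        have "(\<integral>\<^sup>+s. ennreal (norm (H x s)) \<partial>lborel) \<le> C1 * frac_majorant N a f x" by (rule Hn)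
        also have "\<dots> < \<infinity>" using elim C1(1) by (simp add: ennreal_mult_less_top)
        finally show "(\<integral>\<^sup>+s. ennreal (norm (H x s)) \<partial>lborel) < \<infinity>" .
      qed
      then show ?case by (simp only: H_def)
    qed
  qed
  moreover have "0 < C" by (simp add: C_def add_pos_nonneg)
  ultimately show ?thesis unfolding b_def by blast
qed

text \<open>What is at stake is additivity of the integral in \<open>s\<close>, which asks for
  convergence of both terms at this \<open>x\<close>. On the Hardy spaces it therefore holds almost
  everywhere.\<close>

theorem frac_ext_multilinear:
  fixes f :: "'m::finite \<Rightarrow> 'n::{finite,linorder} distribution"
  assumes "integrable lborel (frac_integrand \<alpha> (f(k := u)) x)"
    and "integrable lborel (frac_integrand \<alpha> (f(k := v)) x)"
  shows "frac_ext \<alpha> (f(k := (\<lambda>\<phi>. a * u \<phi> + b * v \<phi>))) x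
    = a * frac_ext \<alpha> (f(k := u)) x + b * frac_ext \<alpha> (f(k := v)) x"
proof -
  have split: "(\<Prod>j\<in>UNIV. (f(k := w)) j \<phi>) = w \<phi> * (\<Prod>j\<in>UNIV - {k}. f j \<phi>)" for w \<phi>
    by (subst prod.remove[of _ k]) (auto intro!: prod.cong)
  have "(LINT s|lborel. frac_integrand \<alpha> (f(k := (\<lambda>\<phi>. a * u \<phi> + b * v \<phi>))) x s)
     = (LINT s|lborel. a * frac_integrand \<alpha> (f(k := u)) x s + b * frac_integrand \<alpha> (f(k := v)) x s)"
    unfolding frac_integrand_def split by (simp add: algebra_simps)
  also have "\<dots> = a * (LINT s|lborel. frac_integrand \<alpha> (f(k := u)) x s)
      + b * (LINT s|lborel. frac_integrand \<alpha> (f(k := v)) x s)"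
    using assms by (subst Bochner_Integration.integral_add) auto
  finally show ?thesis
    unfolding frac_ext_def by (simp only: algebra_simps)
qed

section \<open>Taylor approximation in several variables\<close>

abbreviation monomial :: "('n::finite \<Rightarrow> nat) \<Rightarrow> 'n rvec \<Rightarrow> complex" where
  "monomial \<beta> x \<equiv> complex_of_real (\<Prod>i\<in>UNIV. (x $ i) ^ \<beta> i)"

text \<open>Generated from monomials, so that the vanishing of moments passes to all polynomials of
  degree at most \<open>d\<close> by rule induction.\<close>

inductive poly_le :: "nat \<Rightarrow> ('n::finite rvec \<Rightarrow> complex) \<Rightarrow> bool" for d where
  monom: "(\<Sum>i\<in>UNIV. \<beta> i) \<le> d \<Longrightarrow> poly_le d (\<lambda>x. c * monomial \<beta> x)"
| add: "poly_le d p \<Longrightarrow> poly_le d q \<Longrightarrow> poly_le d (\<lambda>x. p x + q x)"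

lemma poly_le_const: "poly_le d (\<lambda>x. c)"
  using poly_le.monom[of "\<lambda>_. 0" d c] by simp

lemma poly_le_sum: "finite S \<Longrightarrow> (\<And>j. j \<in> S \<Longrightarrow> poly_le d (p j)) \<Longrightarrow> poly_le d (\<lambda>x. \<Sum>j\<in>S. p j x)"
  by (induction S rule: finite_induct) (auto intro: poly_le_const poly_le.add)

lemma poly_le_cmult: "poly_le d p \<Longrightarrow> poly_le d (\<lambda>x. c * p x)"
proof (induction rule: poly_le.induct)
  case (monom \<beta> c')
  then show ?case using poly_le.monom[of \<beta> d "c * c'"] by (simp add: mult.assoc)
next
  case (add p q)
  then show ?case by (simp add: distrib_left poly_le.add)
qed

lemma poly_le_mult_coord:
  fixes p :: "'n::finite rvec \<Rightarrow> complex"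
  shows "poly_le d p \<Longrightarrow> poly_le (d + m) (\<lambda>x. complex_of_real ((x $ i) ^ m) * p x)"
proof (induction rule: poly_le.induct)
  case (monom \<beta> c)
  define \<gamma> where "\<gamma> = \<beta>(i := m + \<beta> i)"
  have "(\<Sum>j\<in>UNIV. \<gamma> j) = m + (\<Sum>j\<in>UNIV. \<beta> j)"
    by (simp add: \<gamma>_def sum.remove[of UNIV i])
  then have "poly_le (d + m) (\<lambda>x. c * monomial \<gamma> x)" using monom by (intro poly_le.monom) auto
  moreover have "(\<Prod>j\<in>UNIV. (x $ j) ^ \<gamma> j) = (x $ i) ^ m * (\<Prod>j\<in>UNIV. (x $ j) ^ \<beta> j)" for x :: "'n rvec"
    by (simp add: \<gamma>_def prod.remove[of UNIV i] power_add mult.assoc)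
  ultimately show ?case by (simp add: mult_ac)
next
  case (add p q)
  then show ?case by (simp add: distrib_left poly_le.add)
qed

text \<open>Setting a coordinate to 0 either keeps a monomial or kills it. The coefficients of an
  expansion in \<open>x $ i\<close> will be taken on this hyperplane.\<close>

lemma poly_le_upd_zero:
  fixes p :: "'n::finite rvec \<Rightarrow> complex"
  shows "poly_le d p \<Longrightarrow> poly_le d (\<lambda>x. p (upd x i 0))"
proof (induction rule: poly_le.induct)
  case (monom \<beta> c)
  show ?case
  proof (cases "\<beta> i = 0")
    case True
    then have "monomial \<beta> (upd x i 0) = monomial \<beta> x" for x :: "'n rvec"
      by (intro arg_cong[where f = complex_of_real] prod.cong) auto
    then show ?thesis using poly_le.monom[OF monom, of c] by (simp only:)
  next
    case False
    then have "monomial \<beta> (upd x i 0) = 0" for x :: "'n rvec"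
      by (simp add: prod.remove[of UNIV i])
    then show ?thesis using poly_le_const[of d 0] by (simp only: mult_zero_right)
  qed
next
  case (add p q)
  then show ?case by (simp add: poly_le.add)
qed

lemma poly_le_continuous: "poly_le d p \<Longrightarrow> continuous_on UNIV p"
  by (induction rule: poly_le.induct) (auto intro!: continuous_intros)

text \<open>The values are complex, so the mean value inequality replaces Lagrange's form of the
  remainder. Induction on \<open>D\<close>: the derivative of the remainder is the remainder of one
  degree less for the shifted family. The bound gives up the factorial.\<close>

lemma taylor_vector_bound:
  fixes h :: "nat \<Rightarrow> real \<Rightarrow> complex"
  assumes "\<And>k t. (h k has_vector_derivative h (Suc k) t) (at t)"
    and "\<And>t. \<bar>t\<bar> \<le> R \<Longrightarrow> cmod (h (Suc D) t) \<le> B" and "\<bar>t\<bar> \<le> R" and "0 \<le> B"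
  shows "cmod (h 0 t - (\<Sum>j\<le>D. complex_of_real (t ^ j / fact j) * h j 0)) \<le> B * \<bar>t\<bar> ^ Suc D"
  using assms(1-3)
proof (induction D arbitrary: h t)
  case 0
  have "norm (h 0 t - h 0 0) \<le> B * norm (t - 0)"
  proof (rule differentiable_bound[of "{- R..R}" "h 0" "\<lambda>t x. x *\<^sub>R h (Suc 0) t"])
    fix s assume "s \<in> {- R..R}"
    then have "cmod (h (Suc 0) s) \<le> B" using 0(2)[of s] by auto
    then show "onorm (\<lambda>x. x *\<^sub>R h (Suc 0) s) \<le> B"
      by (intro onorm_le) (simp add: mult.commute[of B] mult_left_mono)
  qed (use 0 in \<open>auto simp: has_vector_derivative_def intro: has_derivative_at_withinI\<close>)
  then show ?case by simp
next
  case (Suc D)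
  define r where "r s = h 0 s - (\<Sum>j\<le>Suc D. complex_of_real (s ^ j / fact j) * h j 0)" for s
  define r' where "r' s = h (Suc 0) s - (\<Sum>j\<le>D. complex_of_real (s ^ j / fact j) * h (Suc j) 0)" for s
  have der: "(r has_vector_derivative r' s) (at s)" for s
  proof -
    have t: "((\<lambda>s. complex_of_real (s ^ Suc j / fact (Suc j)) * h (Suc j) 0) has_vector_derivative
        complex_of_real (s ^ j / fact j) * h (Suc j) 0) (at s)" for j
    proof -
      have "((\<lambda>s. s ^ Suc j / fact (Suc j)) has_real_derivative s ^ j / fact j) (at s)"
      proof -
        have "((\<lambda>s. s ^ Suc j / fact (Suc j)) has_real_derivative real (Suc j) * s ^ j / fact (Suc j)) (at s)"
          using DERIV_pow[of "Suc j" s] by (intro DERIV_cdivide) simp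
        also have "real (Suc j) * s ^ j / fact (Suc j) = s ^ j / fact j"
          unfolding fact_Suc by (simp del: of_nat_Suc)
        finally show ?thesis .
      qed
      then have "((\<lambda>s. complex_of_real (s ^ Suc j / fact (Suc j))) has_vector_derivative complex_of_real (s ^ j / fact j)) (at s)"
        by (intro has_vector_derivative_of_real) (simp add: has_real_derivative_iff_has_vector_derivative)
      then show ?thesis by (rule has_vector_derivative_mult_left)
    qed
    have "((\<lambda>s. h 0 s - (h 0 0 + (\<Sum>j\<le>D. complex_of_real (s ^ Suc j / fact (Suc j)) * h (Suc j) 0)))
       has_vector_derivative h (Suc 0) s - (0 + (\<Sum>j\<le>D. complex_of_real (s ^ j / fact j) * h (Suc j) 0))) (at s)"
      by (intro has_vector_derivative_diff has_vector_derivative_add has_vector_derivative_const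
          has_vector_derivative_sum t Suc.prems(1))
    moreover have "r = (\<lambda>s. h 0 s - (h 0 0 + (\<Sum>j\<le>D. complex_of_real (s ^ Suc j / fact (Suc j)) * h (Suc j) 0)))"
      unfolding r_def[abs_def] sum.atMost_Suc_shift by simp
    ultimately show ?thesis by (simp add: r'_def)
  qed
  have r': "cmod (r' s) \<le> B * \<bar>s\<bar> ^ Suc D" if "\<bar>s\<bar> \<le> R" for s
    unfolding r'_def using Suc.IH[of "\<lambda>k. h (Suc k)" s] Suc.prems that by simp
  have "norm (r t - r 0) \<le> (B * \<bar>t\<bar> ^ Suc D) * norm (t - 0)"
  proof (rule differentiable_bound[of "{- \<bar>t\<bar>..\<bar>t\<bar>}" r "\<lambda>s x. x *\<^sub>R r' s"])
    fix s assume "s \<in> {- \<bar>t\<bar>..\<bar>t\<bar>}"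
    then have s: "\<bar>s\<bar> \<le> \<bar>t\<bar>" by auto
    then have "cmod (r' s) \<le> B * \<bar>s\<bar> ^ Suc D" using r' Suc.prems(3) by auto
    also have "\<dots> \<le> B * \<bar>t\<bar> ^ Suc D" using s assms(4) by (intro mult_left_mono power_mono) auto
    finally show "onorm (\<lambda>x. x *\<^sub>R r' s) \<le> B * \<bar>t\<bar> ^ Suc D"
      by (intro onorm_le) (simp add: mult.commute[of "B * \<bar>t\<bar> ^ Suc D"] mult_left_mono del: power_Suc)
  qed (use der in \<open>auto simp: has_vector_derivative_def intro: has_derivative_at_withinI\<close>)
  moreover have "r 0 = 0" unfolding r_def sum.atMost_Suc_shift by simp
  ultimately show ?case by (simp add: r_def mult_ac)
qed

lemma smooth_funpow_partial: "smooth g \<Longrightarrow> smooth ((partial i ^^ k) g)"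
  by (induction k) (auto intro: smooth_partial)

text \<open>
  Expanding in one coordinate after the other, in the order in which \<^const>\<open>multi_partial\<close> differentiates,
  avoids any use of the symmetry of mixed derivatives.
\<close>

lemma taylor_coordinatewise:
  fixes xs :: "'n::finite list"
  assumes R: "0 \<le> R" and "distinct xs"
  shows "\<exists>K\<ge>0. \<forall>g B. smooth g \<longrightarrow> 0 \<le> B \<longrightarrow>
    (\<forall>\<beta> z. (\<Sum>i\<in>set xs. \<beta> i) = Suc D \<longrightarrow> (\<forall>i. \<bar>z $ i\<bar> \<le> R) \<longrightarrow> cmod (fold (\<lambda>i. partial i ^^ \<beta> i) xs g z) \<le> B) \<longrightarrow>
    (\<exists>p. poly_le D p \<and> (\<forall>y. (\<forall>i. \<bar>y $ i\<bar> \<le> R) \<longrightarrow> (\<forall>i. i \<notin> set xs \<longrightarrow> y $ i = 0) \<longrightarrow> cmod (g y - p y) \<le> K * B))"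
  using assms(2)
proof (induction xs arbitrary: D)
  case Nil
  show ?case
  proof (intro exI[of _ 0] conjI allI impI)
    fix g :: "'n rvec \<Rightarrow> complex" and B :: real
    \<comment> \<open>With no coordinate left, \<open>y = 0\<close> is the only point to
      consider.\<close>
    have "cmod (g y - g 0) \<le> 0 * B" if "\<forall>i. i \<notin> set [] \<longrightarrow> y $ i = 0" for y
    proof -
      have "y = 0" using that by (simp add: vec_eq_iff)
      then show ?thesis by simp
    qed
    then show "\<exists>p. poly_le D p \<and> (\<forall>y. (\<forall>i. \<bar>y $ i\<bar> \<le> R) \<longrightarrow> (\<forall>i. i \<notin> set [] \<longrightarrow> y $ i = 0) \<longrightarrow> cmod (g y - p y) \<le> 0 * B)"
      using poly_le_const[of D "g 0"] by blast
  qed simp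
next
  case (Cons i xs)
  have d: "distinct xs" and i: "i \<notin> set xs" using Cons.prems by auto
  \<comment> \<open>The degree varies: the coefficient of the \<open>j\<close>-th power of
    \<open>y $ i\<close> is to be approximated in degree \<open>D - j\<close>.\<close>
  have "\<forall>e. \<exists>K\<ge>0. \<forall>g B. smooth g \<longrightarrow> 0 \<le> B \<longrightarrow>
    (\<forall>\<beta> z. (\<Sum>i\<in>set xs. \<beta> i) = Suc e \<longrightarrow> (\<forall>i. \<bar>z $ i\<bar> \<le> R) \<longrightarrow> cmod (fold (\<lambda>i. partial i ^^ \<beta> i) xs g z) \<le> B) \<longrightarrow>
    (\<exists>p. poly_le e p \<and> (\<forall>y. (\<forall>i. \<bar>y $ i\<bar> \<le> R) \<longrightarrow> (\<forall>i. i \<notin> set xs \<longrightarrow> y $ i = 0) \<longrightarrow> cmod (g y - p y) \<le> K * B))"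
    using Cons.IH[OF d] by blast
  from choice[OF this] obtain K where K: "\<And>e. 0 \<le> K e" and IH: "\<And>e g B. smooth g \<Longrightarrow> 0 \<le> B \<Longrightarrow>
    (\<And>\<beta> z. (\<Sum>i\<in>set xs. \<beta> i) = Suc e \<Longrightarrow> (\<forall>i. \<bar>z $ i\<bar> \<le> R) \<Longrightarrow> cmod (fold (\<lambda>i. partial i ^^ \<beta> i) xs g z) \<le> B) \<Longrightarrow>
    \<exists>p. poly_le e p \<and> (\<forall>y. (\<forall>i. \<bar>y $ i\<bar> \<le> R) \<longrightarrow> (\<forall>i. i \<notin> set xs \<longrightarrow> y $ i = 0) \<longrightarrow> cmod (g y - p y) \<le> K e * B)"
    by blast
  \<comment> \<open>The remainder in coordinate \<open>i\<close>, plus the errors of the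
    \<open>D + 1\<close> coefficients.\<close>
  define L where "L = R ^ Suc D + (\<Sum>j\<le>D. R ^ j / fact j * K (D - j))"
  have L: "0 \<le> L" unfolding L_def using R K by (intro add_nonneg_nonneg sum_nonneg) auto
  show ?case
  proof (intro exI[of _ L] conjI L allI impI)
    fix g :: "'n rvec \<Rightarrow> complex" and B :: real
    assume g: "smooth g" and B: "0 \<le> B"
      and bd: "\<forall>\<beta> z. (\<Sum>i\<in>set (i # xs). \<beta> i) = Suc D \<longrightarrow> (\<forall>i. \<bar>z $ i\<bar> \<le> R) \<longrightarrow>
          cmod (fold (\<lambda>i. partial i ^^ \<beta> i) (i # xs) g z) \<le> B"
    define h where "h j = (partial i ^^ j) g" for j
    have hs: "smooth (h j)" for j unfolding h_def by (rule smooth_funpow_partial[OF g])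
    \<comment> \<open>As \<open>i\<close> is not in \<open>xs\<close>, the entry of the multi-index
      at \<open>i\<close> is free and can record the \<open>j\<close> derivatives already
      taken.\<close>
    have fold_eq: "fold (\<lambda>k. partial k ^^ \<beta> k) xs f = fold (\<lambda>k. partial k ^^ (\<beta>(i := j)) k) xs f" for \<beta> j f
      using i by (intro fold_cong) auto
    have hb: "cmod (fold (\<lambda>k. partial k ^^ \<beta> k) xs (h j) z) \<le> B"
      if "(\<Sum>k\<in>set xs. \<beta> k) + j = Suc D" "\<forall>k. \<bar>z $ k\<bar> \<le> R" for \<beta> j z
    proof -
      have "(\<Sum>k\<in>set (i # xs). (\<beta>(i := j)) k) = j + (\<Sum>k\<in>set xs. \<beta> k)"
        using i by (simp add: sum.insert_remove[symmetric]) (intro sum.cong; auto)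
      then have "cmod (fold (\<lambda>k. partial k ^^ (\<beta>(i := j)) k) (i # xs) g z) \<le> B"
        using that by (intro bd[rule_format]) auto
      then show ?thesis by (simp add: h_def fold_eq[where \<beta> = \<beta> and j = j])
    qed
    have "\<forall>j. \<exists>p. j \<le> D \<longrightarrow> poly_le (D - j) p \<and> (\<forall>y. (\<forall>i. \<bar>y $ i\<bar> \<le> R) \<longrightarrow> (\<forall>i. i \<notin> set xs \<longrightarrow> y $ i = 0) \<longrightarrow>
        cmod (h j y - p y) \<le> K (D - j) * B)"
    proof
      fix j
      show "\<exists>p. j \<le> D \<longrightarrow> poly_le (D - j) p \<and> (\<forall>y. (\<forall>i. \<bar>y $ i\<bar> \<le> R) \<longrightarrow> (\<forall>i. i \<notin> set xs \<longrightarrow> y $ i = 0) \<longrightarrow>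
        cmod (h j y - p y) \<le> K (D - j) * B)"
      proof (cases "j \<le> D")
        case True
        then show ?thesis using IH[OF hs[of j] B, of "D - j"] hb by (auto simp: Suc_diff_le)
      qed simp
    qed
    from choice[OF this] obtain p where p: "\<And>j. j \<le> D \<Longrightarrow> poly_le (D - j) (p j)"
      "\<And>j y. j \<le> D \<Longrightarrow> (\<forall>i. \<bar>y $ i\<bar> \<le> R) \<Longrightarrow> (\<forall>i. i \<notin> set xs \<longrightarrow> y $ i = 0) \<Longrightarrow>
        cmod (h j y - p j y) \<le> K (D - j) * B" by blast
    define P where "P y = (\<Sum>j\<le>D. complex_of_real (1 / fact j) * (complex_of_real ((y $ i) ^ j) * p j (upd y i 0)))" for y
    have "poly_le D P"
      unfolding P_def[abs_def]
    proof (intro poly_le_sum poly_le_cmult)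
      fix j assume "j \<in> {..D}"
      then have "poly_le (D - j + j) (\<lambda>x. complex_of_real ((x $ i) ^ j) * p j (upd x i 0))"
        by (intro poly_le_mult_coord poly_le_upd_zero p) simp
      then show "poly_le D (\<lambda>x. complex_of_real ((x $ i) ^ j) * p j (upd x i 0))" using \<open>j \<in> {..D}\<close> by simp
    qed simp
    moreover have "cmod (g y - P y) \<le> L * B"
      if y: "\<forall>k. \<bar>y $ k\<bar> \<le> R" and y0: "\<forall>k. k \<notin> set (i # xs) \<longrightarrow> y $ k = 0" for y
    proof -
      \<comment> \<open>Base point of the expansion along direction \<open>i\<close>; it vanishes in
        all coordinates outside \<open>xs\<close>, as the induction hypothesis demands.\<close>
      define y' where "y' = upd y i 0"
      have yy: "y' + t *\<^sub>R axis i 1 = upd y i t" for t by (auto simp: y'_def vec_eq_iff axis_def)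
      have y'R: "\<forall>k. \<bar>y' $ k\<bar> \<le> R" and y'0: "\<forall>k. k \<notin> set xs \<longrightarrow> y' $ k = 0"
        using y y0 R by (auto simp: y'_def)
      define T where "T = (\<Sum>j\<le>D. complex_of_real ((y $ i) ^ j / fact j) * h j y')"
      have "cmod ((\<lambda>j t. h j (y' + t *\<^sub>R axis i 1)) 0 (y $ i) - (\<Sum>j\<le>D. complex_of_real ((y $ i) ^ j / fact j) *
          (\<lambda>j t. h j (y' + t *\<^sub>R axis i 1)) j 0)) \<le> B * \<bar>y $ i\<bar> ^ Suc D"
      proof (rule taylor_vector_bound[where R = R])
        fix k t
        have "h (Suc k) = partial i (h k)" by (simp add: h_def)
        then show "((\<lambda>t. h k (y' + t *\<^sub>R axis i 1)) has_vector_derivative h (Suc k) (y' + t *\<^sub>R axis i 1)) (at t)"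
          using smooth_line_derivative[OF hs[of k]] by simp
      next
        fix t :: real assume t: "\<bar>t\<bar> \<le> R"
        \<comment> \<open>All \<open>D + 1\<close> derivatives are in direction \<open>i\<close>;
          the remaining orders are 0.\<close>
        have "fold (\<lambda>k. partial k ^^ (\<lambda>_. 0) k) zs f = f" for zs :: "'n list" and f by (induction zs) auto
        then show "cmod (h (Suc D) (y' + t *\<^sub>R axis i 1)) \<le> B"
          using hb[of "\<lambda>_. 0" "Suc D" "y' + t *\<^sub>R axis i 1"] y t unfolding yy by simp
      qed (use y B in auto)
      then have 1: "cmod (g y - T) \<le> B * R ^ Suc D"
      proof -
        assume *: "cmod ((\<lambda>j t. h j (y' + t *\<^sub>R axis i 1)) 0 (y $ i) - (\<Sum>j\<le>D. complex_of_real ((y $ i) ^ j / fact j) *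
          (\<lambda>j t. h j (y' + t *\<^sub>R axis i 1)) j 0)) \<le> B * \<bar>y $ i\<bar> ^ Suc D"
        have "upd y i (y $ i) = y" by (simp add: vec_eq_iff)
        then have "cmod (g y - T) \<le> B * \<bar>y $ i\<bar> ^ Suc D"
          using * unfolding yy by (simp add: T_def y'_def h_def)
        also have "\<dots> \<le> B * R ^ Suc D" using y B by (intro mult_left_mono power_mono) auto
        finally show ?thesis .
      qed
      have "T - P y = (\<Sum>j\<le>D. complex_of_real ((y $ i) ^ j / fact j) * (h j y' - p j y'))"
        by (simp add: T_def P_def y'_def sum_subtractf[symmetric] algebra_simps)
      then have "cmod (T - P y) \<le> (\<Sum>j\<le>D. cmod (complex_of_real ((y $ i) ^ j / fact j) * (h j y' - p j y')))"
        by (simp add: norm_sum)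
      also have "\<dots> \<le> (\<Sum>j\<le>D. R ^ j / fact j * (K (D - j) * B))"
      proof (rule sum_mono)
        fix j assume "j \<in> {..D}"
        then have "cmod (h j y' - p j y') \<le> K (D - j) * B" using p(2)[OF _ y'R y'0] by simp
        moreover have "cmod (complex_of_real ((y $ i) ^ j / fact j)) \<le> R ^ j / fact j"
          using y by (simp add: norm_divide norm_power divide_right_mono power_mono)
        ultimately show "cmod (complex_of_real ((y $ i) ^ j / fact j) * (h j y' - p j y')) \<le> R ^ j / fact j * (K (D - j) * B)"
          unfolding norm_mult using R by (intro mult_mono) auto
      qed
      finally have 2: "cmod (T - P y) \<le> (\<Sum>j\<le>D. R ^ j / fact j * (K (D - j) * B))" .
      have "cmod (g y - P y) \<le> cmod (g y - T) + cmod (T - P y)"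
        using norm_triangle_ineq[of "g y - T" "T - P y"] by simp
      also have "\<dots> \<le> B * R ^ Suc D + (\<Sum>j\<le>D. R ^ j / fact j * (K (D - j) * B))" using 1 2 by (rule add_mono)
      also have "\<dots> = L * B"
        by (simp add: L_def distrib_right sum_distrib_right mult.assoc mult.commute[of B "R ^ Suc D"] del: power_Suc)
      finally show ?thesis .
    qed
    ultimately show "\<exists>p. poly_le D p \<and> (\<forall>y. (\<forall>k. \<bar>y $ k\<bar> \<le> R) \<longrightarrow> (\<forall>k. k \<notin> set (i # xs) \<longrightarrow> y $ k = 0) \<longrightarrow> cmod (g y - p y) \<le> L * B)"
      by blast
  qed
qed

corollary multivariate_taylor:
  fixes R :: real
  assumes R: "0 \<le> R"
  obtains K where "0 \<le> K" "\<And>(g :: 'n::{finite,linorder} rvec \<Rightarrow> complex) B. smooth g \<Longrightarrow> 0 \<le> B \<Longrightarrow>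
    (\<And>\<beta> z. (\<Sum>i\<in>UNIV. \<beta> i) = Suc D \<Longrightarrow> (\<And>i. \<bar>z $ i\<bar> \<le> R) \<Longrightarrow> cmod (multi_partial \<beta> g z) \<le> B) \<Longrightarrow>
    \<exists>p. poly_le D p \<and> (\<forall>y. (\<forall>i. \<bar>y $ i\<bar> \<le> R) \<longrightarrow> cmod (g y - p y) \<le> K * B)"
  using taylor_coordinatewise[OF R, of "sorted_list_of_set (UNIV :: 'n set)" D]
  unfolding multi_partial_def by (auto intro: that)

section \<open>Maximal functions of atoms\<close>

lemma bounded_supported_mult:
  fixes f :: "'n::finite rvec \<Rightarrow> complex"
  assumes f: "bounded_supported A R f" and h: "h \<in> borel_measurable borel"
    and hB: "\<And>x. x \<in> cball 0 R \<Longrightarrow> cmod (h x) \<le> B"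
  shows "integrable lebesgue (\<lambda>x. f x * h x)"
    and "cmod (LINT x|lebesgue. f x * h x) \<le> A * B * measure lborel (cball (0::'n rvec) R)"
proof -
  have m: "f \<in> borel_measurable lebesgue" and A: "0 \<le> A" and AE: "AE x in lebesgue. cmod (f x) \<le> A"
    and supp: "\<And>x. x \<notin> cball 0 R \<Longrightarrow> f x = 0" using f by (auto simp: bounded_supported_def)
  have fm: "(\<lambda>x. f x * h x) \<in> borel_measurable lebesgue"
    by (rule borel_measurable_times[OF m measurable_completion]) (use h in simp)
  have le: "AE x in lebesgue. norm (f x * h x) \<le> A * B * indicator (cball 0 R) x"
    using AE
  proof eventually_elim
    case (elim x)
    then show ?case using supp[of x] hB[of x] A by (auto simp: indicator_def norm_mult intro: mult_mono)
  qed
  have fin: "emeasure lborel (cball (0::'n rvec) R) < \<infinity>" by (rule emeasure_lborel_cball_finite)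
  have int: "integrable lebesgue (\<lambda>x. A * B * indicator (cball (0::'n rvec) R) x :: real)"
    using fin by (intro integrable_mult_right) (auto simp: integrable_indicator_iff emeasure_completion)
  show 1: "integrable lebesgue (\<lambda>x. f x * h x)"
    by (rule Bochner_Integration.integrable_bound[OF int fm]) (use le in \<open>eventually_elim, auto\<close>)
  have "norm (LINT x|lebesgue. f x * h x) \<le> (LINT x|lebesgue. norm (f x * h x))"
    by (rule integral_norm_bound)
  also have "\<dots> \<le> (LINT x|lebesgue. A * B * indicator (cball (0::'n rvec) R) x)"
    by (rule integral_mono_AE[OF integrable_norm[OF 1] int le])
  also have "\<dots> = A * B * measure lborel (cball (0::'n rvec) R)"
    by (simp add: measure_completion)
  finally show "cmod (LINT x|lebesgue. f x * h x) \<le> A * B * measure lborel (cball (0::'n rvec) R)" .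
qed

lemma bounded_supported_mult_continuous:
  fixes f :: "'n::finite rvec \<Rightarrow> complex"
  assumes f: "bounded_supported A R f" and h: "continuous_on UNIV h"
  shows "integrable lebesgue (\<lambda>x. f x * h x)"
proof -
  have "bounded (h ` cball 0 R)"
    by (intro compact_imp_bounded compact_continuous_image continuous_on_subset[OF h]) auto
  then obtain B where "\<And>x. x \<in> cball 0 R \<Longrightarrow> cmod (h x) \<le> B" unfolding bounded_iff by blast
  then show ?thesis by (rule bounded_supported_mult(1)[OF f borel_measurable_continuous_onI[OF h]])
qed

lemma schwartz_norm_0_ge: "\<phi> \<in> schwartz \<Longrightarrow> cmod (\<phi> x) \<le> schwartz_norm 0 \<phi>"
  using schwartz_norm_ge[of \<phi> "\<lambda>_. 0" 0 x] by (simp add: multi_partial_0)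

lemma distr_of_tempered:
  assumes f: "bounded_supported A R f"
  shows "distr_of f \<in> tempered"
proof -
  have int: "integrable lebesgue (\<lambda>x. f x * \<phi> x)" if "\<phi> \<in> schwartz" for \<phi>
    using bounded_supported_mult(1)[OF f schwartz_borel_measurable[OF that]] schwartz_norm_0_ge[OF that] by blast
  have "distr_of f (\<lambda>x. a * \<phi> x + b * \<psi> x) = a * distr_of f \<phi> + b * distr_of f \<psi>"
    if \<phi>: "\<phi> \<in> schwartz" and \<psi>: "\<psi> \<in> schwartz" for \<phi> \<psi> a b
  proof -
    have "distr_of f (\<lambda>x. a * \<phi> x + b * \<psi> x) = (LINT x|lebesgue. a * (f x * \<phi> x) + b * (f x * \<psi> x))"
      using schwartz_lincomb[OF \<phi> \<psi>] by (simp add: distr_of_def algebra_simps)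
    also have "\<dots> = a * (LINT x|lebesgue. f x * \<phi> x) + b * (LINT x|lebesgue. f x * \<psi> x)"
      using int[OF \<phi>] int[OF \<psi>] by (subst Bochner_Integration.integral_add) auto
    finally show ?thesis using \<phi> \<psi> by (simp add: distr_of_def)
  qed
  moreover have "cmod (distr_of f \<phi>) \<le> (A * measure lborel (cball (0::'a rvec) R)) * schwartz_norm 0 \<phi>" if \<phi>: "\<phi> \<in> schwartz" for \<phi>
    using bounded_supported_mult(2)[OF f schwartz_borel_measurable[OF \<phi>], of "schwartz_norm 0 \<phi>"] schwartz_norm_0_ge[OF \<phi>] \<phi>
    by (simp add: distr_of_def mult_ac)
  ultimately show ?thesis
    unfolding tempered_def mem_Collect_eq
    by (intro conjI exI[of _ "A * measure lborel (cball (0::'a rvec) R)"] exI[of _ 0])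
       (auto simp: distr_of_def[of f])
qed

definition vanishing_moments :: "nat \<Rightarrow> ('n::finite rvec \<Rightarrow> complex) \<Rightarrow> bool" where
  "vanishing_moments D f \<longleftrightarrow> (\<forall>\<beta>. (\<Sum>i\<in>UNIV. \<beta> i) \<le> D \<longrightarrow> (LINT x|lebesgue. f x * monomial \<beta> x) = 0)"

lemma vanishing_moments_poly:
  fixes f :: "'n::finite rvec \<Rightarrow> complex"
  assumes f: "bounded_supported A R f" and v: "vanishing_moments D f" and p: "poly_le D p"
  shows "(LINT x|lebesgue. f x * p x) = 0"
  using p
proof (induction rule: poly_le.induct)
  case (monom \<beta> c)
  have "(LINT x|lebesgue. f x * (c * monomial \<beta> x)) = (LINT x|lebesgue. c * (f x * monomial \<beta> x))"
    by (simp add: mult_ac)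
  also have "\<dots> = 0" using v monom by (simp add: vanishing_moments_def)
  finally show ?case .
next
  case (add p q)
  have int: "integrable lebesgue (\<lambda>x. f x * r x)" if "poly_le D r" for r
    by (rule bounded_supported_mult_continuous[OF f poly_le_continuous[OF that]])
  have "(LINT x|lebesgue. f x * (p x + q x)) = (LINT x|lebesgue. f x * p x + f x * q x)"
    by (simp add: distrib_left)
  also have "\<dots> = 0" using add int by (subst Bochner_Integration.integral_add) auto
  finally show ?case .
qed

lemma grand_maximal_le:
  assumes "\<And>t \<psi>. 0 < t \<Longrightarrow> \<psi> \<in> schwartz \<Longrightarrow> schwartz_norm N \<psi> \<le> 1 \<Longrightarrow> cmod (convolve (dilate t \<psi>) u x) \<le> B"
  shows "grand_maximal N u x \<le> ennreal B"
  unfolding grand_maximal_def using assms by (intro SUP_least) (auto intro!: ennreal_leI)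

lemma schwartz_decay:
  assumes \<psi>: "\<psi> \<in> schwartz" "schwartz_norm N \<psi> \<le> 1" and \<beta>: "(\<Sum>i\<in>UNIV. \<beta> i) \<le> N" and K: "K \<le> N"
  shows "cmod (multi_partial \<beta> \<psi> z) \<le> (1 + norm z) powr (- real K)"
proof -
  have z: "1 \<le> 1 + norm z" "0 < 1 + norm z" by (simp, smt (verit) norm_ge_zero)
  have "(1 + norm z) ^ K * cmod (multi_partial \<beta> \<psi> z) \<le> (1 + norm z) ^ N * cmod (multi_partial \<beta> \<psi> z)"
    using z K by (intro mult_right_mono power_increasing) auto
  also have "\<dots> \<le> 1" using schwartz_norm_ge[OF \<psi>(1) \<beta>, of z] \<psi>(2) by simp
  finally show ?thesis using z by (simp add: powr_minus powr_realpow field_simps)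
qed

text \<open>Dilation preserves the integral of the modulus of \<open>\<psi>\<close>, which is
  dominated by the integral of \<open>(1 + norm z) powr (- N)\<close>, finite because
  \<open>n < N\<close>. The bound is thus independent of \<open>t\<close>, \<open>\<psi>\<close> and
  \<open>x\<close>.\<close>

lemma convolve_bounded:
  fixes f :: "'n::{finite,linorder} rvec \<Rightarrow> complex"
  assumes f: "bounded_supported A R f" and N: "CARD('n) < N"
  shows "\<exists>B\<ge>0. \<forall>t \<psi> x. 0 < t \<longrightarrow> \<psi> \<in> schwartz \<longrightarrow> schwartz_norm N \<psi> \<le> 1 \<longrightarrow>
    cmod (convolve (dilate t \<psi>) (distr_of f) x) \<le> B"
proof -
  define I where "I = (\<integral>\<^sup>+z. ennreal ((1 + norm (z :: 'n rvec)) powr (- real N)) \<partial>lborel)"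
  have I: "I < \<infinity>" unfolding I_def using N by (intro nn_integral_decay_finite) simp
  have A: "0 \<le> A" and fm: "f \<in> borel_measurable lebesgue" using f by (auto simp: bounded_supported_def)
  obtain g where g [measurable]: "g \<in> borel_measurable borel" and fg: "AE x in lebesgue. f x = g x"
    and gb: "\<And>x. cmod (g x) \<le> A * indicator (cball 0 R) x"
    by (metis borel_representative[OF f])
  have "cmod (convolve (dilate t \<psi>) (distr_of f) x) \<le> A * enn2real I"
    if t: "0 < t" and \<psi>: "\<psi> \<in> schwartz" "schwartz_norm N \<psi> \<le> 1" for t \<psi> x
  proof -
    have [measurable]: "\<psi> \<in> borel_measurable borel" by (rule schwartz_borel_measurable[OF \<psi>(1)])
    have \<psi>d: "cmod (\<psi> z) \<le> (1 + norm z) powr (- real N)" for z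
      using schwartz_decay[OF \<psi>, of "\<lambda>_. 0" N z] by (simp add: multi_partial_0)
    have s: "(\<lambda>y. dilate t \<psi> (x - y)) \<in> schwartz" by (rule dilate_reflected_schwartz[OF \<psi>(1) t])
    have [measurable]: "dilate t \<psi> \<in> borel_measurable borel" unfolding dilate_def[abs_def] by measurable
    define h where "h y = cmod (\<psi> ((x - y) /\<^sub>R t))" for y
    have h [measurable]: "h \<in> borel_measurable borel" unfolding h_def by measurable
    have "(\<integral>\<^sup>+y. ennreal (h y) \<partial>lborel) = ennreal (t ^ CARD('n)) * (\<integral>\<^sup>+y. ennreal (h (x + t *\<^sub>R y)) \<partial>lborel)"
      using nn_integral_lborel_affine[of "\<lambda>y. ennreal (h y)" t x] t by simp
    also have "(\<integral>\<^sup>+y. ennreal (h (x + t *\<^sub>R y)) \<partial>lborel) \<le> I"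
      unfolding I_def h_def using t \<psi>d by (intro nn_integral_mono ennreal_leI) (simp add: \<psi>d[of "- _", simplified])
    finally have hI: "(\<integral>\<^sup>+y. ennreal (h y) \<partial>lborel) \<le> ennreal (t ^ CARD('n)) * I" by (simp add: mult_left_mono)
    have "ennreal (cmod (convolve (dilate t \<psi>) (distr_of f) x)) = ennreal (cmod (LINT y|lborel. g y * dilate t \<psi> (x - y)))"
      unfolding convolve_def distr_of_borel[OF fm g fg s] ..
    also have "\<dots> \<le> (\<integral>\<^sup>+y. ennreal (cmod (g y * dilate t \<psi> (x - y))) \<partial>lborel)"
    proof (cases "integrable lborel (\<lambda>y. g y * dilate t \<psi> (x - y))")
      case True
      then show ?thesis by (rule integral_norm_bound_ennreal)
    qed (simp add: not_integrable_integral_eq)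
    also have "\<dots> \<le> (\<integral>\<^sup>+y. ennreal (A / t ^ CARD('n)) * ennreal (h y) \<partial>lborel)"
    proof (rule nn_integral_mono)
      fix y
      have "cmod (g y) \<le> A" using gb[of y] A by (cases "norm y \<le> R") auto
      then have "cmod (g y) * cmod (dilate t \<psi> (x - y)) \<le> A * (1 / t ^ CARD('n) * h y)"
        using A t by (intro mult_mono) (auto simp: dilate_def h_def norm_mult norm_divide norm_power)
      then show "ennreal (cmod (g y * dilate t \<psi> (x - y))) \<le> ennreal (A / t ^ CARD('n)) * ennreal (h y)"
        using A t by (simp add: ennreal_mult[symmetric] h_def norm_mult ennreal_leI)
    qed
    also have "\<dots> = ennreal (A / t ^ CARD('n)) * (\<integral>\<^sup>+y. ennreal (h y) \<partial>lborel)"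
      by (rule nn_integral_cmult) simp
    also have "\<dots> \<le> ennreal (A / t ^ CARD('n)) * (ennreal (t ^ CARD('n)) * I)"
      by (intro mult_left_mono hI) simp
    also have "\<dots> = ennreal A * I"
      using t A by (simp add: mult.assoc[symmetric] ennreal_mult[symmetric])
    also have "\<dots> = ennreal (A * enn2real I)" using I A by (simp add: ennreal_mult less_top)
    finally show ?thesis using A by (simp add: ennreal_le_iff)
  qed
  then show ?thesis using A by (intro exI[of _ "A * enn2real I"]) auto
qed

text \<open>The moments annihilate the Taylor polynomial of degree \<open>D\<close> of the dilated
  kernel in \<open>y\<close>. Its derivatives of order \<open>D + 1\<close> scale like
  \<open>t powr (- (n + D + 1))\<close>, and decay of \<open>\<psi>\<close> of the same order at
  \<open>(x - y) / t\<close> cancels this exactly, leaving \<open>norm (x - y)\<close> to the power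
  \<open>- (n + D + 1)\<close>; hence the requirement on \<open>N\<close>. If \<open>norm x\<close>
  is at least \<open>2 * n * R + 1\<close>, then \<open>norm (x - z) \<ge> norm x / 2\<close> for
  every \<open>z\<close> with coordinates bounded by \<open>R\<close>.\<close>

lemma convolve_decay:
  fixes f :: "'n::{finite,linorder} rvec \<Rightarrow> complex"
  assumes f: "bounded_supported A R f" and R: "0 \<le> R" and v: "vanishing_moments D f" and N: "CARD('n) + D + 1 \<le> N"
  shows "\<exists>B\<ge>0. \<forall>t \<psi> x. 0 < t \<longrightarrow> \<psi> \<in> schwartz \<longrightarrow> schwartz_norm N \<psi> \<le> 1 \<longrightarrow> 2 * real CARD('n) * R + 1 \<le> norm x \<longrightarrow>
    cmod (convolve (dilate t \<psi>) (distr_of f) x) \<le> B * norm x powr (- real (CARD('n) + D + 1))"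
proof -
  define K0 where "K0 = CARD('n) + D + 1"
  obtain K where K: "0 \<le> K" "\<And>(g :: 'n rvec \<Rightarrow> complex) B. smooth g \<Longrightarrow> 0 \<le> B \<Longrightarrow>
    (\<And>\<beta> z. (\<Sum>i\<in>UNIV. \<beta> i) = Suc D \<Longrightarrow> (\<And>i. \<bar>z $ i\<bar> \<le> R) \<Longrightarrow> cmod (multi_partial \<beta> g z) \<le> B) \<Longrightarrow>
    \<exists>p. poly_le D p \<and> (\<forall>y. (\<forall>i. \<bar>y $ i\<bar> \<le> R) \<longrightarrow> cmod (g y - p y) \<le> K * B)"
    using multivariate_taylor[OF R, where D = D and 'n = 'n] by blast
  have A: "0 \<le> A" using f by (simp add: bounded_supported_def)
  define V where "V = measure lborel (cball (0::'n rvec) R)"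
  define B where "B = A * K * 2 ^ K0 * V"
  have "cmod (convolve (dilate t \<psi>) (distr_of f) x) \<le> B * norm x powr (- real K0)"
    if t: "0 < t" and \<psi>: "\<psi> \<in> schwartz" "schwartz_norm N \<psi> \<le> 1" and x: "2 * real CARD('n) * R + 1 \<le> norm x" for t \<psi> x
  proof -
    have "0 \<le> 2 * real CARD('n) * R" using R by simp
    then have x0: "0 < norm x" using x by linarith
    define g where "g y = dilate t \<psi> (x - y)" for y
    have gs: "g \<in> schwartz" unfolding g_def[abs_def] by (rule dilate_reflected_schwartz[OF \<psi>(1) t])
    have g_eq: "g = (\<lambda>y. complex_of_real (1 / t ^ CARD('n)) * \<psi> ((- inverse t) *\<^sub>R y + x /\<^sub>R t))"
      by (simp add: g_def[abs_def] dilate_def scaleR_diff_right)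
    define b where "b = (norm x / 2) powr (- real K0)"
    have gb: "cmod (multi_partial \<beta> g z) \<le> b" if \<beta>: "(\<Sum>i\<in>UNIV. \<beta> i) = Suc D" and z: "\<And>i. \<bar>z $ i\<bar> \<le> R" for \<beta> z
    proof -
      have "norm z \<le> (\<Sum>i\<in>UNIV. \<bar>z $ i\<bar>)" by (rule norm_le_l1_cart)
      also have "\<dots> \<le> (\<Sum>i\<in>(UNIV::'n set). R)" by (rule sum_mono) (rule z)
      finally have "norm z \<le> norm x / 2" using x by simp
      then have xz: "norm x / 2 \<le> norm (x - z)" using norm_triangle_ineq2[of x z] by linarith
      define w where "w = (- inverse t) *\<^sub>R z + x /\<^sub>R t"
      have w: "norm w = norm (x - z) / t"
      proof -
        have "w = (x - z) /\<^sub>R t" by (simp add: w_def scaleR_diff_right)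
        then show ?thesis using t by (simp add: divide_inverse)
      qed
      have "0 < norm (x - z)" using xz x0 by linarith
      then have w0: "0 < norm w" using w t by simp
      have "cmod (multi_partial \<beta> \<psi> w) \<le> (1 + norm w) powr (- real K0)"
        using \<beta> N by (intro schwartz_decay[OF \<psi>]) (auto simp: K0_def)
      \<comment> \<open>Dropping the 1 leaves a pure power, so that the powers of \<open>t\<close>
        cancel.\<close>
      also have "\<dots> \<le> norm w powr (- real K0)" using w0 by (intro powr_mono2') auto
      finally have d: "cmod (multi_partial \<beta> \<psi> w) \<le> norm w powr (- real K0)" .
      have "multi_partial \<beta> g z = (complex_of_real (1 / t ^ CARD('n)) * complex_of_real (- inverse t) ^ Suc D) * multi_partial \<beta> \<psi> w"
        unfolding g_eq multi_partial_affine[OF schwartz_smooth[OF \<psi>(1)]] \<beta> w_def ..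
      then have "cmod (multi_partial \<beta> g z) = (1 / t ^ CARD('n)) * (1 / t ^ Suc D) * cmod (multi_partial \<beta> \<psi> w)"
        using t by (simp add: norm_mult norm_power norm_divide norm_inverse power_inverse divide_inverse del: power_Suc)
      also have "(1 / t ^ CARD('n)) * (1 / t ^ Suc D) = t powr (- real K0)"
        using t by (simp add: powr_minus powr_realpow K0_def power_add divide_inverse del: of_nat_add of_nat_Suc)
      also have "t powr (- real K0) * cmod (multi_partial \<beta> \<psi> w) \<le> t powr (- real K0) * norm w powr (- real K0)"
        by (intro mult_left_mono d) simp
      also have "\<dots> = norm (x - z) powr (- real K0)"
        using t by (simp add: w powr_divide)
      also have "\<dots> \<le> b" unfolding b_def using xz x0 by (intro powr_mono2') auto
      finally show ?thesis .
    qed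
    have b0: "0 \<le> b" by (simp add: b_def)
    obtain p where p: "poly_le D p" "\<And>y. (\<And>i. \<bar>y $ i\<bar> \<le> R) \<Longrightarrow> cmod (g y - p y) \<le> K * b"
      using K(2)[OF schwartz_smooth[OF gs] b0 gb] by blast
    have gp: "cmod (g y - p y) \<le> K * b" if "y \<in> cball 0 R" for y
      using that component_le_norm_cart[of y] by (intro p(2)) (auto intro: order_trans)
    have pm: "p \<in> borel_measurable borel" by (rule borel_measurable_continuous_onI[OF poly_le_continuous[OF p(1)]])
    have gm: "g \<in> borel_measurable borel" by (rule schwartz_borel_measurable[OF gs])
    have ip: "integrable lebesgue (\<lambda>y. f y * p y)"
      by (rule bounded_supported_mult_continuous[OF f poly_le_continuous[OF p(1)]])
    have ig: "integrable lebesgue (\<lambda>y. f y * g y)"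
      using bounded_supported_mult(1)[OF f gm] schwartz_norm_0_ge[OF gs] by blast
    have "convolve (dilate t \<psi>) (distr_of f) x = (LINT y|lebesgue. f y * g y)"
      using gs by (simp add: convolve_def distr_of_def g_def[abs_def])
    also have "\<dots> = (LINT y|lebesgue. f y * g y) - (LINT y|lebesgue. f y * p y)"
      using vanishing_moments_poly[OF f v p(1)] by simp
    also have "\<dots> = (LINT y|lebesgue. f y * (g y - p y))"
      using ig ip by (subst Bochner_Integration.integral_diff[symmetric]) (auto simp: right_diff_distrib)
    finally have "cmod (convolve (dilate t \<psi>) (distr_of f) x) \<le> A * (K * b) * V"
      unfolding V_def using bounded_supported_mult(2)[OF f borel_measurable_diff[OF gm pm] gp] by simp
    also have "\<dots> = B * norm x powr (- real K0)"
    proof -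
      have "b = norm x powr (- real K0) / 2 powr (- real K0)" unfolding b_def using x0 by (simp add: powr_divide)
      also have "\<dots> = 2 ^ K0 * norm x powr (- real K0)" by (simp add: powr_minus_divide[of 2] powr_realpow)
      finally show ?thesis by (simp add: B_def)
    qed
    finally show ?thesis .
  qed
  moreover have "0 \<le> B" using A K(1) by (simp add: B_def V_def)
  ultimately show ?thesis unfolding K0_def by blast
qed

lemma grand_maximal_decay:
  fixes f :: "'n::{finite,linorder} rvec \<Rightarrow> complex"
  assumes f: "bounded_supported A R f" and R: "0 \<le> R" and v: "vanishing_moments D f" and N: "CARD('n) + D + 1 \<le> N"
  shows "\<exists>B\<ge>0. \<forall>x. grand_maximal N (distr_of f) x \<le> ennreal B * ennreal ((1 + norm x) powr (- real (CARD('n) + D + 1)))"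
proof -
  define K where "K = real (CARD('n) + D + 1)"
  obtain B1 where B1: "0 \<le> B1" "\<And>t \<psi> x. 0 < t \<Longrightarrow> \<psi> \<in> schwartz \<Longrightarrow> schwartz_norm N \<psi> \<le> 1 \<Longrightarrow>
    cmod (convolve (dilate t \<psi>) (distr_of f) x) \<le> B1"
    using convolve_bounded[OF f, of N] N by auto
  obtain B2 where B2: "0 \<le> B2" "\<And>t \<psi> x. 0 < t \<Longrightarrow> \<psi> \<in> schwartz \<Longrightarrow> schwartz_norm N \<psi> \<le> 1 \<Longrightarrow>
    2 * real CARD('n) * R + 1 \<le> norm x \<Longrightarrow> cmod (convolve (dilate t \<psi>) (distr_of f) x) \<le> B2 * norm x powr (- K)"
    using convolve_decay[OF f R v N] unfolding K_def by blast
  define r where "r = 2 * real CARD('n) * R + 1"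
  have r: "1 \<le> r" using R by (simp add: r_def)
  \<comment> \<open>The first term serves \<open>norm x < r\<close>, the second
    \<open>norm x \<ge> r\<close>, where \<open>norm x\<close> is at least
    \<open>(1 + norm x) / 2\<close>.\<close>
  define B where "B = B1 * (1 + r) powr K + B2 * 2 powr K"
  have "cmod (convolve (dilate t \<psi>) (distr_of f) x) \<le> B * (1 + norm x) powr (- K)"
    if t: "0 < t" and \<psi>: "\<psi> \<in> schwartz" "schwartz_norm N \<psi> \<le> 1" for t \<psi> x
  proof (cases "r \<le> norm x")
    case True
    have K0: "0 \<le> K" by (simp add: K_def)
    have "norm x powr (- K) \<le> ((1 + norm x) / 2) powr (- K)"
      using True r K0 by (intro powr_mono2') auto
    also have "\<dots> = 2 powr K * (1 + norm x) powr (- K)" by (simp add: powr_divide powr_minus_divide)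
    finally have "B2 * norm x powr (- K) \<le> B2 * (2 powr K * (1 + norm x) powr (- K))"
      using B2(1) by (rule mult_left_mono)
    also have "\<dots> \<le> B * (1 + norm x) powr (- K)"
      using B1(1) by (simp add: B_def distrib_right mult.assoc)
    finally show ?thesis using B2(2)[OF t \<psi>, of x] True by (simp add: r_def)
  next
    case False
    have pos: "0 < 1 + norm x" by (smt (verit) norm_ge_zero)
    have "(1 + norm x) powr K \<le> (1 + r) powr K"
      using False by (intro powr_mono2) (auto simp: K_def)
    then have "1 \<le> (1 + r) powr K * (1 + norm x) powr (- K)"
      using pos by (simp add: powr_minus field_simps)
    then have "B1 * 1 \<le> B1 * ((1 + r) powr K * (1 + norm x) powr (- K))" using B1(1) by (rule mult_left_mono)
    also have "\<dots> \<le> B * (1 + norm x) powr (- K)"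
      using B2(1) by (simp add: B_def distrib_right mult.assoc)
    finally show ?thesis using B1(2)[OF t \<psi>, of x] by simp
  qed
  then have "grand_maximal N (distr_of f) x \<le> ennreal (B * (1 + norm x) powr (- K))" for x
    by (intro grand_maximal_le)
  moreover have "0 \<le> B" using B1(1) B2(1) by (simp add: B_def)
  ultimately show ?thesis unfolding K_def by (intro exI[of _ B]) (auto simp: ennreal_mult)
qed

lemma distr_of_hardy:
  fixes f :: "'n::{finite,linorder} rvec \<Rightarrow> complex"
  assumes f: "bounded_supported A R f" and R: "0 \<le> R" and v: "vanishing_moments D f" and N: "CARD('n) + D + 1 \<le> N"
    and p: "\<And>i. 0 < p i" and Dp: "\<And>i. real CARD('n) / p i < real (CARD('n) + D + 1)"
  shows "distr_of f \<in> hardy_space N p"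
proof -
  obtain B where B: "\<And>x. grand_maximal N (distr_of f) x \<le> ennreal B * ennreal ((1 + norm x) powr (- real (CARD('n) + D + 1)))"
    using grand_maximal_decay[OF f R v N] by blast
  have "hardy_norm N p (distr_of f) \<le> mixed_norm p (\<lambda>x. ennreal B * ennreal ((1 + norm x) powr (- real (CARD('n) + D + 1))))"
    unfolding hardy_norm_def by (rule mixed_norm_mono[OF B p])
  also have "\<dots> = ennreal B * mixed_norm p (\<lambda>x. ennreal ((1 + norm x) powr (- real (CARD('n) + D + 1))))"
    by (rule mixed_norm_cmult) (auto simp: p)
  also have "\<dots> < \<infinity>"
    using mixed_norm_decay_finite[where p = p, OF p Dp] by (simp add: ennreal_mult_less_top)
  finally show ?thesis using distr_of_tempered[OF f] by (simp add: hardy_space_def)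
qed

section \<open>Finite sums of atoms\<close>

lemma Lp_norm_cube_pos:
  fixes p :: "'n::{finite,linorder} \<Rightarrow> real"
  assumes p: "\<And>i. 0 < p i" and Q: "cube Q"
  shows "0 < Lp_norm p (indicator Q)"
proof -
  obtain c l where l: "0 < l" and Qc: "Q = cbox c (c + (\<chi> i. l))" using Q by (auto simp: cube_def)
  have eq: "ennreal (cmod (indicator Q x)) = (\<Prod>i\<in>UNIV. indicator {c $ i..c $ i + l} (x $ i))" for x
  proof -
    have "(\<Prod>i\<in>UNIV. (indicator {c $ i..c $ i + l} (x $ i) :: ennreal)) = (if \<forall>i. x $ i \<in> {c $ i..c $ i + l} then 1 else 0)"
      by (auto simp: indicator_def intro!: prod.neutral prod_zero)
    moreover have "(\<forall>i. x $ i \<in> {c $ i..c $ i + l}) \<longleftrightarrow> x \<in> Q"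
      by (simp add: Qc mem_box_cart)
    ultimately show ?thesis by (simp only:) (simp add: indicator_def)
  qed
  have "Lp_norm p (indicator Q) = (\<Prod>i\<in>UNIV. (\<integral>\<^sup>+t. (indicator {c $ i..c $ i + l} t :: ennreal) powe p i \<partial>lborel) powe (1 / p i))"
    unfolding Lp_norm_def eq by (rule mixed_norm_prod) (auto simp: p)
  also have "(\<lambda>i. \<integral>\<^sup>+t. (indicator {c $ i..c $ i + l} t :: ennreal) powe p i \<partial>lborel) = (\<lambda>i. ennreal l)"
  proof
    fix i
    have "(indicator {c $ i..c $ i + l} t :: ennreal) powe p i = indicator {c $ i..c $ i + l} t" for t
      by (simp add: indicator_def)
    then show "(\<integral>\<^sup>+t. (indicator {c $ i..c $ i + l} t :: ennreal) powe p i \<partial>lborel) = ennreal l"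
      using l by simp
  qed
  finally have "Lp_norm p (indicator Q) = (\<Prod>i\<in>UNIV. ennreal l powe (1 / p i))" .
  then have "Lp_norm p (indicator Q) \<noteq> 0" using l by (simp add: prod_zero_iff)
  then show ?thesis by (simp add: zero_less_iff_neq_zero)
qed

lemma bounded_supported_mono:
  "bounded_supported A R f \<Longrightarrow> A \<le> A' \<Longrightarrow> R \<le> R' \<Longrightarrow> bounded_supported A' R' f"
  unfolding bounded_supported_def by (auto elim!: eventually_mono)

lemma bounded_supported_lincomb:
  assumes f: "bounded_supported A R f" and g: "bounded_supported B S g"
  shows "bounded_supported (A + cmod c * B) (max R S) (\<lambda>x. f x + c * g x)"
proof -
  have "AE x in lebesgue. cmod (f x) \<le> A" "AE x in lebesgue. cmod (g x) \<le> B"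
    using f g by (auto simp: bounded_supported_def)
  then have "AE x in lebesgue. cmod (f x + c * g x) \<le> A + cmod c * B"
  proof eventually_elim
    case (elim x)
    have "cmod (f x + c * g x) \<le> cmod (f x) + cmod c * cmod (g x)"
      by (metis norm_mult norm_triangle_ineq)
    also have "\<dots> \<le> A + cmod c * B" using elim by (intro add_mono mult_left_mono) auto
    finally show ?case .
  qed
  moreover have "(\<lambda>x. f x + c * g x) \<in> borel_measurable lebesgue"
    using f g by (intro borel_measurable_add borel_measurable_times borel_measurable_const) (auto simp: bounded_supported_def)
  ultimately show ?thesis using f g by (auto simp: bounded_supported_def)
qed

lemma monomial_continuous: "continuous_on UNIV (monomial \<beta>)"
  using poly_le_continuous[OF poly_le.monom[where \<beta> = \<beta> and c = 1, OF order_refl]] by simp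

lemma vanishing_moments_lincomb:
  fixes f g :: "'n::finite rvec \<Rightarrow> complex"
  assumes f: "bounded_supported A R f" and g: "bounded_supported B S g"
    and vf: "vanishing_moments D f" and vg: "vanishing_moments D g"
  shows "vanishing_moments D (\<lambda>x. f x + c * g x)"
  unfolding vanishing_moments_def
proof (intro allI impI)
  fix \<beta> :: "'n \<Rightarrow> nat" assume \<beta>: "(\<Sum>i\<in>UNIV. \<beta> i) \<le> D"
  have int: "integrable lebesgue (\<lambda>x. h x * monomial \<beta> x)" if "bounded_supported A R h" for h A R
    by (rule bounded_supported_mult_continuous[OF that monomial_continuous])
  have "(LINT x|lebesgue. (f x + c * g x) * monomial \<beta> x)
      = (LINT x|lebesgue. f x * monomial \<beta> x + c * (g x * monomial \<beta> x))"
    by (simp add: distrib_right mult.assoc)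
  also have "\<dots> = (LINT x|lebesgue. f x * monomial \<beta> x) + c * (LINT x|lebesgue. g x * monomial \<beta> x)"
    using int[OF f] int[OF g] by (subst Bochner_Integration.integral_add) auto
  finally show "(LINT x|lebesgue. (f x + c * g x) * monomial \<beta> x) = 0"
    using vf vg \<beta> by (simp add: vanishing_moments_def)
qed

text \<open>The bound in the definition of an atom is the inverse of the norm of a cube. It is
  finite because that norm is positive; in \<open>ennreal\<close>, \<open>inverse 0\<close> is
  \<infinity>.\<close>

lemma atom_bounded_supported:
  fixes p :: "'n::{finite,linorder} \<Rightarrow> real"
  assumes a: "atom p d a" and p: "\<And>i. 0 < p i"
  shows "\<exists>A R. bounded_supported A R a"
proof -
  obtain Q where Q: "cube Q" "\<And>x. x \<notin> Q \<Longrightarrow> a x = 0"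
    "AE x in lebesgue. ennreal (cmod (a x)) \<le> inverse (Lp_norm p (indicator Q))"
    and m: "a \<in> borel_measurable lebesgue"
    using a by (auto simp: atom_def)
  define A where "A = enn2real (inverse (Lp_norm p (indicator Q)))"
  have "inverse (Lp_norm p (indicator Q)) < \<infinity>"
    using Lp_norm_cube_pos[where p = p, OF p Q(1)] by (simp add: less_top[symmetric] ennreal_inverse_eq_top_iff)
  then have A: "inverse (Lp_norm p (indicator Q)) = ennreal A" by (simp add: A_def less_top)
  have "A \<ge> 0" by (simp add: A_def)
  have "AE x in lebesgue. cmod (a x) \<le> A"
    using Q(3) unfolding A by eventually_elim (use \<open>A \<ge> 0\<close> in \<open>simp add: ennreal_le_iff\<close>)
  moreover have "bounded Q" using Q(1) by (auto simp: cube_def bounded_cbox)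
  then obtain R where "Q \<subseteq> cball 0 R" by (metis bounded_subset_ballD ball_subset_cball subset_trans)
  ultimately show ?thesis
    using Q(2) m \<open>A \<ge> 0\<close> unfolding bounded_supported_def by blast
qed

lemma atom_vanishing_moments: "atom p d a \<Longrightarrow> D \<le> d \<Longrightarrow> vanishing_moments D a"
  unfolding atom_def vanishing_moments_def by (meson order_trans)

text \<open>\<open>D\<close> may be smaller than \<open>d\<close>, as every Hardy space has its own
  decay order while \<open>d\<close> is common to all of them.\<close>

lemma atomic_sums_regular:
  fixes p :: "'n::{finite,linorder} \<Rightarrow> real"
  assumes f: "f \<in> atomic_sums p d" and p: "\<And>i. 0 < p i"
  shows "\<exists>A R. bounded_supported A R f" and "D \<le> d \<Longrightarrow> vanishing_moments D f"
proof -
  obtain J :: nat and c a where a: "\<And>j. j < J \<Longrightarrow> atom p d (a j)" and f_eq: "f = (\<lambda>x. \<Sum>j<J. c j * a j x)"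
    using f unfolding atomic_sums_def by blast
  have "(\<exists>A R. bounded_supported A R (\<lambda>x. \<Sum>j<n. c j * a j x)) \<and>
      (D \<le> d \<longrightarrow> vanishing_moments D (\<lambda>x. \<Sum>j<n. c j * a j x))" if "n \<le> J" for n
    using that
  proof (induction n)
    case 0
    have "bounded_supported 0 0 (\<lambda>x :: 'n rvec. 0)" by (simp add: bounded_supported_def)
    then show ?case by (auto simp: vanishing_moments_def)
  next
    case (Suc n)
    obtain A R where f: "bounded_supported A R (\<lambda>x. \<Sum>j<n. c j * a j x)" using Suc by auto
    obtain B S where g: "bounded_supported B S (a n)" using atom_bounded_supported[where p = p, OF a p, of n] Suc.prems by auto
    have "vanishing_moments D (\<lambda>x. (\<Sum>j<n. c j * a j x) + c n * a n x)" if D: "D \<le> d"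
    proof (rule vanishing_moments_lincomb[OF f g])
      show "vanishing_moments D (\<lambda>x. \<Sum>j<n. c j * a j x)" using Suc D by simp
      show "vanishing_moments D (a n)" using atom_vanishing_moments[OF a D] Suc.prems by simp
    qed
    then show ?case using bounded_supported_lincomb[OF f g, of "c n"] by (auto simp: add.commute)
  qed
  from this[of J] show "\<exists>A R. bounded_supported A R f" and "D \<le> d \<Longrightarrow> vanishing_moments D f"
    by (auto simp: f_eq)
qed

text \<open>A number \<open>D\<close> of vanishing moments that brings sums of atoms into the Hardy
  space: the decay \<open>n + D + 1\<close> of the maximal function has to exceed every
  \<open>n / p i\<close>. The sum over \<open>i\<close> is a simple upper bound for the
  maximum.\<close>

definition decay_order :: "('n::finite \<Rightarrow> real) \<Rightarrow> nat" where
  "decay_order p = nat \<lceil>\<Sum>i\<in>UNIV. real CARD('n) / p i\<rceil>"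

lemma decay_order:
  fixes p :: "'n::finite \<Rightarrow> real"
  assumes p: "\<And>i. 0 < p i"
  shows "real CARD('n) / p i < real (CARD('n) + decay_order p + 1)"
proof -
  have "real CARD('n) / p i \<le> (\<Sum>i\<in>UNIV. real CARD('n) / p i)"
    using p by (intro member_le_sum) (auto simp: less_imp_le)
  also have "\<dots> \<le> real (decay_order p)" by (simp add: decay_order_def real_nat_ceiling_ge)
  finally show ?thesis by simp
qed

theorem theorem3p5:
  "\<exists>N\<^sub>0 :: ('n::{finite,linorder} \<Rightarrow> real) \<Rightarrow> nat.
     \<forall>(\<alpha>::real) (p :: 'n \<Rightarrow> real) (q :: 'n \<Rightarrow> real)
       (P :: 'm::finite \<Rightarrow> 'n \<Rightarrow> real) (Q :: 'm \<Rightarrow> 'n \<Rightarrow> real) (N :: 'm \<Rightarrow> nat).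
       0 < \<alpha> \<and> \<alpha> < real CARD('m) * real CARD('n) \<and>
       (\<forall>i. 0 < p i) \<and> (\<forall>i. 0 < q i) \<and> (\<forall>k i. 0 < P k i) \<and> (\<forall>k i. 0 < Q k i) \<and>
       (\<forall>i. 1 / p i = (\<Sum>k\<in>UNIV. 1 / P k i)) \<and>
       (\<forall>i. 1 / q i = (\<Sum>k\<in>UNIV. 1 / Q k i)) \<and>
       (\<forall>k i. Q k i = real CARD('m) * real CARD('n) * P k i
                 / (real CARD('m) * real CARD('n) - \<alpha> * P k i)) \<and>
       (\<forall>k. N\<^sub>0 (P k) \<le> N k)
       \<longrightarrow> extends_to_bounded_operator (frac_int \<alpha>) N P q"
proof (intro exI[of _ "\<lambda>p. CARD('n) + decay_order p + 1"] allI impI, elim conjE)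
  \<comment> \<open>The witness for \<open>N\<^sub>0\<close> is the order of weights and derivatives
    that \<open>convolve_decay\<close> asks for when \<open>D\<close> is the decay order.\<close>
  fix \<alpha> :: real and p q :: "'n \<Rightarrow> real" and P Q :: "'m \<Rightarrow> 'n \<Rightarrow> real" and N :: "'m \<Rightarrow> nat"
  assume \<alpha>: "0 < \<alpha>" "\<alpha> < real CARD('m) * real CARD('n)"
    and q: "\<forall>i. 0 < q i" and P: "\<forall>k i. 0 < P k i" and Q: "\<forall>k i. 0 < Q k i"
    and sum: "\<forall>i. 1 / q i = (\<Sum>k\<in>UNIV. 1 / Q k i)"
    and PQ: "\<forall>k i. Q k i = real CARD('m) * real CARD('n) * P k i / (real CARD('m) * real CARD('n) - \<alpha> * P k i)"
    and N: "\<forall>k. CARD('n) + decay_order (P k) + 1 \<le> N k"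
  define H where "H k = hardy_space (N k) (P k)" for k
  obtain C where C: "0 < C" and bound: "\<And>f. (\<forall>k. f k \<in> H k) \<Longrightarrow>
     Lp_norm q (frac_ext \<alpha> f) \<le> ennreal C * (\<Prod>k\<in>UNIV. hardy_norm (N k) (P k) (f k))"
    and int: "\<And>f. (\<forall>k. f k \<in> H k) \<Longrightarrow> AE x in lebesgue. integrable lborel (frac_integrand \<alpha> f x)"
    using frac_ext_bounded[where P = P and Q = Q and q = q and N = N and \<alpha> = \<alpha>] \<alpha> P Q q sum PQ
    unfolding H_def by blast
  \<comment> \<open>One \<open>d\<close> for all \<open>k\<close>; the sum dominates each decay
    order.\<close>
  define d where "d = (\<Sum>k\<in>UNIV. decay_order (P k))"
  have dk: "decay_order (P k) \<le> d" for k unfolding d_def by (rule member_le_sum) auto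
  show "extends_to_bounded_operator (frac_int \<alpha>) N P q"
    unfolding extends_to_bounded_operator_def H_def[symmetric]
  proof (intro exI[of _ C] exI[of _ d] exI[of _ "frac_ext \<alpha>"] conjI C allI impI)
    fix f assume f: "\<forall>k. f k \<in> H k"
    show b: "Lp_norm q (frac_ext \<alpha> f) \<le> ennreal C * (\<Prod>k\<in>UNIV. hardy_norm (N k) (P k) (f k))"
      by (rule bound[OF f])
    have "hardy_norm (N k) (P k) (f k) \<noteq> top" for k using f[rule_format, of k] by (auto simp: H_def hardy_space_def)
    then have "(\<Prod>k\<in>UNIV. hardy_norm (N k) (P k) (f k)) < \<infinity>"
      by (simp add: ennreal_prod_eq_top less_top[symmetric])
    then have "Lp_norm q (frac_ext \<alpha> f) < \<infinity>"
      using b by (auto simp: ennreal_mult_less_top intro: order.strict_trans1)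
    moreover have "frac_ext \<alpha> f \<in> borel_measurable lebesgue"
    proof -
      have "f k \<in> tempered" for k using f hardy_tempered unfolding H_def by blast
      then have "frac_ext \<alpha> f \<in> borel_measurable borel" by (rule frac_ext_measurable)
      then show ?thesis by (intro measurable_completion) simp
    qed
    ultimately show "frac_ext \<alpha> f \<in> Lp_space q" by (simp add: Lp_space_def)
  next
    fix f k u v a b
    assume f: "\<forall>j. f j \<in> H j" and u: "u \<in> H k" and v: "v \<in> H k"
    have "AE x in lebesgue. integrable lborel (frac_integrand \<alpha> (f(k := u)) x)"
      "AE x in lebesgue. integrable lborel (frac_integrand \<alpha> (f(k := v)) x)"
      by (rule int, use f u v in simp)+
    then show "AE x in lebesgue. frac_ext \<alpha> (f(k := \<lambda>\<phi>. a * u \<phi> + b * v \<phi>)) x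
        = a * frac_ext \<alpha> (f(k := u)) x + b * frac_ext \<alpha> (f(k := v)) x"
      by eventually_elim (rule frac_ext_multilinear)
  next
    fix f k assume f: "\<forall>k. f k \<in> atomic_sums (P k) d"
    obtain A R where "bounded_supported A R (f k)" using atomic_sums_regular(1)[of "f k" "P k" d] f P by blast
    \<comment> \<open>\<open>distr_of_hardy\<close> asks for a nonnegative radius.\<close>
    then have "bounded_supported A \<bar>R\<bar> (f k)" by (rule bounded_supported_mono) auto
    then show "distr_of (f k) \<in> H k"
      unfolding H_def
      using f P N dk by (intro distr_of_hardy[where D = "decay_order (P k)"] atomic_sums_regular(2)[of "f k" "P k" d] decay_order) auto
  next
    fix f assume f: "\<forall>k. f k \<in> atomic_sums (P k) d"
    have "\<forall>k. \<exists>A R. bounded_supported A R (f k)" using atomic_sums_regular(1)[of "f _" "P _" d] f P by blast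
    then obtain A R where AR: "\<And>k. bounded_supported (A k) (R k) (f k)" by metis
    \<comment> \<open>\<open>frac_ext_distr_of\<close> takes one bound and one radius for all
      factors.\<close>
    have "bounded_supported (\<Sum>k\<in>UNIV. A k) (\<Sum>k\<in>UNIV. \<bar>R k\<bar>) (f k)" for k
    proof (rule bounded_supported_mono[OF AR])
      have "0 \<le> A k" for k using AR[of k] by (simp add: bounded_supported_def)
      then show "A k \<le> (\<Sum>k\<in>UNIV. A k)" by (intro member_le_sum) auto
      have "\<bar>R k\<bar> \<le> (\<Sum>k\<in>UNIV. \<bar>R k\<bar>)" by (intro member_le_sum) auto
      then show "R k \<le> (\<Sum>k\<in>UNIV. \<bar>R k\<bar>)" by linarith
    qed
    then have "frac_ext \<alpha> (\<lambda>k. distr_of (f k)) x = frac_int \<alpha> f x" for x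
      by (rule frac_ext_distr_of[OF \<alpha>])
    then show "AE x in lebesgue. frac_ext \<alpha> (\<lambda>k. distr_of (f k)) x = frac_int \<alpha> f x" by simp
  qed
qed

end
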